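(* Let $(Y,S)$ and $(X,T)$ be minimal Cantor systems. The following are equivalent: (1) $(Y,S)$ is a strong speedup of $(X,T)$. (2) There is an exhaustive epimorphism $\varphi:\mathcal{G}(Y,S)\twoheadrightarrow\mathcal{G}(X,T)$ preserving the distinguished order unit. (3) There is a homeomorphism $h:X\to Y$ such that if $f\in\mathrm{cob}(Y,S)$ then $f\circ h\in\mathrm{cob}(X,T)$.
   Context: A Cantor space is a nonempty compact, metrizable, perfect, zero-dimensional space. A minimal Cantor system $(X,T)$ is a Cantor space $X$ with a homeomorphism $T:X\to X$ all of whose orbits $\{T^n(x):n\in\mathbb{Z}\}$ are dense. $\mathbb{Z}^+$ denotes the positive integers. Strong speedup: $(Y,S)$ is a strong speedup of $(X,T)$ if there is a function $p:X\to\mathbb{Z}^+$ with at most one point of discontinuity such that $(Y,S)$ is topologically conjugate to $(X,T')$, where $T'(x)=T^{p(x)}(x)$ for all $x\in X$. Groups: $C(X,\mathbb{Z})$ is the group of continuous integer-valued functions on $X$; $\mathrm{cob}(X,T)=\{f-f\circ T: f\in C(X,\mathbb{Z})\}$; $G(X,T)=C(X,\mathbb{Z})/\mathrm{cob}(X,T)$; $G(X,T)_+=\{[f]: f\in C(X,\mathbb{Z}), f\ge 0\}$; $\mathcal{G}(X,T)=(G(X,T),G(X,T)_+,[\mathbf{1}_X])$, where $\mathbf{1}_X$ is the constant function $1$ and $[\mathbf 1_X]$ is the distinguished order unit. In an ordered group with positive cone $G_+$: $a\le b$ means $b-a\in G_+$, and $a<b$ means $b-a\in G_+\setminus\{0\}$.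 An epimorphism of unital ordered groups $\varphi:(G,G_+,u)\to(H,H_+,v)$ preserving the distinguished order unit is a surjective group homomorphism with $\varphi(G_+)\subseteq H_+$ and $\varphi(u)=v$. It is exhaustive if for every $g\in G_+$ and $h\in H$ with $0<h<\varphi(g)$ there is $g'\in G$ with $\varphi(g')=h$ and $0<g'<g$. *)

theory Defs
  imports "HOL-Analysis.Analysis" "HOL-Algebra.Coset"
begin

definition is_homeo :: "('a::topological_space \<Rightarrow> 'b::topological_space) \<Rightarrow> bool" where
  "is_homeo h \<longleftrightarrow> (\<exists>g. homeomorphism UNIV UNIV h g)"

text \<open>
  Spaces are types. Metrizability is the class constraint \<open>metric_space\<close>, nonemptiness is
  automatic, and only the topology induced by the metric is used below.
\<close>

definition Cantor_space :: "'a::metric_space itself \<Rightarrow> bool" where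
  "Cantor_space (_ :: 'a itself) \<longleftrightarrow>
     compact (UNIV :: 'a set) \<and>
     (\<forall>x::'a. x islimpt UNIV) \<and>
     (\<forall>(x::'a) U. open U \<and> x \<in> U \<longrightarrow> (\<exists>V. open V \<and> closed V \<and> x \<in> V \<and> V \<subseteq> U))"

definition int_iterate :: "('a \<Rightarrow> 'a) \<Rightarrow> int \<Rightarrow> 'a \<Rightarrow> 'a" where
  "int_iterate T n = (if 0 \<le> n then T ^^ nat n else inv_into UNIV T ^^ nat (- n))"

definition minimal_Cantor_system :: "('a::metric_space \<Rightarrow> 'a) \<Rightarrow> bool" where
  "minimal_Cantor_system T \<longleftrightarrow>
     Cantor_space TYPE('a) \<and> is_homeo T \<and>
     (\<forall>x. closure (range (\<lambda>n. int_iterate T n x)) = UNIV)"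

definition conjugate ::
  "('a::topological_space \<Rightarrow> 'a) \<Rightarrow> ('b::topological_space \<Rightarrow> 'b) \<Rightarrow> bool" where
  "conjugate S T \<longleftrightarrow> (\<exists>h. is_homeo h \<and> h \<circ> S = T \<circ> h)"

definition strong_speedup ::
  "('b::topological_space \<Rightarrow> 'b) \<Rightarrow> ('a::t2_space \<Rightarrow> 'a) \<Rightarrow> bool" where
  "strong_speedup S T \<longleftrightarrow>
     (\<exists>p :: 'a \<Rightarrow> nat. (\<forall>x. 0 < p x) \<and>
        (\<forall>x y. \<not> isCont p x \<and> \<not> isCont p y \<longrightarrow> x = y) \<and>
        conjugate S (\<lambda>x. (T ^^ p x) x))"

text \<open>
  Ordered groups extend the monoid record, so abelian groups are written multiplicatively:
  \<open>b \<otimes> inv a\<close> is the difference of \<open>b\<close> and \<open>a\<close>, and \<open>\<one>\<close> is the neutral element.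
  The distinguished order unit is \<open>order_unit\<close>.
\<close>

record 'g unital_ordered_group = "'g monoid" +
  pos_cone :: "'g set"
  order_unit :: 'g

definition ord_less :: "('g, 'm) unital_ordered_group_scheme \<Rightarrow> 'g \<Rightarrow> 'g \<Rightarrow> bool" where
  "ord_less G a b \<longleftrightarrow> b \<otimes>\<^bsub>G\<^esub> inv\<^bsub>G\<^esub> a \<in> pos_cone G - {\<one>\<^bsub>G\<^esub>}"

definition unital_ordered_epi ::
  "('g, 'm) unital_ordered_group_scheme \<Rightarrow> ('h, 'n) unital_ordered_group_scheme \<Rightarrow> ('g \<Rightarrow> 'h) \<Rightarrow> bool"
where
  "unital_ordered_epi G H \<phi> \<longleftrightarrow>
     \<phi> \<in> epi G H \<and> \<phi> ` pos_cone G \<subseteq> pos_cone H \<and> \<phi> (order_unit G) = order_unit H"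

definition exhaustive ::
  "('g, 'm) unital_ordered_group_scheme \<Rightarrow> ('h, 'n) unital_ordered_group_scheme \<Rightarrow> ('g \<Rightarrow> 'h) \<Rightarrow> bool"
where
  "exhaustive G H \<phi> \<longleftrightarrow>
     (\<forall>g \<in> pos_cone G. \<forall>h \<in> carrier H.
        ord_less H \<one>\<^bsub>H\<^esub> h \<and> ord_less H h (\<phi> g) \<longrightarrow>
        (\<exists>g' \<in> carrier G. \<phi> g' = h \<and> ord_less G \<one>\<^bsub>G\<^esub> g' \<and> ord_less G g' g))"

definition cont_int :: "('a::topological_space \<Rightarrow> int) monoid" where
  "cont_int = \<lparr>carrier = {f. continuous_on UNIV f}, mult = (\<lambda>f g x. f x + g x), one = (\<lambda>x. 0)\<rparr>"

definition cob :: "('a::topological_space \<Rightarrow> 'a) \<Rightarrow> ('a \<Rightarrow> int) set" where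
  "cob T = {(\<lambda>x. f x - f (T x)) | f. f \<in> carrier cont_int}"

definition cob_class :: "('a::topological_space \<Rightarrow> 'a) \<Rightarrow> ('a \<Rightarrow> int) \<Rightarrow> ('a \<Rightarrow> int) set" where
  "cob_class T f = cob T #>\<^bsub>cont_int\<^esub> f"

definition dimension_group ::
  "('a::topological_space \<Rightarrow> 'a) \<Rightarrow> ('a \<Rightarrow> int) set unital_ordered_group" where
  "dimension_group T =
     \<lparr>carrier = carrier (cont_int Mod cob T),
      mult = mult (cont_int Mod cob T),
      one = one (cont_int Mod cob T),
      pos_cone = {cob_class T f | f. f \<in> carrier cont_int \<and> (\<forall>x. 0 \<le> f x)},
      order_unit = cob_class T (\<lambda>x. 1)\<rparr>"

end

theory Submission
  imports Defs
begin

text \<open>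
  For a speedup \<open>T'\<close> with jump function \<open>p\<close>, the indicator functions of a clopen set and of its
  preimage under \<open>T'\<close> are cohomologous for \<open>T\<close>: on one of the set and its complement \<open>p\<close> is
  locally constant, hence bounded. So the conjugacy carries coboundaries to coboundaries. Composition
  with such a homeomorphism induces an epimorphism, which is exhaustive because a class strictly
  between \<open>0\<close> and the class of \<open>g \<ge> 0\<close> has a representative between \<open>0\<close> and \<open>g\<close>, found by
  redistributing values along the columns of a tall tower.

  Conversely, call clopen sets of the two spaces matched if the epimorphism maps the class of one
  to the class of the other. Subdivisions can be copied in both directions, using exhaustiveness from
  \<open>X\<close> to \<open>Y\<close>, and sets of \<open>X\<close> matched to the same set are joined by a continuous speedup of
  \<open>T\<close>. Back-and-forth along Kakutani--Rokhlin partitions of \<open>(Y, S)\<close> whose bases shrink to a point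
  \<open>y0\<close> copies the towers to \<open>X\<close>, with levels joined by positive powers of \<open>T\<close> that are never
  changed later except at the tops of the towers. The tops shrink to a single point \<open>x0\<close>, and the
  bases to \<open>T x0\<close>, which defines the limit at \<open>x0\<close>.
\<close>

subsection \<open>Locally constant functions and coboundaries\<close>

text \<open>The epimorphism may have a kernel, and this fixes the direction of the construction.
  Clopen sets of X matched to cohomologous sets of Y are cohomologous for \<open>T\<close>, so a
  move of \<open>S\<close> between two levels can be imitated by positive powers of
  \<open>T\<close>; no such conclusion is available from X to Y. Hence the dynamics is always copied
  from Y to X, while subdivisions are copied both ways to make the limit a homeomorphism.
  Exhaustiveness and the interpolation of classes work with strict inequalities. Strictness leaves
  room: small neighbourhoods of finitely many points can be reserved before a class is adjusted,
  which keeps chosen points on the prescribed side of each subdivision. Each shrinking of the base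
  forces new jumps at the tops, and no bound on their lengths is kept. Only at one point are they
  never settled, and there the single permitted discontinuity is spent. \<open>loc_const\<close>
  asks for no topology on the values, so that words, atoms and labels are handled like integer
  functions.\<close>

definition loc_const :: "('a::topological_space \<Rightarrow> 'c) \<Rightarrow> bool" where
  "loc_const f \<longleftrightarrow> (\<forall>x. \<forall>\<^sub>F y in nhds x. f y = f x)"

lemma loc_const_const [simp]: "loc_const (\<lambda>x. c)"
  by (simp add: loc_const_def)

lemma loc_const_app: "loc_const f \<Longrightarrow> loc_const (\<lambda>x. g (f x))"
  unfolding loc_const_def by (smt (verit) eventually_mono)

lemma loc_const_app2: "loc_const f \<Longrightarrow> loc_const g \<Longrightarrow> loc_const (\<lambda>x. h (f x) (g x))"
  unfolding loc_const_def by (smt (verit) eventually_elim2)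

lemma loc_const_app3:
  "loc_const f \<Longrightarrow> loc_const g \<Longrightarrow> loc_const k \<Longrightarrow> loc_const (\<lambda>x. h (f x) (g x) (k x))"
  using loc_const_app2[OF loc_const_app2[of f g Pair] , of k "\<lambda>p. h (fst p) (snd p)"] by simp

lemma loc_const_arith:
  fixes f g :: "'a::topological_space \<Rightarrow> int"
  shows "loc_const f \<Longrightarrow> loc_const g \<Longrightarrow> loc_const (\<lambda>x. f x + g x)"
    and "loc_const f \<Longrightarrow> loc_const g \<Longrightarrow> loc_const (\<lambda>x. f x - g x)"
    and "loc_const f \<Longrightarrow> loc_const (\<lambda>x. - f x)"
  by (rule loc_const_app2[of f g "(+)"], assumption+)
    (rule loc_const_app2[of f g "(-)"], assumption+, rule loc_const_app[of f uminus])

text \<open>The index is constant near \<open>x\<close>, so only the one member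
  \<open>f (n x)\<close> matters there and no uniformity in \<open>k\<close> is needed. Quantities
  read off after a varying number of iterates become locally constant this way.\<close>

lemma loc_const_family:
  assumes "loc_const n" "\<And>k. loc_const (f k)"
  shows "loc_const (\<lambda>x. f (n x) x)"
  unfolding loc_const_def
proof
  fix x
  have "\<forall>\<^sub>F y in nhds x. n y = n x" "\<forall>\<^sub>F y in nhds x. f (n x) y = f (n x) x"
    using assms by (auto simp: loc_const_def)
  then show "\<forall>\<^sub>F y in nhds x. f (n y) y = f (n x) x"
    by eventually_elim simp
qed

lemma loc_const_compose:
  assumes "loc_const f" "continuous_on UNIV T"
  shows "loc_const (\<lambda>x. f (T x))"
  unfolding loc_const_def
proof
  fix x
  have "\<forall>\<^sub>F y in nhds (T x). f y = f (T x)" using assms by (auto simp: loc_const_def)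
  moreover have "filterlim T (nhds (T x)) (nhds x)"
    using assms(2) by (metis continuous_on_def UNIV_I tendsto_at_iff_tendsto_nhds)
  ultimately show "\<forall>\<^sub>F y in nhds x. f (T y) = f (T x)"
    by (rule eventually_compose_filterlim)
qed

lemma loc_const_ball:
  assumes "finite I" "\<And>i. i \<in> I \<Longrightarrow> loc_const (f i)"
  shows "\<forall>\<^sub>F y in nhds x. \<forall>i\<in>I. f i y = f i x"
  using assms by (auto simp: eventually_ball_finite_distrib loc_const_def)

lemma loc_const_map:
  assumes "\<And>i. i \<in> set l \<Longrightarrow> loc_const (f i)"
  shows "loc_const (\<lambda>x. map (\<lambda>i. f i x) l)"
  unfolding loc_const_def
proof
  fix x
  have "\<forall>\<^sub>F y in nhds x. \<forall>i\<in>set l. f i y = f i x" by (rule loc_const_ball) (use assms in auto)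
  then show "\<forall>\<^sub>F y in nhds x. map (\<lambda>i. f i y) l = map (\<lambda>i. f i x) l"
    by eventually_elim simp
qed

lemma loc_const_sum:
  assumes "\<And>i. i \<in> I \<Longrightarrow> loc_const (f i)"
  shows "loc_const (\<lambda>x. \<Sum>i\<in>I. f i x)"
proof (cases "finite I")
  case True
  show ?thesis unfolding loc_const_def
  proof
    fix x
    have "\<forall>\<^sub>F y in nhds x. \<forall>i\<in>I. f i y = f i x" by (rule loc_const_ball) (use assms True in auto)
    then show "\<forall>\<^sub>F y in nhds x. (\<Sum>i\<in>I. f i y) = (\<Sum>i\<in>I. f i x)"
      by eventually_elim simp
  qed
qed simp

text \<open>Only the finitely many predicates up to the minimum at \<open>x\<close> have to keep
  their truth values near \<open>x\<close>. This serves the first hitting times.\<close>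

lemma loc_const_Least:
  fixes P :: "nat \<Rightarrow> 'a::topological_space \<Rightarrow> bool"
  assumes "\<And>n. loc_const (P n)" "\<And>x. \<exists>n. P n x"
  shows "loc_const (\<lambda>x. LEAST n. P n x)"
  unfolding loc_const_def
proof
  fix x
  define m where "m = (LEAST n. P n x)"
  have "P m x" unfolding m_def using assms(2) by (rule LeastI_ex)
  moreover have "\<And>i. i < m \<Longrightarrow> \<not> P i x" unfolding m_def by (rule not_less_Least)
  ultimately have m: "P m x" "\<And>i. i < m \<Longrightarrow> \<not> P i x" .
  have "\<forall>\<^sub>F y in nhds x. \<forall>i\<in>{..m}. P i y = P i x" by (rule loc_const_ball) (use assms in auto)
  then have "\<forall>\<^sub>F y in nhds x. (LEAST n. P n y) = m"
  proof eventually_elim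
    case (elim y)
    then have "P m y" "\<And>i. i < m \<Longrightarrow> \<not> P i y" using m by auto
    then show ?case by (metis Least_equality not_le_imp_less)
  qed
  then show "\<forall>\<^sub>F y in nhds x. (LEAST n. P n y) = (LEAST n. P n x)" by (simp add: m_def)
qed

lemma loc_const_open: "loc_const f \<Longrightarrow> open {x. P (f x)}"
proof (subst open_subopen, safe)
  fix x assume f: "loc_const f" "P (f x)"
  then have "\<forall>\<^sub>F y in nhds x. f y = f x" by (simp add: loc_const_def)
  then obtain U where "open U" "x \<in> U" "\<And>y. y \<in> U \<Longrightarrow> f y = f x"
    unfolding eventually_nhds by blast
  moreover have "U \<subseteq> {x. P (f x)}"
    using f(2) calculation(3) by (metis mem_Collect_eq subsetI)
  ultimately show "\<exists>T. open T \<and> x \<in> T \<and> T \<subseteq> {x. P (f x)}" by blast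
qed

lemma loc_const_closed: "loc_const f \<Longrightarrow> closed {x. P (f x)}"
  using loc_const_open[of f "\<lambda>v. \<not> P v"] by (simp add: closed_def Collect_neg_eq)

text \<open>Stated through membership so that the closure rules for \<open>loc_const\<close> apply
  to sets directly; \<open>clopen_iff\<close> gives back the usual meaning.\<close>

abbreviation clopen :: "'a::topological_space set \<Rightarrow> bool" where
  "clopen A \<equiv> loc_const (\<lambda>x. x \<in> A)"

lemma clopen_iff: "clopen A \<longleftrightarrow> open A \<and> closed A"
proof
  assume "clopen A"
  from loc_const_open[OF this, of "\<lambda>b. b"] loc_const_closed[OF this, of "\<lambda>b. b"]
  show "open A \<and> closed A" by simp
next
  assume A: "open A \<and> closed A"
  show "clopen A" unfolding loc_const_def
  proof
    fix x
    show "\<forall>\<^sub>F y in nhds x. (y \<in> A) = (x \<in> A)"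
    proof (cases "x \<in> A")
      case True
      then have "\<forall>\<^sub>F y in nhds x. y \<in> A" using A by (simp add: eventually_nhds_in_open)
      then show ?thesis by eventually_elim (use True in simp)
    next
      case False
      then have "\<forall>\<^sub>F y in nhds x. y \<in> - A" using A by (intro eventually_nhds_in_open) auto
      then show ?thesis by eventually_elim (use False in simp)
    qed
  qed
qed

lemma clopen_Collect: "loc_const f \<Longrightarrow> clopen {x. P (f x)}"
  using loc_const_app[of f P] by simp

lemma loc_const_iff_continuous:
  fixes f :: "'a::topological_space \<Rightarrow> 'c::discrete_topology"
  shows "loc_const f \<longleftrightarrow> continuous_on UNIV f"
proof
  assume f: "loc_const f"
  show "continuous_on UNIV f"
    unfolding continuous_on_def
  proof
    fix x
    have "\<forall>\<^sub>F y in nhds x. f y = f x" using f by (simp add: loc_const_def)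
    then have "\<forall>\<^sub>F y in at x. f y = f x"
      unfolding eventually_at_filter by eventually_elim simp
    then show "(f \<longlongrightarrow> f x) (at x)" by (rule tendsto_eventually)
  qed
next
  assume f: "continuous_on UNIV f"
  show "loc_const f" unfolding loc_const_def
  proof
    fix x
    have "open {f x}" by (rule open_discrete)
    then have "open (f -` {f x})" using f by (simp add: continuous_on_open_vimage)
    then have "\<forall>\<^sub>F y in nhds x. y \<in> f -` {f x}" by (intro eventually_nhds_in_open) auto
    then show "\<forall>\<^sub>F y in nhds x. f y = f x" by eventually_elim simp
  qed
qed

lemma isCont_nat_iff:
  fixes f :: "'a::t2_space \<Rightarrow> nat"
  shows "isCont f x \<longleftrightarrow> (\<forall>\<^sub>F y in nhds x. f y = f x)"
proof
  assume "isCont f x"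
  then have "filterlim f (nhds (f x)) (nhds x)"
    by (simp add: isCont_def tendsto_at_iff_tendsto_nhds)
  moreover have "\<forall>\<^sub>F n in nhds (f x). n = f x"
    by (simp add: nhds_discrete eventually_principal)
  ultimately show "\<forall>\<^sub>F y in nhds x. f y = f x"
    by (rule eventually_compose_filterlim[rotated])
next
  assume "\<forall>\<^sub>F y in nhds x. f y = f x"
  then have "\<forall>\<^sub>F y in at x. f y = f x"
    unfolding eventually_at_filter by eventually_elim simp
  then show "isCont f x" unfolding isCont_def by (rule tendsto_eventually)
qed

lemma finite_range_loc_const:
  assumes "compact (UNIV :: 'a::topological_space set)" "loc_const (f :: 'a \<Rightarrow> 'c)"
  shows "finite (range f)"
proof -
  have "\<exists>D\<subseteq>range (\<lambda>v. {x. f x = v}). finite D \<and> UNIV \<subseteq> \<Union>D"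
    by (rule compactE[OF assms(1), of "range (\<lambda>v. {x. f x = v})"])
      (use loc_const_open[OF assms(2), of "\<lambda>w. w = _"] in auto)
  then obtain C where "finite C" "UNIV \<subseteq> (\<Union>v\<in>C. {x. f x = v})"
    by (metis finite_subset_image)
  then have "range f \<subseteq> C" by auto
  then show ?thesis using \<open>finite C\<close> finite_subset by auto
qed

lemma loc_const_int_bounded:
  assumes "compact (UNIV :: 'a::topological_space set)" "loc_const (f :: 'a \<Rightarrow> int)"
  obtains K where "0 \<le> K" "\<And>x. \<bar>f x\<bar> \<le> K"
proof -
  have "finite (range (\<lambda>x. \<bar>f x\<bar>))"
    by (rule finite_range_loc_const[OF assms(1) loc_const_app[OF assms(2)]])
  then have "\<bar>f x\<bar> \<le> Max (range (\<lambda>x. \<bar>f x\<bar>))" for x by simp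
  then show ?thesis using that by (metis abs_ge_zero order_trans)
qed

lemma loc_const_nat_bounded:
  assumes "compact (UNIV :: 'a::topological_space set)" "loc_const (f :: 'a \<Rightarrow> nat)"
  obtains K where "\<And>x. f x \<le> K"
proof -
  have "finite (range f)"
    by (rule finite_range_loc_const[OF assms])
  then have "f x \<le> Max (range f)" for x by simp
  then show ?thesis using that by metis
qed

lemma clopen_simps [intro]:
  "clopen {}" "clopen UNIV"
  "clopen A \<Longrightarrow> clopen B \<Longrightarrow> clopen (A \<inter> B)"
  "clopen A \<Longrightarrow> clopen B \<Longrightarrow> clopen (A \<union> B)"
  "clopen A \<Longrightarrow> clopen B \<Longrightarrow> clopen (A - B)"
  "clopen A \<Longrightarrow> clopen (- A)"
  unfolding clopen_iff by auto

lemma loc_const_of_bool: "clopen A \<Longrightarrow> loc_const (\<lambda>x. of_bool (x \<in> A))"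
  by (rule loc_const_app)

section \<open>Cohomologous functions and Birkhoff sums\<close>

lemma cob_iff:
  "f \<in> cob T \<longleftrightarrow> (\<exists>k. loc_const k \<and> f = (\<lambda>x. k x - k (T x)))"
  unfolding cob_def cont_int_def loc_const_iff_continuous by auto

definition cohom :: "('a::topological_space \<Rightarrow> 'a) \<Rightarrow> ('a \<Rightarrow> int) \<Rightarrow> ('a \<Rightarrow> int) \<Rightarrow> bool" where
  "cohom T f g \<longleftrightarrow> (\<lambda>x. f x - g x) \<in> cob T"

lemma cohomE:
  assumes "cohom T f g"
  obtains k where "loc_const k" "\<And>x. f x - g x = k x - k (T x)"
  using assms unfolding cohom_def cob_iff by metis

lemma cohomI: "loc_const k \<Longrightarrow> (\<And>x. f x - g x = k x - k (T x)) \<Longrightarrow> cohom T f g"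
  unfolding cohom_def cob_iff by auto

lemma cohom_refl [simp]: "cohom T f f"
  by (rule cohomI[of "\<lambda>x. 0"]) auto

lemma cohom_add:
  assumes "cohom T f g" "cohom T f' g'"
  shows "cohom T (\<lambda>x. f x + f' x) (\<lambda>x. g x + g' x)"
proof -
  obtain k where k: "loc_const k" "\<And>x. f x - g x = k x - k (T x)"
    using cohomE[OF assms(1)] by blast
  obtain k' where k': "loc_const k'" "\<And>x. f' x - g' x = k' x - k' (T x)"
    using cohomE[OF assms(2)] by blast
  show ?thesis
  proof (rule cohomI)
    show "loc_const (\<lambda>x. k x + k' x)" by (rule loc_const_app2[OF k(1) k'(1)])
    show "f x + f' x - (g x + g' x) = k x + k' x - (k (T x) + k' (T x))" for x
      using k(2)[of x] k'(2)[of x] by simp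
  qed
qed

lemma cohom_uminus:
  assumes "cohom T f g"
  shows "cohom T (\<lambda>x. - f x) (\<lambda>x. - g x)"
proof -
  obtain k where k: "loc_const k" "\<And>x. f x - g x = k x - k (T x)"
    using cohomE[OF assms] by blast
  show ?thesis
  proof (rule cohomI)
    show "loc_const (\<lambda>x. - k x)" by (rule loc_const_app[OF k(1)])
    show "- f x - - g x = - k x - - k (T x)" for x
      using k(2)[of x] by simp
  qed
qed

lemma cohom_diff:
  "cohom T f g \<Longrightarrow> cohom T f' g' \<Longrightarrow> cohom T (\<lambda>x. f x - f' x) (\<lambda>x. g x - g' x)"
  using cohom_add[OF _ cohom_uminus] by simp

lemma cohom_sym: "cohom T f g \<Longrightarrow> cohom T g f"
  using cohom_uminus[of T f g] by (simp add: cohom_def)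

lemma cohom_trans: "cohom T f g \<Longrightarrow> cohom T g h \<Longrightarrow> cohom T f h"
  using cohom_add[of T f g g h] by (simp add: cohom_def)

lemma cohom_sum:
  assumes "\<And>i. i \<in> I \<Longrightarrow> cohom T (f i) (g i)"
  shows "cohom T (\<lambda>x. \<Sum>i\<in>I. f i x) (\<lambda>x. \<Sum>i\<in>I. g i x)"
  using assms
proof (induction I rule: infinite_finite_induct)
  case (insert i I)
  then have "cohom T (\<lambda>x. f i x + (\<Sum>i\<in>I. f i x)) (\<lambda>x. g i x + (\<Sum>i\<in>I. g i x))"
    by (intro cohom_add) auto
  with insert show ?case by simp
qed simp_all

text \<open>The Birkhoff sum over the first \<open>n\<close> points of the forward orbit of
  \<open>x\<close>. For a coboundary it telescopes (\<open>bsum_cob\<close>), so it stays bounded in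
  \<open>n\<close>.\<close>

definition bsum :: "('a \<Rightarrow> 'a) \<Rightarrow> nat \<Rightarrow> ('a \<Rightarrow> int) \<Rightarrow> 'a \<Rightarrow> int" where
  "bsum T n f x = (\<Sum>i<n. f ((T ^^ i) x))"

lemma bsum_0 [simp]: "bsum T 0 f x = 0"
  by (simp add: bsum_def)

lemma bsum_Suc: "bsum T (Suc n) f x = bsum T n f x + f ((T ^^ n) x)"
  by (simp add: bsum_def)

lemma bsum_add: "bsum T (m + n) f x = bsum T m f x + bsum T n f ((T ^^ m) x)"
  by (induction n) (auto simp: bsum_Suc funpow_add add.commute)

lemma bsum_minus: "bsum T n (\<lambda>x. f x - g x) x = bsum T n f x - bsum T n g x"
  by (simp add: bsum_def sum_subtractf)

lemma bsum_cob: "bsum T n (\<lambda>x. k x - k (T x)) x = k x - k ((T ^^ n) x)"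
  by (induction n) (auto simp: bsum_Suc)

lemma bsum_bound: "(\<And>x. \<bar>f x\<bar> \<le> K) \<Longrightarrow> \<bar>bsum T n f x\<bar> \<le> int n * K"
proof (induction n)
  case (Suc n)
  have "\<bar>f ((T ^^ n) x)\<bar> \<le> K" "\<bar>bsum T n f x\<bar> \<le> int n * K"
    by (rule Suc.prems, rule Suc.IH[OF Suc.prems])
  then show ?case by (simp add: bsum_Suc distrib_right abs_le_iff)
qed simp

text \<open>On a minimal system this singles out the nonzero classes of the positive cone; unlike membership
  in the cone it visibly survives small perturbations.\<close>

definition spos :: "('a \<Rightarrow> 'a) \<Rightarrow> ('a \<Rightarrow> int) \<Rightarrow> bool" where
  "spos T f \<longleftrightarrow> (\<exists>n. \<forall>x. 0 < bsum T n f x)"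

subsection \<open>Minimal systems and towers\<close>

lemma continuous_on_funpow:
  fixes f :: "'a::topological_space \<Rightarrow> 'a"
  shows "continuous_on UNIV f \<Longrightarrow> continuous_on UNIV (f ^^ n)"
  by (induction n) (auto intro: continuous_on_compose2 simp: id_def)

locale minimal_system =
  fixes T :: "'a::metric_space \<Rightarrow> 'a"
  assumes minimal: "minimal_Cantor_system T"
begin

abbreviation Ti :: "'a \<Rightarrow> 'a" where "Ti \<equiv> inv_into UNIV T"

lemma compact_space: "compact (UNIV :: 'a set)"
  using minimal by (simp add: minimal_Cantor_system_def Cantor_space_def)

lemma homeo: "homeomorphism UNIV UNIV T Ti"
proof -
  obtain g where g: "homeomorphism UNIV UNIV T g"
    using minimal by (auto simp: minimal_Cantor_system_def is_homeo_def)
  then have "T (g x) = x" "g (T x) = x" for x by (auto simp: homeomorphism_def)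
  then have "Ti = g" by (intro inv_equality)
  with g show ?thesis by simp
qed

lemma bij_T: "bij T"
  by (rule o_bij[of Ti]) (use homeo in \<open>auto simp: homeomorphism_def\<close>)

lemma T_Ti [simp]: "T (Ti x) = x" and Ti_T [simp]: "Ti (T x) = x"
  using homeo by (auto simp: homeomorphism_def)

lemma cont_T: "continuous_on UNIV T" and cont_Ti: "continuous_on UNIV Ti"
  using homeo by (auto simp: homeomorphism_def)

lemma cont_pow: "continuous_on UNIV (T ^^ n)" and cont_pow_inv: "continuous_on UNIV (Ti ^^ n)"
  by (rule continuous_on_funpow, rule cont_T cont_Ti)+

lemma pow_inv_cancel [simp]: "(T ^^ n) ((Ti ^^ n) x) = x" "(Ti ^^ n) ((T ^^ n) x) = x"
proof -
  show "(T ^^ n) ((Ti ^^ n) x) = x"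
    by (induction n arbitrary: x) (simp_all add: funpow_swap1)
  show "(Ti ^^ n) ((T ^^ n) x) = x"
    by (induction n arbitrary: x) (simp_all add: funpow_swap1)
qed

lemma inj_pow: "(T ^^ n) x = (T ^^ n) y \<Longrightarrow> x = y"
  by (drule arg_cong[of _ _ "Ti ^^ n"]) simp

lemma pow_pow_inv: "n \<le> m \<Longrightarrow> (T ^^ n) ((Ti ^^ m) x) = (Ti ^^ (m - n)) x"
  using funpow_add[of n "m - n" Ti] by simp

lemma inv_pow_pow: "n \<le> m \<Longrightarrow> (Ti ^^ n) ((T ^^ m) x) = (T ^^ (m - n)) x"
  using funpow_add[of n "m - n" T] by simp

lemma zero_dim: "open U \<and> x \<in> U \<longrightarrow> (\<exists>V. open V \<and> closed V \<and> x \<in> V \<and> V \<subseteq> U)"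
  for U :: "'a set"
  using minimal unfolding minimal_Cantor_system_def Cantor_space_def
  by (elim conjE allE) assumption

lemma clopen_nbhd:
  fixes U :: "'a set"
  assumes "open U" "x \<in> U"
  obtains V where "clopen V" "x \<in> V" "V \<subseteq> U"
proof -
  have "\<exists>V. open V \<and> closed V \<and> x \<in> V \<and> V \<subseteq> U"
    using zero_dim[of U x] assms by simp
  then show ?thesis using that by (auto simp: clopen_iff)
qed

lemma infinite_space: "infinite (UNIV :: 'a set)"
proof
  assume "finite (UNIV :: 'a set)"
  then have "\<not> (undefined :: 'a) islimpt UNIV" by (rule islimpt_finite)
  then show False using minimal by (simp add: minimal_Cantor_system_def Cantor_space_def)
qed

lemma loc_const_pow: "loc_const f \<Longrightarrow> loc_const (\<lambda>x. f ((T ^^ n) x))"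
  and loc_const_pow_inv: "loc_const f \<Longrightarrow> loc_const (\<lambda>x. f ((Ti ^^ n) x))"
  by (erule loc_const_compose, rule cont_pow cont_pow_inv)+

lemma loc_const_bsum: "loc_const f \<Longrightarrow> loc_const (bsum T n f)"
  using loc_const_sum[of "{..<n}" "\<lambda>i x. f ((T ^^ i) x)"] loc_const_pow[of f]
  by (simp add: bsum_def[abs_def])

text \<open>Minimality only gives density of two-sided orbits. Compactness bounds the visiting times
  by \<open>M\<close> in absolute value, and starting from \<open>(T ^^ M) x\<close> makes all of
  them nonnegative.\<close>

lemma visits_forward:
  assumes "open U" "U \<noteq> {}"
  shows "\<exists>N. \<forall>x. \<exists>n<N. (T ^^ n) x \<in> U"
proof -
  define W where "W n = int_iterate T n -` U" for n
  have "open (W n)" for n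
    unfolding W_def using cont_pow cont_pow_inv assms(1)
    by (auto intro!: open_vimage simp: int_iterate_def)
  moreover have "UNIV \<subseteq> (\<Union>n. W n)"
  proof
    fix x :: 'a
    have "closure (range (\<lambda>n. int_iterate T n x)) = UNIV"
      using minimal by (simp add: minimal_Cantor_system_def)
    then have "range (\<lambda>n. int_iterate T n x) \<inter> U \<noteq> {}"
      using assms open_Int_closure_eq_empty[of U "range (\<lambda>n. int_iterate T n x)"] by auto
    then show "x \<in> (\<Union>n. W n)" by (auto simp: W_def)
  qed
  ultimately obtain I where I: "finite I" "UNIV \<subseteq> (\<Union>n\<in>I. W n)"
    by (metis compactE_image[OF compact_space, of UNIV W])
  define M where "M = nat (Max (abs ` I))"
  have M: "\<bar>n\<bar> \<le> int M" if "n \<in> I" for n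
  proof -
    have "\<bar>n\<bar> \<le> Max (abs ` I)" using I(1) that by (intro Max_ge) auto
    then show ?thesis unfolding M_def by linarith
  qed
  have "\<exists>n<2 * M + 1. (T ^^ n) x \<in> U" for x
  proof -
    obtain n where n: "n \<in> I" "int_iterate T n ((T ^^ M) x) \<in> U" using I(2) by (auto simp: W_def)
    have "int_iterate T n ((T ^^ M) x) = (T ^^ nat (int M + n)) x"
    proof (cases "0 \<le> n")
      case True
      then have "nat (int M + n) = nat n + M" by linarith
      then show ?thesis using True by (simp add: int_iterate_def funpow_add)
    next
      case False
      then have *: "nat (int M + n) = M - nat (- n)" "nat (- n) \<le> M" using M[OF n(1)] by linarith+
      then show ?thesis using False inv_pow_pow[OF *(2)] by (simp add: int_iterate_def)
    qed
    moreover have "nat (int M + n) < 2 * M + 1" using M[OF n(1)] by linarith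
    ultimately show ?thesis using n(2) by metis
  qed
  then show ?thesis by blast
qed

lemma visits_backward:
  assumes "open U" "U \<noteq> {}"
  shows "\<exists>N. \<forall>x. \<exists>n<N. (Ti ^^ n) x \<in> U"
proof -
  obtain N where N: "\<forall>x. \<exists>n<N. (T ^^ n) x \<in> U" using visits_forward[OF assms] by blast
  have "\<exists>n<Suc N. (Ti ^^ n) x \<in> U" for x
  proof -
    obtain n where "n < N" "(T ^^ n) ((Ti ^^ N) x) \<in> U" using N by blast
    then have "(Ti ^^ (N - n)) x \<in> U" by (simp add: pow_pow_inv)
    then show ?thesis by (metis diff_less_Suc)
  qed
  then show ?thesis by blast
qed

text \<open>A periodic orbit is finite, so its complement is open, and nonempty because the space is
  infinite; yet the forward orbit would never visit it.\<close>

lemma aperiodic: assumes "0 < n" shows "(T ^^ n) x \<noteq> x"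
proof
  assume eq: "(T ^^ n) x = x"
  define O' where "O' = (\<lambda>i. (T ^^ i) x) ` {..<n}"
  have inv: "(T ^^ m) x \<in> O'" for m
  proof -
    have "(T ^^ m) x = (T ^^ (m mod n)) x" using eq by (simp add: funpow_mod_eq)
    then show ?thesis using assms by (auto simp: O'_def)
  qed
  have "finite O'" by (simp add: O'_def)
  then have "open (- O')" by (intro open_Compl finite_imp_closed)
  moreover have "- O' \<noteq> {}"
  proof
    assume "- O' = {}"
    then have "O' = UNIV" by auto
    with \<open>finite O'\<close> infinite_space show False by simp
  qed
  ultimately obtain N where "\<forall>x. \<exists>n<N. (T ^^ n) x \<in> - O'" using visits_forward by blast
  with inv show False by blast
qed

text \<open>By aperiodicity \<open>x\<close> can be separated from each of its next
  \<open>n - 1\<close> images, and finitely many separating neighbourhoods are intersected. Used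
  both for towers with long columns and for sets that an orbit meets rarely.\<close>

lemma small_return_nbhd:
  assumes "open U" "x \<in> U"
  obtains V where "clopen V" "x \<in> V" "V \<subseteq> U"
    "\<And>v i. v \<in> V \<Longrightarrow> 0 < i \<Longrightarrow> i < n \<Longrightarrow> (T ^^ i) v \<notin> V"
proof -
  have "\<exists>P. open P \<and> x \<in> P \<and> (\<forall>v\<in>P. (T ^^ i) v \<notin> P)" if "0 < i" for i
  proof -
    have "x \<noteq> (T ^^ i) x" using aperiodic[OF that, of x] by metis
    then obtain P Q where PQ: "open P" "open Q" "x \<in> P" "(T ^^ i) x \<in> Q" "P \<inter> Q = {}"
      using hausdorff by metis
    have "open (P \<inter> (T ^^ i) -` Q)" using PQ cont_pow by (auto intro!: open_Int open_vimage)
    then show ?thesis using PQ by (intro exI[of _ "P \<inter> (T ^^ i) -` Q"]) auto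
  qed
  then obtain P where P: "\<And>i. 0 < i \<Longrightarrow> open (P i) \<and> x \<in> P i \<and> (\<forall>v\<in>P i. (T ^^ i) v \<notin> P i)"
    by metis
  have "open (U \<inter> (\<Inter>i\<in>{1..<n}. P i))" using assms P by (intro open_Int open_INT) auto
  moreover have "x \<in> U \<inter> (\<Inter>i\<in>{1..<n}. P i)" using assms P by auto
  ultimately obtain V where V: "clopen V" "x \<in> V" "V \<subseteq> U \<inter> (\<Inter>i\<in>{1..<n}. P i)"
    by (rule clopen_nbhd)
  have "(T ^^ i) v \<notin> V" if "v \<in> V" "0 < i" "i < n" for v i
  proof -
    have "v \<in> P i" "V \<subseteq> P i" using that V(3) by auto
    with P[of i] that show ?thesis by blast
  qed
  with V show ?thesis by (intro that) auto
qed

text \<open>Blocks of length \<open>L\<close> contribute at least 1 each, the values being integers,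
  and the incomplete last block costs at most \<open>L * K\<close>.\<close>

lemma bsum_at_least:
  assumes "spos T f" "loc_const f"
  obtains N where "\<And>n x. N \<le> n \<Longrightarrow> m \<le> bsum T n f x"
proof -
  obtain L where L: "\<And>x. 0 < bsum T L f x" using assms(1) by (auto simp: spos_def)
  obtain K where K: "0 \<le> K" "\<And>x. \<bar>f x\<bar> \<le> K"
    using loc_const_int_bounded[OF compact_space assms(2)] by blast
  have blocks: "int q \<le> bsum T (q * L) f x" for q x
  proof (induction q arbitrary: x)
    case (Suc q)
    have "bsum T (Suc q * L) f x = bsum T L f x + bsum T (q * L) f ((T ^^ L) x)"
      by (simp add: bsum_add)
    then show ?case using Suc[of "(T ^^ L) x"] L[of x] by simp
  qed simp
  have "0 < L" using L[of undefined] by (cases L) auto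
  define Q where "Q = nat (m + int L * K)"
  have "m \<le> bsum T n f x" if "Q * L \<le> n" for n x
  proof -
    have "n = (n div L) * L + n mod L" by simp
    then have "bsum T n f x = bsum T (n div L * L) f x + bsum T (n mod L) f ((T ^^ (n div L * L)) x)"
      by (metis bsum_add)
    moreover have "int (n div L) \<le> bsum T (n div L * L) f x" by (rule blocks)
    moreover have "\<bar>bsum T (n mod L) f ((T ^^ (n div L * L)) x)\<bar> \<le> int (n mod L) * K"
      by (rule bsum_bound) (rule K)
    moreover have "int (n mod L) * K \<le> int L * K"
      using \<open>0 < L\<close> K by (intro mult_right_mono) (auto simp: less_imp_le)
    moreover have "Q \<le> n div L"
      using that \<open>0 < L\<close> by (simp add: less_eq_div_iff_mult_less_eq)
    ultimately show ?thesis unfolding Q_def by linarith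
  qed
  then show ?thesis by (rule that)
qed

text \<open>Birkhoff sums of cohomologous functions differ by at most \<open>2 * K\<close> whatever
  the length, while those of \<open>f\<close> exceed \<open>2 * K\<close> for long segments.\<close>

lemma spos_cohom:
  assumes "spos T f" "cohom T f g" "loc_const f"
  shows "spos T g"
proof -
  obtain k where k: "loc_const k" "\<And>x. f x - g x = k x - k (T x)"
    using cohomE[OF assms(2)] by blast
  obtain K where K: "0 \<le> K" "\<And>x. \<bar>k x\<bar> \<le> K"
    using loc_const_int_bounded[OF compact_space k(1)] by blast
  obtain N where N: "\<And>n x. N \<le> n \<Longrightarrow> 2 * K + 1 \<le> bsum T n f x"
    using bsum_at_least[OF assms(1,3)] by blast
  have "0 < bsum T N g x" for x
  proof -
    have "bsum T N f x - bsum T N g x = bsum T N (\<lambda>x. k x - k (T x)) x"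
      by (subst bsum_minus[symmetric]) (simp add: k(2))
    also have "\<dots> = k x - k ((T ^^ N) x)" by (rule bsum_cob)
    finally show ?thesis using N[of N x] K(2)[of x] K(2)[of "(T ^^ N) x"] by simp
  qed
  then show ?thesis by (auto simp: spos_def)
qed

text \<open>Every orbit meets the open set where \<open>f\<close> is nonzero within a bounded time,
  and no term is negative.\<close>

lemma spos_nonneg:
  assumes "loc_const f" "\<And>x. 0 \<le> f x" "f y \<noteq> 0"
  shows "spos T f"
proof -
  have "open {x. f x \<noteq> 0}" using loc_const_open[OF assms(1), of "\<lambda>v. v \<noteq> 0"] .
  moreover have "{x. f x \<noteq> 0} \<noteq> {}" using assms(3) by auto
  ultimately obtain N where N: "\<forall>x. \<exists>n<N. (T ^^ n) x \<in> {x. f x \<noteq> 0}"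
    using visits_forward by blast
  have "0 < bsum T N f x" for x
  proof -
    obtain n where "n < N" "f ((T ^^ n) x) \<noteq> 0" using N by blast
    then show ?thesis unfolding bsum_def
      by (intro sum_pos2[of _ n]) (use assms(2) in \<open>auto simp: less_le\<close>)
  qed
  then show ?thesis by (auto simp: spos_def)
qed

lemma spos_not_cohom_nonpos:
  assumes "spos T f" "loc_const f" "cohom T f g" "\<And>x. g x \<le> 0"
  shows False
proof -
  have "spos T g" using spos_cohom assms by blast
  moreover have "bsum T n g x \<le> 0" for n x
    using assms(4) by (simp add: bsum_def sum_nonpos)
  ultimately show False by (meson not_le spos_def)
qed

section \<open>Levels and columns of the tower over a clopen set\<close>

definition bt :: "'a set \<Rightarrow> 'a \<Rightarrow> nat" where
  "bt V x = (LEAST i. (Ti ^^ i) x \<in> V)"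

text \<open>Time 0 counts for \<open>bt\<close>, which is therefore the level of a point in the
  tower over \<open>V\<close>; it is excluded for \<open>rt\<close>, which is therefore the height
  of the column above a point of \<open>V\<close>.\<close>

definition rt :: "'a set \<Rightarrow> 'a \<Rightarrow> nat" where
  "rt V x = (LEAST i. 0 < i \<and> (T ^^ i) x \<in> V)"

lemma backward_visit:
  assumes "clopen V" "V \<noteq> {}"
  shows "\<exists>i. (Ti ^^ i) x \<in> V"
  using visits_backward[of V] assms clopen_iff by blast

lemma forward_visit:
  assumes "clopen V" "V \<noteq> {}"
  shows "\<exists>i. 0 < i \<and> (T ^^ i) x \<in> V"
proof -
  obtain N where "\<forall>x. \<exists>n<N. (T ^^ n) x \<in> V"
    using visits_forward[of V] assms clopen_iff by blast
  then obtain n where "(T ^^ n) (T x) \<in> V" by blast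
  then have "(T ^^ Suc n) x \<in> V" by (simp add: funpow_swap1)
  then show ?thesis by blast
qed

lemma bt_in:
  assumes "clopen V" "V \<noteq> {}"
  shows "(Ti ^^ bt V x) x \<in> V"
  unfolding bt_def by (rule LeastI_ex) (rule backward_visit[OF assms])

lemma bt_least: "i < bt V x \<Longrightarrow> (Ti ^^ i) x \<notin> V"
  unfolding bt_def by (rule not_less_Least)

lemma bt_eqI: "(Ti ^^ i) x \<in> V \<Longrightarrow> (\<And>j. j < i \<Longrightarrow> (Ti ^^ j) x \<notin> V) \<Longrightarrow> bt V x = i"
  unfolding bt_def by (rule Least_equality) (auto simp: not_less[symmetric])

lemma rt_in:
  assumes "clopen V" "V \<noteq> {}"
  shows "0 < rt V x" "(T ^^ rt V x) x \<in> V"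
  using LeastI_ex[OF forward_visit[OF assms], of x] unfolding rt_def by auto

lemma rt_least: "0 < i \<Longrightarrow> i < rt V x \<Longrightarrow> (T ^^ i) x \<notin> V"
  unfolding rt_def using not_less_Least[of i "\<lambda>i. 0 < i \<and> (T ^^ i) x \<in> V"] by blast

lemma rt_eqI: "0 < i \<Longrightarrow> (T ^^ i) x \<in> V \<Longrightarrow> (\<And>j. 0 < j \<Longrightarrow> j < i \<Longrightarrow> (T ^^ j) x \<notin> V) \<Longrightarrow> rt V x = i"
  unfolding rt_def by (rule Least_equality) (auto simp: not_less[symmetric])

lemma bt_column: "x \<in> V \<Longrightarrow> j < rt V x \<Longrightarrow> bt V ((T ^^ j) x) = j"
  by (rule bt_eqI) (auto simp: inv_pow_pow rt_least)

lemma rt_base: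
  assumes V: "clopen V" "V \<noteq> {}" and "T y \<in> V"
  shows "rt V ((Ti ^^ bt V y) y) = Suc (bt V y)"
proof (rule rt_eqI)
  show "(T ^^ Suc (bt V y)) ((Ti ^^ bt V y) y) \<in> V" using assms by simp
  fix j assume "0 < j" "j < Suc (bt V y)"
  then show "(T ^^ j) ((Ti ^^ bt V y) y) \<notin> V"
    by (simp add: pow_pow_inv bt_least)
qed simp

lemma bt_T:
  assumes V: "clopen V" "V \<noteq> {}" and "T y \<notin> V"
  shows "bt V (T y) = Suc (bt V y)"
proof (rule bt_eqI)
  have *: "(Ti ^^ Suc j) (T y) = (Ti ^^ j) y" for j by (simp add: funpow_swap1)
  show "(Ti ^^ Suc (bt V y)) (T y) \<in> V" unfolding * by (rule bt_in[OF V])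
  fix j assume j: "j < Suc (bt V y)"
  show "(Ti ^^ j) (T y) \<notin> V"
  proof (cases j)
    case 0
    then show ?thesis using assms by simp
  next
    case (Suc i)
    then show ?thesis using j * bt_least[of i V y] by simp
  qed
qed

lemma bt_less_rt:
  assumes V: "clopen V" "V \<noteq> {}"
  shows "bt V y < rt V ((Ti ^^ bt V y) y)"
proof (rule ccontr)
  let ?x = "(Ti ^^ bt V y) y"
  assume "\<not> ?thesis"
  then have r: "rt V ?x \<le> bt V y" by simp
  then have "(T ^^ rt V ?x) ?x = (Ti ^^ (bt V y - rt V ?x)) y" by (rule pow_pow_inv)
  moreover have "bt V y - rt V ?x < bt V y" using rt_in(1)[OF V, of ?x] r by linarith
  ultimately show False using bt_least rt_in(2)[OF V, of ?x] by fastforce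
qed

lemma loc_const_bt:
  assumes V: "clopen V" "V \<noteq> {}"
  shows "loc_const (bt V)"
  unfolding bt_def[abs_def]
  by (rule loc_const_Least) (use loc_const_pow_inv[OF V(1)] backward_visit[OF V] in auto)

lemma loc_const_rt:
  assumes V: "clopen V" "V \<noteq> {}"
  shows "loc_const (rt V)"
  unfolding rt_def[abs_def]
proof (rule loc_const_Least)
  show "loc_const (\<lambda>x. 0 < n \<and> (T ^^ n) x \<in> V)" for n
    by (rule loc_const_app[of "\<lambda>x. (T ^^ n) x \<in> V"]) (rule loc_const_pow[OF V(1)])
qed (rule forward_visit[OF V])

lemma loc_const_base:
  assumes V: "clopen V" "V \<noteq> {}" and f: "loc_const f"
  shows "loc_const (\<lambda>x. f ((Ti ^^ bt V x) x))"
  using loc_const_family[OF loc_const_bt[OF V], of "\<lambda>i x. f ((Ti ^^ i) x)"] loc_const_pow_inv[OF f]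
  by simp

text \<open>The transfer function is minus the partial column sum of the tower above \<open>V\<close>.\<close>

lemma column_sums_cohom:
  assumes V: "clopen V" "V \<noteq> {}" and f: "loc_const f"
    and sum0: "\<And>x. x \<in> V \<Longrightarrow> bsum T (rt V x) f x = 0"
  shows "cohom T f (\<lambda>x. 0)"
proof (rule cohomI)
  define k where "k y = - bsum T (bt V y) f ((Ti ^^ bt V y) y)" for y
  have "loc_const (\<lambda>y. - bsum T i f ((Ti ^^ i) y))" for i
    by (rule loc_const_app[of _ uminus], rule loc_const_pow_inv, rule loc_const_bsum, rule f)
  then show "loc_const k"
    unfolding k_def[abs_def]
    using loc_const_family[OF loc_const_bt[OF V], of "\<lambda>i y. - bsum T i f ((Ti ^^ i) y)"] by simp
  fix y
  let ?i = "bt V y" let ?x = "(Ti ^^ ?i) y"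
  have fy: "bsum T (Suc ?i) f ?x = bsum T ?i f ?x + f y" by (simp add: bsum_Suc)
  show "f y - 0 = k y - k (T y)"
  proof (cases "T y \<in> V")
    case True
    have "bsum T (Suc ?i) f ?x = 0" using sum0[OF bt_in[OF V, of y]] rt_base[OF V True] by simp
    moreover have "bt V (T y) = 0" by (rule bt_eqI) (use True in auto)
    ultimately show ?thesis using fy by (simp add: k_def)
  next
    case False
    have "(Ti ^^ Suc ?i) (T y) = ?x" by (simp add: funpow_swap1)
    then show ?thesis using fy unfolding k_def bt_T[OF V False] by simp
  qed
qed

text \<open>In every column of a tower with long columns the total of \<open>a\<close> is put into the lowest levels,
  filling each level up to \<open>g\<close>.\<close>

lemma cohom_between:
  assumes a: "loc_const a" "spos T a" and g: "loc_const g" "\<And>x. 0 \<le> g x"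
    and ga: "spos T (\<lambda>x. g x - a x)"
  shows "\<exists>b. loc_const b \<and> (\<forall>x. 0 \<le> b x \<and> b x \<le> g x) \<and> cohom T b a"
proof -
  have lga: "loc_const (\<lambda>x. g x - a x)" by (rule loc_const_app2[OF g(1) a(1)])
  obtain N1 where N1: "\<And>n x. N1 \<le> n \<Longrightarrow> 0 \<le> bsum T n a x"
    using bsum_at_least[OF a(2,1)] by blast
  obtain N2 where N2: "\<And>n x. N2 \<le> n \<Longrightarrow> 0 \<le> bsum T n (\<lambda>x. g x - a x) x"
    using bsum_at_least[OF ga lga] by blast
  \<comment> \<open>In columns of height at least \<open>N\<close> the sums of \<open>a\<close> and
    of \<open>g - a\<close> are both nonnegative, so the total of \<open>a\<close> fits under the
    capacity given by \<open>g\<close>.\<close>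
  define N where "N = max N1 N2"
  obtain V where V: "clopen V" "undefined \<in> V"
      "\<And>v i. v \<in> V \<Longrightarrow> 0 < i \<Longrightarrow> i < N \<Longrightarrow> (T ^^ i) v \<notin> V"
    using small_return_nbhd[of UNIV undefined N] by auto
  then have V': "clopen V" "V \<noteq> {}" by auto
  have long: "N \<le> rt V x" if "x \<in> V" for x
    using V(3)[OF that] rt_in[OF V'] by (meson not_le_imp_less)
  define G where "G i x = bsum T i g x" for i x
  define s where "s x = bsum T (rt V x) a x" for x
  \<comment> \<open>\<open>G i\<close> is the capacity of the lowest \<open>i\<close> levels, so
    \<open>min s (G i)\<close> is the amount they hold after filling from below; \<open>b\<close> is
    its increment at the level of \<open>y\<close>.\<close>
  define b where "b y = min (s ((Ti ^^ bt V y) y)) (G (Suc (bt V y)) ((Ti ^^ bt V y) y))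
    - min (s ((Ti ^^ bt V y) y)) (G (bt V y) ((Ti ^^ bt V y) y))" for y
  have ls: "loc_const s" unfolding s_def[abs_def]
    using loc_const_family[OF loc_const_rt[OF V'], of "\<lambda>i x. bsum T i a x"] loc_const_bsum[OF a(1)]
    by simp
  have lb: "loc_const b"
  proof -
    have "loc_const (\<lambda>y. min (s ((Ti ^^ i) y)) (G (Suc i) ((Ti ^^ i) y))
      - min (s ((Ti ^^ i) y)) (G i ((Ti ^^ i) y)))" for i
      unfolding G_def
      by (rule loc_const_app3[of _ _ _ "\<lambda>u v w. min u v - min u w"];
        intro loc_const_pow_inv[of s] loc_const_pow_inv[OF loc_const_bsum[OF g(1)]] ls)
    then show ?thesis unfolding b_def[abs_def]
      using loc_const_family[OF loc_const_bt[OF V'], of "\<lambda>i y. min (s ((Ti ^^ i) y)) (G (Suc i) ((Ti ^^ i) y))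
      - min (s ((Ti ^^ i) y)) (G i ((Ti ^^ i) y))"] by simp
  qed
  have bg: "0 \<le> b y \<and> b y \<le> g y" for y
  proof -
    have "G (Suc (bt V y)) ((Ti ^^ bt V y) y) = G (bt V y) ((Ti ^^ bt V y) y) + g y"
      by (simp add: G_def bsum_Suc)
    then show ?thesis using g(2)[of y] unfolding b_def by (auto simp: min_def)
  qed
  have colb: "bsum T (rt V x) b x = s x" if x: "x \<in> V" for x
  proof -
    have "bsum T j b x = min (s x) (G j x) - min (s x) 0" if "j \<le> rt V x" for j
      using that
    proof (induction j)
      case 0
      then show ?case by (simp add: G_def)
    next
      case (Suc j)
      then have "bt V ((T ^^ j) x) = j" using bt_column[OF x] by simp
      then have "b ((T ^^ j) x) = min (s x) (G (Suc j) x) - min (s x) (G j x)"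
        unfolding b_def by simp
      then show ?case using Suc by (simp add: bsum_Suc)
    qed
    from this[of "rt V x"] have "bsum T (rt V x) b x = min (s x) (G (rt V x) x) - min (s x) 0"
      by simp
    moreover have "0 \<le> s x" unfolding s_def using N1[of "rt V x" x] long[OF x] by (simp add: N_def)
    moreover have "s x \<le> G (rt V x) x"
      using N2[of "rt V x" x] long[OF x] by (simp add: N_def s_def G_def bsum_minus)
    ultimately show ?thesis by simp
  qed
  have "cohom T (\<lambda>x. b x - a x) (\<lambda>x. 0)"
  proof (rule column_sums_cohom[OF V'])
    show "loc_const (\<lambda>x. b x - a x)" by (rule loc_const_app2[OF lb a(1)])
    show "bsum T (rt V x) (\<lambda>x. b x - a x) x = 0" if "x \<in> V" for x
      using colb[OF that] by (simp add: bsum_minus s_def)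
  qed
  then have "cohom T b a" by (simp add: cohom_def)
  with lb bg show ?thesis by blast
qed

abbreviation ind :: "'a set \<Rightarrow> 'a \<Rightarrow> int" where
  "ind A x \<equiv> of_bool (x \<in> A)"

text \<open>An integer function between 0 and an indicator takes only the values 0 and 1, so it is
  itself an indicator.\<close>

lemma clopen_between:
  assumes a: "loc_const a" "spos T a" and A: "clopen A" and "spos T (\<lambda>x. ind A x - a x)"
  shows "\<exists>B. clopen B \<and> B \<subseteq> A \<and> cohom T (ind B) a"
proof -
  obtain b where b: "loc_const b" "\<And>x. 0 \<le> b x \<and> b x \<le> ind A x" "cohom T b a"
    using cohom_between[OF a loc_const_of_bool[OF A] _ assms(4)] by auto
  have "b x = ind {x. b x = 1} x" "b x = 1 \<Longrightarrow> x \<in> A" for x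
    using b(2)[of x] by (cases "x \<in> A"; auto)+
  then have "b = ind {x. b x = 1}" "{x. b x = 1} \<subseteq> A" by auto
  with b(3) clopen_Collect[OF b(1), of "\<lambda>v. v = 1"] show ?thesis by metis
qed

lemma spos_mono:
  assumes "spos T f" "\<And>x. f x \<le> g x"
  shows "spos T g"
proof -
  obtain n where "\<And>x. 0 < bsum T n f x" using assms(1) by (auto simp: spos_def)
  moreover have "bsum T n f x \<le> bsum T n g x" for x
    unfolding bsum_def using assms(2) by (intro sum_mono) auto
  ultimately show ?thesis unfolding spos_def by (metis less_le_trans)
qed

lemma spos_nonzero:
  assumes "spos T f"
  shows "\<exists>x. f x \<noteq> 0"
proof (rule ccontr)
  assume "\<nexists>x. f x \<noteq> 0"
  then have "bsum T n f x = 0" for n x by (simp add: bsum_def)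
  with assms show False by (simp add: spos_def)
qed

text \<open>If returns to \<open>V\<close> take at least \<open>N\<close> steps, an orbit segment of
  length \<open>N\<close> meets \<open>V\<close> at most once, while \<open>a\<close> sums to at
  least 2 along it. Removing \<open>V\<close> thus keeps the inequality strict.\<close>

lemma small_indicator:
  assumes a: "loc_const a" "spos T a" and U: "open U" "x \<in> U"
  shows "\<exists>V. clopen V \<and> x \<in> V \<and> V \<subseteq> U \<and> spos T (\<lambda>x. a x - ind V x)"
proof -
  obtain N where N: "\<And>n x. N \<le> n \<Longrightarrow> 2 \<le> bsum T n a x"
    using bsum_at_least[OF a(2,1)] by blast
  obtain V where V: "clopen V" "x \<in> V" "V \<subseteq> U"
      "\<And>v i. v \<in> V \<Longrightarrow> 0 < i \<Longrightarrow> i < N \<Longrightarrow> (T ^^ i) v \<notin> V"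
    using small_return_nbhd[OF U, of N] by metis
  have "bsum T N (ind V) y \<le> 1" for y
  proof -
    have "i = j" if "i < N" "j < N" "(T ^^ i) y \<in> V" "(T ^^ j) y \<in> V" for i j
      using that
    proof (induction i j rule: linorder_wlog)
      case (le i j)
      have "(T ^^ (j - i)) ((T ^^ i) y) = (T ^^ j) y"
        using funpow_add[of "j - i" i T] le by simp
      moreover have "(T ^^ (j - i)) ((T ^^ i) y) \<notin> V" if "i < j"
        by (rule V(4)) (use that le in auto)
      ultimately show ?case using le by (metis le_neq_implies_less)
    qed auto
    then have "card {i \<in> {..<N}. (T ^^ i) y \<in> V} \<le> 1"
      by (intro card_le_Suc0_iff_eq[THEN iffD2, folded One_nat_def]) auto
    moreover have "bsum T N (ind V) y = int (card {i \<in> {..<N}. (T ^^ i) y \<in> V})"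
      by (simp add: bsum_def Int_def)
    ultimately show ?thesis by simp
  qed
  then have "0 < bsum T N (\<lambda>x. a x - ind V x) y" for y
    unfolding bsum_minus using N[OF order_refl, of y] by (metis diff_gt_0_iff_gt le_less_trans less_le_trans one_less_numeral_iff semiring_norm(76))
  then have "spos T (\<lambda>x. a x - ind V x)" by (auto simp: spos_def)
  with V show ?thesis by blast
qed

lemma small_indicator_finite:
  assumes a: "loc_const a" "spos T a" and F: "finite F" and U: "open U" "F \<subseteq> U"
  shows "\<exists>V. clopen V \<and> F \<subseteq> V \<and> V \<subseteq> U \<and> spos T (\<lambda>x. a x - ind V x)"
  using F U(2)
proof (induction F)
  case empty
  then show ?case using a(2) by (intro exI[of _ "{}"]) auto
next
  case (insert x F)
  then obtain V where V: "clopen V" "F \<subseteq> V" "V \<subseteq> U" "spos T (\<lambda>x. a x - ind V x)" by auto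
  obtain W where W: "clopen W" "x \<in> W" "W \<subseteq> U" "spos T (\<lambda>x. a x - ind V x - ind W x)"
    using small_indicator[OF loc_const_app2[OF a(1) V(1)] V(4) U(1), of x] insert.prems by auto
  have "spos T (\<lambda>x. a x - ind (V \<union> W) x)" by (rule spos_mono[OF W(4)]) auto
  moreover have "clopen (V \<union> W)" using V(1) W(1) by (rule clopen_simps)
  ultimately show ?case using V W by (intro exI[of _ "V \<union> W"]) auto
qed

text \<open>Neighbourhoods \<open>U\<close> of \<open>F\<close> and \<open>W\<close> of
  \<open>G\<close> are chosen so small that both strict inequalities survive. A set of class
  \<open>a - ind U\<close> is then found in \<open>A - U - W\<close>, and \<open>U\<close> is added
  to it.\<close>

lemma clopen_between_points:
  assumes a: "loc_const a" "spos T a" and A: "clopen A" and aA: "spos T (\<lambda>x. ind A x - a x)"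
    and F: "finite F" "F \<subseteq> A" and G: "finite G" "G \<subseteq> A" "F \<inter> G = {}"
  shows "\<exists>B. clopen B \<and> B \<subseteq> A \<and> F \<subseteq> B \<and> B \<inter> G = {} \<and> cohom T (ind B) a"
proof -
  have "open (A - G)" using A G(1) by (simp add: clopen_iff open_Diff finite_imp_closed)
  then obtain U where U: "clopen U" "F \<subseteq> U" "U \<subseteq> A - G" "spos T (\<lambda>x. a x - ind U x)"
    using small_indicator_finite[OF a F(1), of "A - G"] F(2) G(3) by auto
  have "open (A - U)" using A U(1) by (simp add: clopen_iff open_Diff)
  then obtain W where W: "clopen W" "G \<subseteq> W" "W \<subseteq> A - U" "spos T (\<lambda>x. ind A x - a x - ind W x)"
    using small_indicator_finite[OF loc_const_app2[OF A a(1)] aA G(1), of "A - U"] U(3) G(2) by auto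
  have "loc_const (\<lambda>x. a x - ind U x)" by (rule loc_const_app2[OF a(1) U(1)])
  moreover have "clopen (A - U - W)" using A U(1) W(1) by (intro clopen_simps)
  moreover have "spos T (\<lambda>x. ind (A - U - W) x - (a x - ind U x))"
    by (rule spos_mono[OF W(4)]) (use U(3) W(3) in auto)
  ultimately obtain B where B: "clopen B" "B \<subseteq> A - U - W" "cohom T (ind B) (\<lambda>x. a x - ind U x)"
    using clopen_between[of "\<lambda>x. a x - ind U x" "A - U - W"] U(4) by auto
  have "ind (B \<union> U) = (\<lambda>x. ind B x + ind U x)" using B(2) by (auto simp: fun_eq_iff)
  then have "cohom T (ind (B \<union> U)) a"
    using cohom_add[OF B(3) cohom_refl[of T "ind U"]] by simp
  moreover have "clopen (B \<union> U)" using B(1) U(1) by (rule clopen_simps)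
  ultimately show ?thesis using B U W A by (intro exI[of _ "B \<union> U"]) auto
qed

lemma spos_ind: "clopen A \<Longrightarrow> A \<noteq> {} \<Longrightarrow> spos T (ind A)"
  using spos_nonneg[of "ind A"] loc_const_of_bool[of A] by auto

lemma null_clopen_empty: "clopen C \<Longrightarrow> cohom T (ind C) (\<lambda>x. 0) \<Longrightarrow> C = {}"
  using spos_not_cohom_nonpos[of "ind C" "\<lambda>x. 0"] spos_ind[of C] loc_const_of_bool[of C] by auto

section \<open>Moving clopen sets along orbits\<close>

lemma cohom_T: "loc_const f \<Longrightarrow> cohom T f (\<lambda>x. f (T x))"
  by (rule cohomI[of f]) auto

lemma cohom_pow: "loc_const f \<Longrightarrow> cohom T f (\<lambda>x. f ((T ^^ n) x))"
proof (induction n)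
  case (Suc n)
  have "cohom T (\<lambda>x. f ((T ^^ n) x)) (\<lambda>x. f ((T ^^ n) (T x)))"
    by (rule cohom_T[OF loc_const_pow[OF Suc.prems]])
  then show ?case using cohom_trans Suc by (fastforce simp: funpow_swap1)
qed simp

lemma cohom_pow_inv:
  assumes "loc_const f"
  shows "cohom T f (\<lambda>x. f ((Ti ^^ n) x))"
  using cohom_sym[OF cohom_pow[OF loc_const_pow_inv[OF assms, of n], of n]] by simp

text \<open>\<open>A\<close> is cut by the value of \<open>p\<close>. Each piece is moved by one
  fixed power of \<open>T\<close>, which does not change its class, and injectivity makes the
  indicator of the image the sum of the moved indicators.\<close>

lemma speedup_image:
  assumes A: "clopen A" and p: "loc_const p" and inj: "inj_on (\<lambda>x. (T ^^ p x) x) A"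
  shows "clopen ((\<lambda>x. (T ^^ p x) x) ` A)" "cohom T (ind A) (ind ((\<lambda>x. (T ^^ p x) x) ` A))"
proof -
  let ?I = "(\<lambda>x. (T ^^ p x) x) ` A"
  obtain K where K: "\<And>x. p x \<le> K" using loc_const_nat_bounded[OF compact_space p] by blast
  define B where "B n = {x \<in> A. p x = n}" for n
  have B: "loc_const (ind (B n))" for n
    using loc_const_app2[OF A p, of "\<lambda>u v. of_bool (u \<and> v = n)"] by (simp add: B_def)
  have img: "ind ?I y = (\<Sum>n\<le>K. ind (B n) ((Ti ^^ n) y))" for y
  proof (cases "y \<in> ?I")
    case True
    then obtain x where x: "x \<in> A" "y = (T ^^ p x) x" by auto
    have "ind (B n) ((Ti ^^ n) y) = (if n = p x then 1 else 0)" for n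
    proof (cases "(Ti ^^ n) y \<in> B n")
      case True
      then have *: "(Ti ^^ n) y \<in> A" "p ((Ti ^^ n) y) = n" by (auto simp: B_def)
      then have "(T ^^ p ((Ti ^^ n) y)) ((Ti ^^ n) y) = (T ^^ p x) x" using x by simp
      then have "(Ti ^^ n) y = x" by (rule inj_onD[OF inj _ *(1) x(1)])
      then show ?thesis using * True by auto
    next
      case False
      then show ?thesis using x by (auto simp: B_def)
    qed
    then show ?thesis using True K[of x] by simp
  next
    case False
    have "(Ti ^^ n) y \<notin> B n" for n
    proof
      assume "(Ti ^^ n) y \<in> B n"
      then have *: "(Ti ^^ n) y \<in> A" "y = (T ^^ p ((Ti ^^ n) y)) ((Ti ^^ n) y)"
        by (simp_all add: B_def)
      show False
        using False rev_image_eqI[of "(Ti ^^ n) y" A y "\<lambda>x. (T ^^ p x) x", OF *] by contradiction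
    qed
    then show ?thesis using False by simp
  qed
  have dom: "ind A x = (\<Sum>n\<le>K. ind (B n) x)" for x
  proof (cases "x \<in> A")
    case True
    then have "ind (B n) x = (if n = p x then 1 else 0)" for n by (auto simp: B_def)
    then show ?thesis using True K[of x] by simp
  qed (auto simp: B_def)
  have "loc_const (ind ?I)"
    unfolding img by (rule loc_const_sum) (rule loc_const_pow_inv[OF B])
  from clopen_Collect[OF this, of "\<lambda>v. v = 1"] show "clopen ?I" by simp
  show "cohom T (ind A) (ind ?I)"
    unfolding img dom by (rule cohom_sum) (rule cohom_pow_inv[OF B])
qed

text \<open>Points of \<open>A\<close> join a first-in-first-out queue and a visit of \<open>B\<close> serves one of them.
  A transfer function \<open>q\<close> of \<open>ind B - ind A\<close> is a possible queue length, and every point of \<open>A\<close>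
  is moved along its orbit to the visit of \<open>B\<close> at which it is served.\<close>

lemma speedup_between:
  assumes A: "clopen A" and B: "clopen B" "B \<noteq> {}" and AB: "cohom T (ind A) (ind B)"
  shows "\<exists>p. loc_const p \<and> (\<forall>x. 0 < p x) \<and> bij_betw (\<lambda>x. (T ^^ p x) x) A B"
proof -
  obtain k where k: "loc_const k" "\<And>x. ind A x - ind B x = k x - k (T x)"
    using cohomE[OF AB] by blast
  obtain K where K: "\<And>x. \<bar>k x\<bar> \<le> K"
    using loc_const_int_bounded[OF compact_space k(1)] by blast
  \<comment> \<open>The sign makes \<open>q\<close> grow at points of \<open>A\<close> and drop at
    points of \<open>B\<close>; the constant \<open>K + 1\<close> makes it at least 1
    everywhere.\<close>
  define q where "q x = K + 1 - k x" for x
  have q: "loc_const q" unfolding q_def[abs_def] using k(1) by (rule loc_const_app)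
  have q1: "1 \<le> q x" for x using K[of x] by (simp add: q_def abs_le_iff)
  have qm: "q ((T ^^ m) x) - q x = bsum T m (ind A) x - bsum T m (ind B) x" for m x
    using bsum_cob[of T m k x] by (simp add: q_def bsum_minus[symmetric] k(2))
  \<comment> \<open>With \<open>q x\<close> points ahead of it, \<open>x\<close> is served at the
    visit of \<open>B\<close> numbered \<open>q x + 1\<close>, counted from time 0. As
    \<open>q x\<close> is at least 1, this is not the visit at time 0, so the jump is
    positive.\<close>
  define p where "p x = (LEAST n. 0 < n \<and> q x < bsum T (Suc n) (ind B) x)" for x
  have ex: "\<exists>n. 0 < n \<and> q x < bsum T (Suc n) (ind B) x" for x
  proof -
    obtain N where "\<And>n y. N \<le> n \<Longrightarrow> q x + 1 \<le> bsum T n (ind B) y"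
      using bsum_at_least[OF spos_ind[OF B] loc_const_of_bool[OF B(1)]] by blast
    from this[of "Suc (Suc N)" x] show ?thesis by (intro exI[of _ "Suc N"]) simp
  qed
  have lp: "loc_const p"
    unfolding p_def[abs_def]
  proof (rule loc_const_Least)
    show "loc_const (\<lambda>x. 0 < n \<and> q x < bsum T (Suc n) (ind B) x)" for n
      by (rule loc_const_app2[OF q loc_const_bsum[OF loc_const_of_bool[OF B(1)]]])
  qed (rule ex)
  have p0: "0 < p x" and pq: "q x < bsum T (Suc (p x)) (ind B) x" for x
    using LeastI_ex[OF ex[of x]] unfolding p_def by auto
  have pq': "bsum T (p x) (ind B) x \<le> q x" for x
  proof (cases "p x = 1")
    case True
    then show ?thesis using q1[of x] by (simp add: bsum_def)
  next
    case False
    then have "p x - 1 < p x" "0 < p x - 1" "Suc (p x - 1) = p x" using p0[of x] by auto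
    then show ?thesis
      using not_less_Least[of "p x - 1" "\<lambda>n. 0 < n \<and> q x < bsum T (Suc n) (ind B) x"]
      by (simp add: p_def[symmetric])
  qed
  have pB: "(T ^^ p x) x \<in> B" and pe: "bsum T (p x) (ind B) x = q x" for x
  proof -
    show "(T ^^ p x) x \<in> B" using pq[of x] pq'[of x] by (cases "(T ^^ p x) x \<in> B") (auto simp: bsum_Suc)
    then show "bsum T (p x) (ind B) x = q x" using pq[of x] pq'[of x] by (simp add: bsum_Suc)
  qed
  \<comment> \<open>If \<open>x\<close> and a later point \<open>y\<close> of its orbit are served
    together, comparing queue lengths shows that nothing in \<open>A\<close> occurs in the
    \<open>m\<close> steps from \<open>x\<close> to \<open>y\<close>; but \<open>x\<close> itself
    does unless \<open>m = 0\<close>.\<close>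
  have inj: "x = y" if "x \<in> A" "y \<in> A" "(T ^^ p x) x = (T ^^ p y) y" "p y \<le> p x" for x y
  proof -
    define m where "m = p x - p y"
    have pm: "p x = m + p y" using that by (simp add: m_def)
    then have "(T ^^ p y) ((T ^^ m) x) = (T ^^ p y) y"
      using that(3) funpow_add[of "p y" m T] by (simp add: add.commute)
    then have y: "y = (T ^^ m) x" by (metis inj_pow)
    have "q x = bsum T m (ind B) x + q y"
      using pe[of x] pe[of y] bsum_add[of T m "p y" "ind B" x] by (simp add: pm y)
    then have "bsum T m (ind A) x = 0" using qm[of m x] by (simp add: y)
    moreover have "0 < bsum T m (ind A) x" if "0 < m"
      unfolding bsum_def by (rule sum_pos2[of _ 0]) (use that \<open>x \<in> A\<close> in auto)
    ultimately have "m = 0" by (cases m) auto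
    then show "x = y" by (simp add: y)
  qed
  have inj: "inj_on (\<lambda>x. (T ^^ p x) x) A"
  proof (rule inj_onI)
    fix x y assume "x \<in> A" "y \<in> A" "(T ^^ p x) x = (T ^^ p y) y"
    then show "x = y" using inj[of x y] inj[of y x] by (cases "p y \<le> p x") auto
  qed
  let ?I = "(\<lambda>x. (T ^^ p x) x) ` A"
  have I: "?I \<subseteq> B" using pB by auto
  \<comment> \<open>Surjectivity follows from classes alone: the part of \<open>B\<close> that is
    missed has class 0, and a nonempty clopen set does not.\<close>
  have "clopen (B - ?I)" using B(1) speedup_image(1)[OF A lp inj] by (rule clopen_simps)
  moreover have "cohom T (ind (B - ?I)) (\<lambda>x. 0)"
  proof -
    have "cohom T (\<lambda>x. ind B x - ind ?I x) (\<lambda>x. ind B x - ind B x)"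
      using cohom_diff[OF cohom_refl cohom_trans[OF cohom_sym[OF speedup_image(2)[OF A lp inj]] AB]] .
    moreover have "ind (B - ?I) = (\<lambda>x. ind B x - ind ?I x)" using I by (auto simp: fun_eq_iff)
    ultimately show ?thesis by simp
  qed
  ultimately have "B - ?I = {}" by (rule null_clopen_empty)
  with I have "?I = B" by auto
  with inj lp p0 show ?thesis by (auto simp: bij_betw_def)
qed

end

subsection \<open>Dimension groups\<close>

lemma cob_class_altdef: "cob_class T f = {g. cohom T g f}"
proof -
  have "g \<in> cob_class T f \<longleftrightarrow> cohom T g f" for g
  proof
    assume "g \<in> cob_class T f"
    then obtain h where "h \<in> cob T" "g = (\<lambda>x. h x + f x)"
      by (auto simp: cob_class_def r_coset_def cont_int_def)
    then show "cohom T g f" by (simp add: cohom_def)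
  next
    assume "cohom T g f"
    then have "(\<lambda>x. g x - f x) \<in> cob T" by (simp add: cohom_def)
    then show "g \<in> cob_class T f"
      by (auto simp: cob_class_def r_coset_def cont_int_def intro!: bexI[of _ "\<lambda>x. g x - f x"])
  qed
  then show ?thesis by auto
qed

lemma cob_class_eq_iff: "cob_class T f = cob_class T g \<longleftrightarrow> cohom T f g"
proof
  assume "cob_class T f = cob_class T g"
  then have "f \<in> cob_class T g" by (metis cob_class_altdef cohom_refl mem_Collect_eq)
  then show "cohom T f g" by (simp add: cob_class_altdef)
next
  assume "cohom T f g"
  then have "cohom T k f \<longleftrightarrow> cohom T k g" for k
    using cohom_trans[of T k f g] cohom_trans[of T k g f] cohom_sym[of T f g] by blast
  then show "cob_class T f = cob_class T g" by (simp add: cob_class_altdef)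
qed

lemma dimension_group_carrier: "carrier (dimension_group T) = cob_class T ` {f. loc_const f}"
  by (auto simp: dimension_group_def FactGroup_def RCOSETS_def cob_class_def cont_int_def
      loc_const_iff_continuous)

lemma dimension_group_mult:
  "cob_class T f \<otimes>\<^bsub>dimension_group T\<^esub> cob_class T g = cob_class T (\<lambda>x. f x + g x)"
proof -
  have "cob_class T f <#>\<^bsub>cont_int\<^esub> cob_class T g = cob_class T (\<lambda>x. f x + g x)"
  proof
    show "cob_class T f <#>\<^bsub>cont_int\<^esub> cob_class T g \<subseteq> cob_class T (\<lambda>x. f x + g x)"
      unfolding cob_class_altdef set_mult_def by (auto simp: cont_int_def intro: cohom_add)
    show "cob_class T (\<lambda>x. f x + g x) \<subseteq> cob_class T f <#>\<^bsub>cont_int\<^esub> cob_class T g"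
    proof
      fix k assume "k \<in> cob_class T (\<lambda>x. f x + g x)"
      then have k: "cohom T k (\<lambda>x. f x + g x)" by (simp add: cob_class_altdef)
      have "cohom T (\<lambda>x. k x - g x) f"
        using cohom_diff[OF k cohom_refl[of T g]] by simp
      then show "k \<in> cob_class T f <#>\<^bsub>cont_int\<^esub> cob_class T g"
        unfolding cob_class_altdef set_mult_def
        by (auto simp: cont_int_def) (rule exI[of _ "\<lambda>x. k x - g x"], auto intro!: exI[of _ g])
    qed
  qed
  then show ?thesis by (simp add: dimension_group_def FactGroup_def)
qed

lemma dimension_group_one: "\<one>\<^bsub>dimension_group T\<^esub> = cob_class T (\<lambda>x. 0)"
  by (simp add: dimension_group_def FactGroup_def cob_class_altdef cohom_def)

lemma dimension_group_pos_cone: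
  "pos_cone (dimension_group T) = cob_class T ` {f. loc_const f \<and> (\<forall>x. 0 \<le> f x)}"
  by (auto simp: dimension_group_def cont_int_def loc_const_iff_continuous)

lemma dimension_group_order_unit: "order_unit (dimension_group T) = cob_class T (\<lambda>x. 1)"
  by (simp add: dimension_group_def)

lemma dimension_group_group: "group (dimension_group T)"
proof (rule groupI)
  show "\<exists>y\<in>carrier (dimension_group T). y \<otimes>\<^bsub>dimension_group T\<^esub> x = \<one>\<^bsub>dimension_group T\<^esub>"
    if x: "x \<in> carrier (dimension_group T)" for x
  proof -
    obtain f where f: "f \<in> {f. loc_const f}" "x = cob_class T f"
      using x unfolding dimension_group_carrier by blast
    then have "loc_const (\<lambda>x. - f x)" by (intro loc_const_arith) simp
    then have "cob_class T (\<lambda>x. - f x) \<in> carrier (dimension_group T)"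
      by (auto simp: dimension_group_carrier)
    moreover have "cob_class T (\<lambda>x. - f x) \<otimes>\<^bsub>dimension_group T\<^esub> x = \<one>\<^bsub>dimension_group T\<^esub>"
      unfolding f dimension_group_mult dimension_group_one by simp
    ultimately show ?thesis by blast
  qed
qed (auto simp: dimension_group_carrier dimension_group_mult dimension_group_one add.assoc
    intro!: imageI loc_const_arith)

lemma dimension_group_inv:
  assumes "loc_const f"
  shows "inv\<^bsub>dimension_group T\<^esub> (cob_class T f) = cob_class T (\<lambda>x. - f x)"
proof (rule group.inv_equality[OF dimension_group_group])
  show "cob_class T (\<lambda>x. - f x) \<otimes>\<^bsub>dimension_group T\<^esub> cob_class T f = \<one>\<^bsub>dimension_group T\<^esub>"
    by (simp add: dimension_group_mult dimension_group_one)
qed (use assms in \<open>auto simp: dimension_group_carrier intro!: imageI loc_const_arith\<close>)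

context minimal_system
begin

text \<open>A nonnegative function that is not identically 0 cannot be a coboundary: its Birkhoff
  sums grow beyond every bound.\<close>

lemma ord_less_iff:
  assumes "loc_const a"
  shows "ord_less (dimension_group T) (cob_class T a) (cob_class T b) \<longleftrightarrow>
    (\<exists>f. loc_const f \<and> (\<forall>x. 0 \<le> f x) \<and> (\<exists>x. f x \<noteq> 0) \<and> cohom T (\<lambda>x. b x - a x) f)"
    (is "?L \<longleftrightarrow> ?R")
proof -
  have L: "?L \<longleftrightarrow> (\<exists>f. loc_const f \<and> (\<forall>x. 0 \<le> f x) \<and> cohom T (\<lambda>x. b x - a x) f) \<and>
      \<not> cohom T (\<lambda>x. b x - a x) (\<lambda>x. 0)"
    unfolding ord_less_def dimension_group_inv[OF assms] dimension_group_mult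
      dimension_group_one dimension_group_pos_cone
    by (auto simp: cob_class_eq_iff)
  show ?thesis
  proof
    assume ?L
    then obtain f where f: "loc_const f" "\<And>x. 0 \<le> f x" "cohom T (\<lambda>x. b x - a x) f"
      "\<not> cohom T (\<lambda>x. b x - a x) (\<lambda>x. 0)" unfolding L by blast
    moreover have "\<exists>x. f x \<noteq> 0"
    proof (rule ccontr)
      assume "\<nexists>x. f x \<noteq> 0"
      then have "f = (\<lambda>x. 0)" by auto
      with f show False by simp
    qed
    ultimately show ?R by blast
  next
    assume ?R
    then obtain f y where f: "loc_const f" "\<And>x. 0 \<le> f x" "cohom T (\<lambda>x. b x - a x) f" "f y \<noteq> 0"
      by blast
    then have "spos T f" by (intro spos_nonneg)
    have "\<not> cohom T (\<lambda>x. b x - a x) (\<lambda>x. 0)"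
    proof
      assume "cohom T (\<lambda>x. b x - a x) (\<lambda>x. 0)"
      then have "cohom T f (\<lambda>x. 0)" using f(3) cohom_sym cohom_trans by blast
      then show False using spos_not_cohom_nonpos[OF \<open>spos T f\<close> f(1)] by blast
    qed
    then show ?L unfolding L using f by blast
  qed
qed

lemma ord_less_spos:
  assumes "loc_const a" "loc_const b" "ord_less (dimension_group T) (cob_class T a) (cob_class T b)"
  shows "spos T (\<lambda>x. b x - a x)"
proof -
  obtain f y where f: "loc_const f" "\<And>x. 0 \<le> f x" "cohom T (\<lambda>x. b x - a x) f" "f y \<noteq> 0"
    using assms ord_less_iff by blast
  then have "spos T f" by (intro spos_nonneg)
  then show ?thesis using spos_cohom cohom_sym[OF f(3)] f(1) by blast
qed

end

text \<open>A homomorphism of classes recorded as a relation between representatives, so that the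
  construction can speak of functions and clopen sets instead of cosets. Uniqueness is one-sided:
  \<open>b\<close> determines the class of \<open>a\<close>, while a kernel leaves the class of
  \<open>b\<close> open. In \<open>rel_exhaustive\<close> the bounds \<open>0 < c < a\<close> are
  witnessed by nonnegative, nonzero functions \<open>c\<close> and \<open>d\<close>.\<close>

locale exhaustive_relation = X: minimal_system T + Y: minimal_system S
  for T :: "'a::metric_space \<Rightarrow> 'a" and S :: "'b::metric_space \<Rightarrow> 'b" +
  fixes \<Phi> :: "('a \<Rightarrow> int) \<Rightarrow> ('b \<Rightarrow> int) \<Rightarrow> bool"
  assumes rel_loc_const: "\<Phi> a b \<Longrightarrow> loc_const a" "\<Phi> a b \<Longrightarrow> loc_const b"
    and rel_one: "\<Phi> (\<lambda>x. 1) (\<lambda>x. 1)"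
    and rel_add: "\<Phi> a b \<Longrightarrow> \<Phi> a' b' \<Longrightarrow> \<Phi> (\<lambda>x. a x + a' x) (\<lambda>x. b x + b' x)"
    and rel_uminus: "\<Phi> a b \<Longrightarrow> \<Phi> (\<lambda>x. - a x) (\<lambda>x. - b x)"
    and rel_cohom: "\<Phi> a b \<Longrightarrow> loc_const a' \<Longrightarrow> loc_const b' \<Longrightarrow> cohom T a a' \<Longrightarrow> cohom S b b' \<Longrightarrow> \<Phi> a' b'"
    and rel_unique: "\<Phi> a b \<Longrightarrow> \<Phi> a' b \<Longrightarrow> cohom T a a'"
    and rel_nonneg: "loc_const b \<Longrightarrow> (\<And>x. 0 \<le> b x) \<Longrightarrow> \<exists>a. \<Phi> a b \<and> (\<forall>x. 0 \<le> a x)"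
    and rel_exhaustive: "\<Phi> a b \<Longrightarrow> (\<And>x. 0 \<le> b x) \<Longrightarrow> loc_const c \<Longrightarrow> loc_const d \<Longrightarrow>
      (\<And>x. 0 \<le> c x) \<Longrightarrow> (\<And>x. 0 \<le> d x) \<Longrightarrow> c x \<noteq> 0 \<Longrightarrow> d x' \<noteq> 0 \<Longrightarrow>
      cohom T (\<lambda>x. a x - c x) d \<Longrightarrow> \<exists>b'. \<Phi> c b' \<and> spos S b' \<and> spos S (\<lambda>x. b x - b' x)"

lemma exhaustive_relation_of_epi:
  assumes X: "minimal_system T" and Y: "minimal_system S"
    and epi: "unital_ordered_epi (dimension_group S) (dimension_group T) \<phi>"
    and exh: "exhaustive (dimension_group S) (dimension_group T) \<phi>"
  shows "exhaustive_relation T S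
    (\<lambda>a b. loc_const a \<and> loc_const b \<and> \<phi> (cob_class S b) = cob_class T a)"
proof -
  interpret X: minimal_system T by fact
  interpret Y: minimal_system S by fact
  have hom: "\<phi> \<in> hom (dimension_group S) (dimension_group T)"
    and pos: "\<phi> ` pos_cone (dimension_group S) \<subseteq> pos_cone (dimension_group T)"
    and unit: "\<phi> (cob_class S (\<lambda>x. 1)) = cob_class T (\<lambda>x. 1)"
    using epi by (auto simp: unital_ordered_epi_def epi_def dimension_group_order_unit)
  show ?thesis
  proof unfold_locales
    fix a b a' b'
    assume 1: "loc_const a \<and> loc_const b \<and> \<phi> (cob_class S b) = cob_class T a"
      and 2: "loc_const a' \<and> loc_const b' \<and> \<phi> (cob_class S b') = cob_class T a'"
    have "\<phi> (cob_class S b \<otimes>\<^bsub>dimension_group S\<^esub> cob_class S b') =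
        \<phi> (cob_class S b) \<otimes>\<^bsub>dimension_group T\<^esub> \<phi> (cob_class S b')"
      by (rule hom_mult[OF hom]) (use 1 2 in \<open>auto simp: dimension_group_carrier\<close>)
    then have "\<phi> (cob_class S (\<lambda>x. b x + b' x)) = cob_class T (\<lambda>x. a x + a' x)"
      using 1 2 by (simp add: dimension_group_mult)
    moreover have "loc_const (\<lambda>x. a x + a' x)" "loc_const (\<lambda>x. b x + b' x)"
      using 1 2 by (auto intro: loc_const_arith)
    ultimately show "loc_const (\<lambda>x. a x + a' x) \<and> loc_const (\<lambda>x. b x + b' x) \<and>
        \<phi> (cob_class S (\<lambda>x. b x + b' x)) = cob_class T (\<lambda>x. a x + a' x)" by blast
  next
    fix a b
    assume ab: "loc_const a \<and> loc_const b \<and> \<phi> (cob_class S b) = cob_class T a"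
    then have l: "loc_const (\<lambda>x. - a x)" "loc_const (\<lambda>x. - b x)" by (auto intro: loc_const_arith)
    have "group_hom (dimension_group S) (dimension_group T) \<phi>"
      by (intro group_hom.intro dimension_group_group group_hom_axioms.intro hom)
    from group_hom.hom_inv[OF this, of "cob_class S b"]
    have "\<phi> (cob_class S (\<lambda>x. - b x)) = cob_class T (\<lambda>x. - a x)"
      using ab by (auto simp: dimension_group_carrier dimension_group_inv)
    with l show "loc_const (\<lambda>x. - a x) \<and> loc_const (\<lambda>x. - b x) \<and>
        \<phi> (cob_class S (\<lambda>x. - b x)) = cob_class T (\<lambda>x. - a x)" by blast
  next
    fix b :: "'b \<Rightarrow> int" assume b: "loc_const b" "\<And>x. 0 \<le> b x"
    then have "\<phi> (cob_class S b) \<in> pos_cone (dimension_group T)"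
      using pos by (auto simp: dimension_group_pos_cone)
    then show "\<exists>a. (loc_const a \<and> loc_const b \<and> \<phi> (cob_class S b) = cob_class T a) \<and> (\<forall>x. 0 \<le> a x)"
      using b by (auto simp: dimension_group_pos_cone)
  next
    fix a b c d x x'
    assume ab: "loc_const a \<and> loc_const b \<and> \<phi> (cob_class S b) = cob_class T a"
      and b: "\<And>x. 0 \<le> b x" and c: "loc_const c" "\<And>x. 0 \<le> c x" "c x \<noteq> 0"
      and d: "loc_const d" "\<And>x. 0 \<le> d x" "d x' \<noteq> 0" and acd: "cohom T (\<lambda>x. a x - c x) d"
    have "cob_class S b \<in> pos_cone (dimension_group S)"
      using ab b by (auto simp: dimension_group_pos_cone)
    moreover have "cob_class T c \<in> carrier (dimension_group T)"
      using c by (auto simp: dimension_group_carrier)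
    moreover have "ord_less (dimension_group T) \<one>\<^bsub>dimension_group T\<^esub> (cob_class T c)"
      unfolding dimension_group_one
      by (subst X.ord_less_iff) (use c in \<open>auto intro!: exI[of _ c]\<close>)
    moreover have "ord_less (dimension_group T) (cob_class T c) (\<phi> (cob_class S b))"
      using ab X.ord_less_iff[OF c(1), of a] d acd by metis
    ultimately obtain g where g: "g \<in> carrier (dimension_group S)" "\<phi> g = cob_class T c"
        "ord_less (dimension_group S) \<one>\<^bsub>dimension_group S\<^esub> g"
        "ord_less (dimension_group S) g (cob_class S b)"
      using exh unfolding exhaustive_def by blast
    then obtain b' where b': "loc_const b'" "g = cob_class S b'"
      by (auto simp: dimension_group_carrier)
    have "spos S (\<lambda>x. b' x - 0)"
      by (rule Y.ord_less_spos) (use g b' in \<open>auto simp: dimension_group_one\<close>)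
    moreover have "spos S (\<lambda>x. b x - b' x)"
      by (rule Y.ord_less_spos) (use g b' ab in auto)
    ultimately show "\<exists>b'. (loc_const c \<and> loc_const b' \<and> \<phi> (cob_class S b') = cob_class T c) \<and>
        spos S b' \<and> spos S (\<lambda>x. b x - b' x)"
      using b' g c by auto
  qed (use unit in \<open>auto simp: cob_class_eq_iff[symmetric]\<close>)
qed

text \<open>Coboundaries are carried in one direction only, so a cohomology for \<open>T\<close>
  says nothing about \<open>S\<close>. Pointwise inequalities, however, can be carried back along
  the inverse \<open>g\<close>; therefore the intermediate class is first given a representative
  lying pointwise between the bounds.\<close>

lemma exhaustive_epi_of_homeo:
  fixes S :: "'b::metric_space \<Rightarrow> 'b" and T :: "'a::metric_space \<Rightarrow> 'a"
  assumes X: "minimal_system T" and Y: "minimal_system S"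
    and h: "is_homeo h" and cob: "\<forall>f\<in>cob S. f \<circ> h \<in> cob T"
  shows "\<exists>\<phi>. unital_ordered_epi (dimension_group S) (dimension_group T) \<phi> \<and>
    exhaustive (dimension_group S) (dimension_group T) \<phi>"
proof -
  interpret X: minimal_system T by fact
  interpret Y: minimal_system S by fact
  obtain g where g: "homeomorphism UNIV UNIV h g" using h by (auto simp: is_homeo_def)
  then have hg: "h (g y) = y" "g (h x) = x" for x y by (auto simp: homeomorphism_def)
  have lh: "loc_const (\<lambda>x. f (h x))" if "loc_const f" for f :: "'b \<Rightarrow> int"
    using that g by (auto simp: homeomorphism_def intro: loc_const_compose)
  have lg: "loc_const (\<lambda>y. f (g y))" if "loc_const f" for f :: "'a \<Rightarrow> int"
    using that g by (auto simp: homeomorphism_def intro: loc_const_compose)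
  have ch: "cohom T (\<lambda>x. f (h x)) (\<lambda>x. f' (h x))" if "cohom S f f'" for f f'
    using that cob by (auto simp: cohom_def comp_def)
  define \<phi> where "\<phi> C = cob_class T ((SOME f. loc_const f \<and> C = cob_class S f) \<circ> h)" for C
  have \<phi>: "\<phi> (cob_class S f) = cob_class T (\<lambda>x. f (h x))" if "loc_const f" for f
  proof -
    define f' where "f' = (SOME f'. loc_const f' \<and> cob_class S f = cob_class S f')"
    have "loc_const f' \<and> cob_class S f = cob_class S f'"
      unfolding f'_def by (rule someI[of _ f]) (use that in auto)
    then have "cohom S f' f" by (metis cob_class_eq_iff)
    then have "cob_class T (\<lambda>x. f' (h x)) = cob_class T (\<lambda>x. f (h x))"
      using ch by (simp add: cob_class_eq_iff)
    then show ?thesis by (simp add: \<phi>_def f'_def[symmetric] comp_def)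
  qed
  have "\<phi> \<in> hom (dimension_group S) (dimension_group T)"
  proof (rule homI)
    fix C D assume "C \<in> carrier (dimension_group S)" "D \<in> carrier (dimension_group S)"
    then obtain f f' where "loc_const f" "C = cob_class S f" "loc_const f'" "D = cob_class S f'"
      by (auto simp: dimension_group_carrier)
    then show "\<phi> (C \<otimes>\<^bsub>dimension_group S\<^esub> D) = \<phi> C \<otimes>\<^bsub>dimension_group T\<^esub> \<phi> D"
      by (simp add: dimension_group_mult \<phi> loc_const_arith)
  qed (auto simp: dimension_group_carrier \<phi> lh)
  moreover have "\<phi> ` carrier (dimension_group S) = carrier (dimension_group T)"
  proof -
    have "cob_class T f \<in> \<phi> ` cob_class S ` {f. loc_const f}" if "loc_const f" for f
      using \<phi>[OF lg[OF that]] lg[OF that] by (auto simp: hg image_iff)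
    then show ?thesis by (auto simp: dimension_group_carrier \<phi> lh)
  qed
  moreover have "\<phi> ` pos_cone (dimension_group S) \<subseteq> pos_cone (dimension_group T)"
    by (auto simp: dimension_group_pos_cone \<phi> lh)
  moreover have "\<phi> (order_unit (dimension_group S)) = order_unit (dimension_group T)"
    by (simp add: dimension_group_order_unit \<phi>)
  ultimately have "unital_ordered_epi (dimension_group S) (dimension_group T) \<phi>"
    by (simp add: unital_ordered_epi_def epi_def)
  moreover have "exhaustive (dimension_group S) (dimension_group T) \<phi>"
    unfolding exhaustive_def
  proof (intro ballI impI; elim conjE)
    fix C D assume C: "C \<in> pos_cone (dimension_group S)" and D: "D \<in> carrier (dimension_group T)"
      and less: "ord_less (dimension_group T) \<one>\<^bsub>dimension_group T\<^esub> D" "ord_less (dimension_group T) D (\<phi> C)"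
    obtain c where c: "loc_const c" "\<And>x. 0 \<le> c x" "C = cob_class S c"
      using C by (auto simp: dimension_group_pos_cone)
    obtain d where d: "loc_const d" "D = cob_class T d"
      using D by (auto simp: dimension_group_carrier)
    have d1: "spos T d"
      using X.ord_less_spos[OF _ d(1), of "\<lambda>x. 0"] less(1) d by (simp add: dimension_group_one)
    have d2: "spos T (\<lambda>x. c (h x) - d x)"
      using X.ord_less_spos[OF d(1) lh[OF c(1)]] less(2) by (simp add: c d \<phi>)
    obtain b where b: "loc_const b" "\<And>x. 0 \<le> b x \<and> b x \<le> c (h x)" "cohom T b d"
      using X.cohom_between[OF d(1) d1 lh[OF c(1)] _ d2] c(2) by auto
    have "cob_class S (\<lambda>y. b (g y)) \<in> carrier (dimension_group S)"
      using lg[OF b(1)] by (auto simp: dimension_group_carrier)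
    moreover have "\<phi> (cob_class S (\<lambda>y. b (g y))) = D"
      using b(3) by (simp add: \<phi> lg[OF b(1)] hg d cob_class_eq_iff)
    moreover have "ord_less (dimension_group S) \<one>\<^bsub>dimension_group S\<^esub> (cob_class S (\<lambda>y. b (g y)))"
    proof -
      have "\<exists>x. b x \<noteq> 0"
        using X.spos_cohom[OF d1 cohom_sym[OF b(3)] d(1)] by (rule X.spos_nonzero)
      then show ?thesis unfolding dimension_group_one
        using lg[OF b(1)] b(2) by (subst Y.ord_less_iff) (auto intro!: exI[of _ "\<lambda>y. b (g y)"] simp: hg, metis hg(2))
    qed
    moreover have "ord_less (dimension_group S) (cob_class S (\<lambda>y. b (g y))) C"
    proof -
      have "cohom T (\<lambda>x. c (h x) - d x) (\<lambda>x. c (h x) - b x)"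
        by (intro cohom_diff cohom_refl cohom_sym[OF b(3)])
      then have "spos T (\<lambda>x. c (h x) - b x)"
        using X.spos_cohom[OF d2] loc_const_app2[OF lh[OF c(1)] d(1)] by blast
      then have "\<exists>x. c (h x) - b x \<noteq> 0" by (rule X.spos_nonzero)
      then obtain x where "c (h x) - b (g (h x)) \<noteq> 0" by (auto simp: hg)
      moreover have "0 \<le> c y - b (g y)" for y using b(2)[of "g y"] by (simp add: hg)
      moreover have "loc_const (\<lambda>y. c y - b (g y))" using c(1) lg[OF b(1)] by (rule loc_const_app2)
      ultimately show ?thesis unfolding c(3)
        using lg[OF b(1)] by (subst Y.ord_less_iff) (auto intro!: exI[of _ "\<lambda>y. c y - b (g y)"])
    qed
    ultimately show "\<exists>g'\<in>carrier (dimension_group S). \<phi> g' = D \<and>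
        ord_less (dimension_group S) \<one>\<^bsub>dimension_group S\<^esub> g' \<and> ord_less (dimension_group S) g' C" by blast
  qed
  ultimately show ?thesis by blast
qed

subsection \<open>Strong speedups and coboundaries\<close>

context minimal_system
begin

text \<open>If \<open>p\<close> is discontinuous in the preimage of \<open>A\<close>, then it is continuous in the preimage
  of \<open>- A\<close>, and \<open>ind A = 1 - ind (- A)\<close>.\<close>

lemma speedup_preimage_cohom:
  assumes p: "\<And>x y. \<not> isCont p x \<Longrightarrow> \<not> isCont p y \<Longrightarrow> x = y"
    and bij: "bij (\<lambda>x. (T ^^ p x) x)" and A: "clopen A" "clopen {x. (T ^^ p x) x \<in> A}"
  shows "cohom T (ind A) (ind {x. (T ^^ p x) x \<in> A})"
proof -
  let ?C = "\<lambda>A. {x. (T ^^ p x) x \<in> A}"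
  have main: "cohom T (ind A) (ind (?C A))"
    if A: "clopen A" "clopen (?C A)" and pA: "\<And>x. x \<in> ?C A \<Longrightarrow> isCont p x" for A
  proof -
    \<comment> \<open>Jump 0 off the preimage makes the jump function locally constant everywhere
      and leaves it unchanged where images are taken.\<close>
    define p' where "p' x = (if x \<in> ?C A then p x else 0)" for x
    have "loc_const p'" unfolding loc_const_def
    proof
      fix x
      have *: "\<forall>\<^sub>F y in nhds x. y \<in> ?C A \<longleftrightarrow> x \<in> ?C A" using A(2) by (simp add: loc_const_def)
      show "\<forall>\<^sub>F y in nhds x. p' y = p' x"
      proof (cases "x \<in> ?C A")
        case True
        then have "\<forall>\<^sub>F y in nhds x. p y = p x" using pA isCont_nat_iff by blast
        with * show ?thesis by eventually_elim (use True in \<open>simp add: p'_def\<close>)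
      next
        case False
        with * show ?thesis by (auto elim!: eventually_mono simp: p'_def)
      qed
    qed
    moreover have "inj_on (\<lambda>x. (T ^^ p' x) x) (?C A)"
    proof (rule inj_onI)
      fix x y assume "x \<in> ?C A" "y \<in> ?C A" "(T ^^ p' x) x = (T ^^ p' y) y"
      then have "(T ^^ p x) x = (T ^^ p y) y" by (simp add: p'_def)
      then show "x = y" using bij by (auto dest: bij_is_inj injD)
    qed
    ultimately have "cohom T (ind (?C A)) (ind ((\<lambda>x. (T ^^ p' x) x) ` ?C A))"
      by (intro speedup_image(2)[OF A(2)])
    moreover have "(\<lambda>x. (T ^^ p' x) x) ` ?C A = A"
    proof
      show "(\<lambda>x. (T ^^ p' x) x) ` ?C A \<subseteq> A" unfolding p'_def by auto
      show "A \<subseteq> (\<lambda>x. (T ^^ p' x) x) ` ?C A"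
      proof
        fix a assume "a \<in> A"
        obtain x where x: "a = (T ^^ p x) x" using surjD[OF bij_is_surj[OF bij], of a] by blast
        then have "x \<in> ?C A" using \<open>a \<in> A\<close> by simp
        moreover from this have "a = (T ^^ p' x) x" using x unfolding p'_def by simp
        ultimately show "a \<in> (\<lambda>x. (T ^^ p' x) x) ` ?C A" by (rule rev_image_eqI)
      qed
    qed
    ultimately show ?thesis by (simp add: cohom_sym)
  qed
  show ?thesis
  proof (cases "\<forall>x\<in>?C A. isCont p x")
    case True
    then show ?thesis using main[OF A] by blast
  next
    case False
    then obtain x where "x \<in> ?C A" "\<not> isCont p x" by blast
    then have "isCont p y" if "y \<in> ?C (- A)" for y using p[of x y] that by auto
    moreover have "clopen (- A)" "clopen (?C (- A))"
      using clopen_simps(6)[OF A(1)] clopen_simps(6)[OF A(2)] by simp_all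
    ultimately have "cohom T (ind (- A)) (ind (?C (- A)))" using main by blast
    from cohom_diff[OF cohom_refl[of T "\<lambda>x. 1"] this]
    have "cohom T (\<lambda>x. 1 - ind (- A) x) (\<lambda>x. 1 - ind (?C (- A)) x)" .
    moreover have "(\<lambda>x. 1 - ind (- A) x) = ind A" "(\<lambda>x. 1 - ind (?C (- A)) x) = ind (?C A)"
      by auto
    ultimately show ?thesis by simp
  qed
qed

lemma cohom_scale:
  assumes "cohom T f g"
  shows "cohom T (\<lambda>x. c * f x) (\<lambda>x. c * g x)"
proof -
  obtain k where k: "loc_const k" "\<And>x. f x - g x = k x - k (T x)"
    using cohomE[OF assms] by blast
  show ?thesis
  proof (rule cohomI)
    show "loc_const (\<lambda>x. c * k x)" by (rule loc_const_app[OF k(1)])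
    show "c * f x - c * g x = c * k x - c * k (T x)" for x
      using k(2)[of x] by (simp add: right_diff_distrib[symmetric])
  qed
qed

end

text \<open>The homeomorphism is the inverse \<open>g\<close> of the conjugacy: the coboundary of
  \<open>k\<close> for \<open>S\<close> becomes that of \<open>k' = k \<circ> g\<close> for the
  speedup. As \<open>k'\<close> is a finite integer combination of clopen indicators, it is enough
  to compare each indicator with that of the preimage.\<close>

lemma homeo_of_strong_speedup:
  fixes S :: "'b::metric_space \<Rightarrow> 'b" and T :: "'a::metric_space \<Rightarrow> 'a"
  assumes X: "minimal_system T" and Y: "minimal_system S" and sp: "strong_speedup S T"
  shows "\<exists>h :: 'a \<Rightarrow> 'b. is_homeo h \<and> (\<forall>f\<in>cob S. f \<circ> h \<in> cob T)"
proof -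
  interpret X: minimal_system T by fact
  interpret Y: minimal_system S by fact
  obtain p h where p: "\<And>x y. \<not> isCont p x \<Longrightarrow> \<not> isCont p y \<Longrightarrow> x = y"
    and h: "is_homeo h" "h \<circ> S = (\<lambda>x. (T ^^ p x) x) \<circ> h"
    using sp unfolding strong_speedup_def conjugate_def by metis
  obtain g where g: "homeomorphism UNIV UNIV h g" using h by (auto simp: is_homeo_def)
  then have hg: "h (g y) = y" "g (h x) = x" for x y by (auto simp: homeomorphism_def)
  have cg: "continuous_on UNIV g" and ch: "continuous_on UNIV h" using g by (auto simp: homeomorphism_def)
  have T': "(T ^^ p x) x = h (S (g x))" for x
    using fun_cong[OF h(2), of "g x"] by (simp add: hg)
  have gT: "g ((T ^^ p x) x) = S (g x)" for x by (simp add: T' hg)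
  have T'': "(\<lambda>x. (T ^^ p x) x) = (\<lambda>x. h (S (g x)))" by (rule ext) (rule T')
  have bij: "bij (\<lambda>x. (T ^^ p x) x)"
    unfolding T'' by (rule o_bij[of "\<lambda>x. h (Y.Ti (g x))"]) (simp_all add: hg comp_def id_def)
  have T'c: "continuous_on UNIV (\<lambda>x. (T ^^ p x) x)"
    unfolding T''
    by (rule continuous_on_compose2[OF ch continuous_on_compose2[OF Y.cont_T cg]]) auto
  have "f \<circ> g \<in> cob T" if f: "f \<in> cob S" for f
  proof -
    obtain k where k: "loc_const k" "\<And>y. f y = k y - k (S y)" using f by (auto simp: cob_iff)
    define k' where "k' x = k (g x)" for x
    have k': "loc_const k'" unfolding k'_def[abs_def] by (rule loc_const_compose[OF k(1) cg])
    have fin: "finite (range k')" by (rule finite_range_loc_const[OF X.compact_space k'])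
    let ?A = "\<lambda>n. {x. k' x = n}"
    have "cohom T (\<lambda>x. \<Sum>n\<in>range k'. n * X.ind (?A n) x)
        (\<lambda>x. \<Sum>n\<in>range k'. n * X.ind {x. (T ^^ p x) x \<in> ?A n} x)"
    proof (rule cohom_sum, rule X.cohom_scale, rule X.speedup_preimage_cohom[OF p bij])
      fix n
      show A: "clopen (?A n)" by (rule clopen_Collect[OF k'])
      show "clopen {x. (T ^^ p x) x \<in> ?A n}"
        using loc_const_compose[OF A T'c] by simp
    qed
    moreover have "(\<Sum>n\<in>range k'. n * X.ind (?A n) x) = k' x" for x
    proof -
      have "(\<Sum>n\<in>range k'. n * X.ind (?A n) x) = (\<Sum>n\<in>range k'. if n = k' x then n else 0)"
        by (rule sum.cong) auto
      then show ?thesis using fin by simp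
    qed
    moreover have "(\<Sum>n\<in>range k'. n * X.ind {x. (T ^^ p x) x \<in> ?A n} x) = k' ((T ^^ p x) x)" for x
    proof -
      have "(\<Sum>n\<in>range k'. n * X.ind {x. (T ^^ p x) x \<in> ?A n} x) =
          (\<Sum>n\<in>range k'. if n = k' ((T ^^ p x) x) then n else 0)"
        by (rule sum.cong) auto
      then show ?thesis using fin by simp
    qed
    ultimately have "cohom T k' (\<lambda>x. k' ((T ^^ p x) x))" by simp
    then show ?thesis by (simp add: cohom_def comp_def k(2) k'_def gT)
  qed
  moreover have "is_homeo g" using homeomorphism_symD[OF g] unfolding is_homeo_def by blast
  ultimately show ?thesis by (intro exI[of _ g] conjI ballI)
qed

subsection \<open>Matched clopen sets\<close>

text \<open>Abstract in \<open>R\<close> so that it applies to matching and to its converse, copying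
  partitions in either direction. One label is split off at a time.\<close>

lemma split_finite:
  fixes w :: "'a::topological_space \<Rightarrow> 'l"
  assumes clop: "\<And>A B. R A B \<Longrightarrow> clopen A"
    and empty: "\<And>B. R {} B \<Longrightarrow> B = {}"
    and split: "\<And>A B A'. R A B \<Longrightarrow> clopen A' \<Longrightarrow> A' \<subseteq> A \<Longrightarrow> \<exists>B'\<subseteq>B. R A' B' \<and> R (A - A') (B - B')"
    and w: "loc_const w" and "R A B" "finite L" "w ` A \<subseteq> L"
  shows "\<exists>\<rho>. (\<forall>l\<in>L. R {x \<in> A. w x = l} (\<rho> l)) \<and> disjoint_family_on \<rho> L \<and> (\<Union>l\<in>L. \<rho> l) = B"
  using \<open>finite L\<close> \<open>R A B\<close> \<open>w ` A \<subseteq> L\<close>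
proof (induction L arbitrary: A B)
  case empty
  then have "A = {}" by auto
  then show ?case using assms(2) empty by (auto simp: disjoint_family_on_def)
next
  case (insert l L)
  let ?A = "{x \<in> A. w x = l}"
  have "clopen ?A" using loc_const_app2[OF clop[OF insert.prems(1)] w] by simp
  then obtain B' where B': "B' \<subseteq> B" "R ?A B'" "R (A - ?A) (B - B')"
    using split[OF insert.prems(1), of ?A] by auto
  have "w ` (A - ?A) \<subseteq> L" using insert.prems(2) by auto
  then obtain \<rho> where \<rho>: "\<forall>l'\<in>L. R {x \<in> A - ?A. w x = l'} (\<rho> l')" "disjoint_family_on \<rho> L"
    "(\<Union>l\<in>L. \<rho> l) = B - B'"
    using insert.IH[OF B'(3)] by blast
  have eq: "{x \<in> A - ?A. w x = l'} = {x \<in> A. w x = l'}" if "l' \<in> L" for l'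
    using that insert.hyps(2) by auto
  have "\<forall>l'\<in>insert l L. R {x \<in> A. w x = l'} ((\<rho>(l := B')) l')"
    using \<rho>(1) B'(2) eq insert.hyps(2) by auto
  moreover have "disjoint_family_on (\<rho>(l := B')) (insert l L)"
    using \<rho>(2,3) insert.hyps(2) unfolding disjoint_family_on_def by auto
  moreover have "(\<Union>l'\<in>insert l L. (\<rho>(l := B')) l') = B"
    using \<rho>(3) B'(1) insert.hyps(2) by auto
  ultimately show ?case by blast
qed

context exhaustive_relation
begin

lemma rel_diff: "\<Phi> a b \<Longrightarrow> \<Phi> a' b' \<Longrightarrow> \<Phi> (\<lambda>x. a x - a' x) (\<lambda>x. b x - b' x)"
  using rel_add[OF _ rel_uminus] by simp

lemma rel_zero: "\<Phi> (\<lambda>x. 0) (\<lambda>x. 0)"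
  using rel_diff[OF rel_one rel_one] by simp

definition matched :: "'a set \<Rightarrow> 'b set \<Rightarrow> bool" where
  "matched A B \<longleftrightarrow> clopen A \<and> clopen B \<and> \<Phi> (X.ind A) (Y.ind B)"

lemma matched_clopen: "matched A B \<Longrightarrow> clopen A" "matched A B \<Longrightarrow> clopen B"
  by (simp_all add: matched_def)

lemma matched_UNIV: "matched UNIV UNIV"
  using rel_one by (simp add: matched_def)

lemma matched_cohom:
  "matched A B \<Longrightarrow> clopen A' \<Longrightarrow> clopen B' \<Longrightarrow> cohom T (X.ind A) (X.ind A') \<Longrightarrow>
    cohom S (Y.ind B) (Y.ind B') \<Longrightarrow> matched A' B'"
  unfolding matched_def
  by (elim conjE, intro conjI, assumption+, rule rel_cohom[OF _ loc_const_of_bool loc_const_of_bool])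

lemma matched_diff:
  assumes "matched A B" "matched A' B'" "A' \<subseteq> A" "B' \<subseteq> B"
  shows "matched (A - A') (B - B')"
proof -
  have "X.ind (A - A') = (\<lambda>x. X.ind A x - X.ind A' x)" "Y.ind (B - B') = (\<lambda>x. Y.ind B x - Y.ind B' x)"
    using assms(3,4) by (auto simp: fun_eq_iff)
  moreover have "clopen (A - A')" "clopen (B - B')"
    by (rule clopen_simps(5); use assms(1,2) in \<open>simp add: matched_def\<close>)+
  ultimately show ?thesis using assms(1,2) rel_diff[of "X.ind A" "Y.ind B" "X.ind A'" "Y.ind B'"]
    by (simp add: matched_def del: Diff_iff)
qed

lemma matched_Un:
  assumes "matched A B" "matched A' B'" "A \<inter> A' = {}" "B \<inter> B' = {}"
  shows "matched (A \<union> A') (B \<union> B')"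
proof -
  have "X.ind (A \<union> A') = (\<lambda>x. X.ind A x + X.ind A' x)" "Y.ind (B \<union> B') = (\<lambda>x. Y.ind B x + Y.ind B' x)"
    using assms(3,4) by (auto simp: fun_eq_iff)
  moreover have "clopen (A \<union> A')" "clopen (B \<union> B')"
    by (rule clopen_simps(4); use assms(1,2) in \<open>simp add: matched_def\<close>)+
  ultimately show ?thesis using assms(1,2) rel_add[of "X.ind A" "Y.ind B" "X.ind A'" "Y.ind B'"]
    by (simp add: matched_def del: Un_iff)
qed

lemma matched_empty: "matched {} {}"
  using rel_zero by (simp add: matched_def)

text \<open>The kernel contains no nonzero positive class. If the class of a nonempty
  \<open>B\<close> went to 0, so would a Birkhoff sum of its indicator that is at least 1
  everywhere; subtracting 1 gives a nonnegative function whose image is the class of -1, against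
  positivity.\<close>

lemma matched_empty_iff:
  assumes "matched A B"
  shows "A = {} \<longleftrightarrow> B = {}"
proof
  assume "B = {}"
  then have "\<Phi> (X.ind A) (\<lambda>x. 0)" using assms by (simp add: matched_def)
  then have "cohom T (X.ind A) (\<lambda>x. 0)" using rel_unique rel_zero by blast
  then show "A = {}" using X.null_clopen_empty matched_clopen(1)[OF assms] by blast
next
  assume "A = {}"
  then have 0: "\<Phi> (\<lambda>x. 0) (Y.ind B)" and B: "clopen B" using assms by (simp_all add: matched_def)
  note lB = loc_const_of_bool[OF B]
  show "B = {}"
  proof (rule ccontr)
    assume "B \<noteq> {}"
    then obtain n where n: "\<And>y. 0 < bsum S n (Y.ind B) y"
      using Y.spos_ind[OF B] by (auto simp: spos_def)
    have "\<Phi> (\<lambda>x. 0) (bsum S n (Y.ind B))" for n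
    proof (induction n)
      case 0
      then show ?case using rel_zero by (simp add: bsum_def[abs_def])
    next
      case (Suc n)
      have "\<Phi> (\<lambda>x. 0) (\<lambda>y. Y.ind B ((S ^^ n) y))"
        by (rule rel_cohom[OF 0 loc_const_const Y.loc_const_pow[OF lB] cohom_refl Y.cohom_pow[OF lB]])
      from rel_add[OF Suc this] show ?case by (simp add: bsum_Suc[abs_def])
    qed
    from rel_diff[OF this rel_one] have m1: "\<Phi> (\<lambda>x. - 1) (\<lambda>y. bsum S n (Y.ind B) y - 1)" by simp
    have "0 \<le> bsum S n (Y.ind B) y - 1" for y using n[of y] by simp
    then obtain a where a: "\<Phi> a (\<lambda>y. bsum S n (Y.ind B) y - 1)" "\<forall>x. 0 \<le> a x"
      using rel_nonneg[OF rel_loc_const(2)[OF m1]] by blast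
    have "cohom T (\<lambda>x. 1) (\<lambda>x. - a x)"
      using cohom_uminus[OF rel_unique[OF m1 a(1)]] by simp
    moreover have "spos T (\<lambda>x. 1)" using X.spos_ind[of UNIV] by simp
    ultimately show False using X.spos_not_cohom_nonpos[of "\<lambda>x. 1"] a(2) by fastforce
  qed
qed

text \<open>Here exhaustiveness is used: the class of \<open>A'\<close> lifts to one strictly
  between 0 and the class of \<open>B\<close>, and that class is realised by a subset of
  \<open>B\<close>. If \<open>A'\<close> is empty or all of \<open>A\<close>, strictness fails and
  \<open>B'\<close> is taken empty or all of \<open>B\<close>.\<close>

lemma matched_split_left:
  assumes m: "matched A B" and A': "clopen A'" "A' \<subseteq> A"
    and F: "finite F" "F \<subseteq> B" "A' = {} \<Longrightarrow> F = {}"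
    and G: "finite G" "G \<subseteq> B" "A' = A \<Longrightarrow> G = {}" and FG: "F \<inter> G = {}"
  shows "\<exists>B'\<subseteq>B. matched A' B' \<and> F \<subseteq> B' \<and> B' \<inter> G = {}"
proof (cases "A' = {} \<or> A' = A")
  case True
  then show ?thesis using m F G matched_empty by (cases "A' = {}") auto
next
  case False
  then obtain x x' where x: "x \<in> A'" "x' \<in> A - A'" using A' by blast
  note cl = matched_clopen[OF m]
  have "X.ind (A - A') = (\<lambda>x. X.ind A x - X.ind A' x)" using A'(2) by (auto simp: fun_eq_iff)
  then have "cohom T (\<lambda>x. X.ind A x - X.ind A' x) (X.ind (A - A'))" by simp
  moreover have "\<Phi> (X.ind A) (Y.ind B)" using m by (simp add: matched_def)
  moreover have "loc_const (X.ind A')" "loc_const (X.ind (A - A'))"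
    using A'(1) cl(1) loc_const_of_bool clopen_simps(5) by blast+
  ultimately obtain b where b: "\<Phi> (X.ind A') b" "spos S b" "spos S (\<lambda>x. Y.ind B x - b x)"
    using rel_exhaustive[of "X.ind A" "Y.ind B" "X.ind A'" "X.ind (A - A')" x x'] x by auto
  then obtain B' where B': "clopen B'" "B' \<subseteq> B" "F \<subseteq> B'" "B' \<inter> G = {}" "cohom S (Y.ind B') b"
    using Y.clopen_between_points[OF rel_loc_const(2)[OF b(1)] b(2) cl(2) b(3) F(1,2) G(1,2) FG] by blast
  have "\<Phi> (X.ind A') (Y.ind B')"
    using rel_cohom[OF b(1) loc_const_of_bool[OF A'(1)] loc_const_of_bool[OF B'(1)] cohom_refl cohom_sym[OF B'(5)]] .
  then have "matched A' B'" using A'(1) B'(1) by (simp add: matched_def)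
  with B' show ?thesis by blast
qed

text \<open>Positivity suffices in this direction: the classes of \<open>B'\<close> and
  \<open>B - B'\<close> have nonnegative images, and these are nonzero because only the empty set is
  matched to the empty set.\<close>

lemma matched_split_right:
  assumes m: "matched A B" and B': "clopen B'" "B' \<subseteq> B"
    and F: "finite F" "F \<subseteq> A" "B' = {} \<Longrightarrow> F = {}"
    and G: "finite G" "G \<subseteq> A" "B' = B \<Longrightarrow> G = {}" and FG: "F \<inter> G = {}"
  shows "\<exists>A'\<subseteq>A. matched A' B' \<and> F \<subseteq> A' \<and> A' \<inter> G = {}"
proof (cases "B' = {} \<or> B' = B")
  case True
  then show ?thesis using m F G matched_empty by (cases "B' = {}") auto
next
  case False
  note cl = matched_clopen[OF m]
  have pos: "\<exists>a. \<Phi> a (Y.ind C) \<and> spos T a" if C: "clopen C" "C \<noteq> {}" for C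
  proof -
    obtain a where a: "\<Phi> a (Y.ind C)" "\<And>x. 0 \<le> a x"
      using rel_nonneg[OF loc_const_of_bool[OF C(1)]] by auto
    have "\<exists>x. a x \<noteq> 0"
    proof (rule ccontr)
      assume "\<nexists>x. a x \<noteq> 0"
      then have "a = X.ind {}" by auto
      then have "matched {} C" using a(1) C by (auto simp: matched_def)
      then show False using matched_empty_iff C(2) by blast
    qed
    then show ?thesis using a X.spos_nonneg[OF rel_loc_const(1)[OF a(1)] a(2)] by blast
  qed
  have dB: "clopen (B - B')" "B - B' \<noteq> {}" using cl(2) B' False clopen_simps(5) by blast+
  obtain a where a: "\<Phi> a (Y.ind B')" "spos T a" using pos[OF B'(1)] False by blast
  obtain a' where a': "\<Phi> a' (Y.ind (B - B'))" "spos T a'" using pos[OF dB] by blast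
  have la: "loc_const a" "loc_const a'" using rel_loc_const(1) a a' by blast+
  have "Y.ind (B - B') = (\<lambda>y. Y.ind B y - Y.ind B' y)" using B'(2) by (auto simp: fun_eq_iff)
  moreover have "\<Phi> (X.ind A) (Y.ind B)" using m by (simp add: matched_def)
  ultimately have "cohom T a' (\<lambda>x. X.ind A x - a x)"
    using rel_unique[OF a'(1)] rel_diff[OF _ a(1)] by simp
  then have sp: "spos T (\<lambda>x. X.ind A x - a x)" using X.spos_cohom[OF a'(2) _ la(2)] by blast
  obtain A' where A': "clopen A'" "A' \<subseteq> A" "F \<subseteq> A'" "A' \<inter> G = {}" "cohom T (X.ind A') a"
    using X.clopen_between_points[OF la(1) a(2) cl(1) sp F(1,2) G(1,2) FG] by blast
  have "\<Phi> (X.ind A') (Y.ind B')"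
    using rel_cohom[OF a(1) loc_const_of_bool[OF A'(1)] loc_const_of_bool[OF B'(1)] cohom_sym[OF A'(5)] cohom_refl] .
  then have "matched A' B'" using A'(1) B'(1) by (simp add: matched_def)
  with A' show ?thesis by blast
qed

text \<open>The two pairs of marked points survive every subdivision of matched sets. In the stages below they keep \<open>T x0\<close>
  over \<open>y0\<close> and \<open>x0\<close> over the preimage of \<open>y0\<close>, so that the limit can be completed at the
  point \<open>x0\<close> by a forward iterate.\<close>

definition pmatched :: "'a \<Rightarrow> 'a \<Rightarrow> 'b \<Rightarrow> 'b \<Rightarrow> 'a set \<Rightarrow> 'b set \<Rightarrow> bool" where
  "pmatched x x' y y' A B \<longleftrightarrow> matched A B \<and> (x \<in> A \<longleftrightarrow> y \<in> B) \<and> (x' \<in> A \<longleftrightarrow> y' \<in> B)"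

lemma pmatched_split_left:
  assumes neq: "x \<noteq> x'" "y \<noteq> y'" and m: "pmatched x x' y y' A B" and A': "clopen A'" "A' \<subseteq> A"
  shows "\<exists>B'\<subseteq>B. pmatched x x' y y' A' B' \<and> pmatched x x' y y' (A - A') (B - B')"
proof -
  \<comment> \<open>\<open>F\<close> collects the marked points that \<open>B'\<close> must contain,
    \<open>G\<close> those that it must avoid.\<close>
  define F where "F = {v. (v = y \<and> x \<in> A') \<or> (v = y' \<and> x' \<in> A')}"
  define G where "G = {v. (v = y \<and> x \<in> A - A') \<or> (v = y' \<and> x' \<in> A - A')}"
  have "finite F" "finite G"
    by (rule finite_subset[of _ "{y, y'}"]; auto simp: F_def G_def)+
  then obtain B' where B': "B' \<subseteq> B" "matched A' B'" "F \<subseteq> B'" "B' \<inter> G = {}"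
    using matched_split_left[of A B A' F G] m A' neq unfolding pmatched_def F_def G_def by auto
  have "matched (A - A') (B - B')" using matched_diff B' A' m by (auto simp: pmatched_def)
  with B' m A' show ?thesis unfolding pmatched_def F_def G_def by (intro exI[of _ B']) auto
qed

lemma pmatched_split_right:
  assumes neq: "x \<noteq> x'" "y \<noteq> y'" and m: "pmatched x x' y y' A B" and B': "clopen B'" "B' \<subseteq> B"
  shows "\<exists>A'\<subseteq>A. pmatched x x' y y' A' B' \<and> pmatched x x' y y' (A - A') (B - B')"
proof -
  define F where "F = {v. (v = x \<and> y \<in> B') \<or> (v = x' \<and> y' \<in> B')}"
  define G where "G = {v. (v = x \<and> y \<in> B - B') \<or> (v = x' \<and> y' \<in> B - B')}"
  have "finite F" "finite G"
    by (rule finite_subset[of _ "{x, x'}"]; auto simp: F_def G_def)+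
  then obtain A' where A': "A' \<subseteq> A" "matched A' B'" "F \<subseteq> A'" "A' \<inter> G = {}"
    using matched_split_right[of A B B' F G] m B' neq unfolding pmatched_def F_def G_def by auto
  have "matched (A - A') (B - B')" using matched_diff B' A' m by (auto simp: pmatched_def)
  with A' m B' show ?thesis unfolding pmatched_def F_def G_def by (intro exI[of _ A']) auto
qed

lemma pmatched_partition_left:
  assumes neq: "x \<noteq> x'" "y \<noteq> y'" and m: "pmatched x x' y y' A B" and w: "loc_const w"
  shows "\<exists>\<rho>. (\<forall>l\<in>range w. pmatched x x' y y' {v \<in> A. w v = l} (\<rho> l)) \<and>
    disjoint_family_on \<rho> (range w) \<and> (\<Union>l\<in>range w. \<rho> l) = B"
proof (rule split_finite[of "pmatched x x' y y'", OF _ _ _ w m finite_range_loc_const[OF X.compact_space w]])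
  show "clopen A" if "pmatched x x' y y' A B" for A B
    using that matched_clopen by (auto simp: pmatched_def)
  show "B = {}" if "pmatched x x' y y' {} B" for B
    using that matched_empty_iff by (auto simp: pmatched_def)
qed (use pmatched_split_left[OF neq] in auto)

lemma pmatched_partition_right:
  assumes neq: "x \<noteq> x'" "y \<noteq> y'" and m: "pmatched x x' y y' A B" and w: "loc_const w"
  shows "\<exists>\<rho>. (\<forall>l\<in>range w. pmatched x x' y y' (\<rho> l) {v \<in> B. w v = l}) \<and>
    disjoint_family_on \<rho> (range w) \<and> (\<Union>l\<in>range w. \<rho> l) = A"
proof (rule split_finite[of "\<lambda>B A. pmatched x x' y y' A B", OF _ _ _ w m finite_range_loc_const[OF Y.compact_space w]])
  show "clopen B" if "pmatched x x' y y' A B" for A B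
    using that matched_clopen by (auto simp: pmatched_def)
  show "A = {}" if "pmatched x x' y y' A {}" for A
    using that matched_empty_iff by (auto simp: pmatched_def)
qed (use pmatched_split_right[OF neq] in auto)

end

subsection \<open>Approximating the conjugacy by towers\<close>

context minimal_system
begin

text \<open>A Kakutani-Rokhlin partition with base \<open>U\<close>, without indices for columns and
  heights: an atom is a top if its image lies in \<open>U\<close>, and otherwise its image is the
  atom directly above it. The image of a top need not be an atom.\<close>

definition tower_partition :: "'a set \<Rightarrow> 'a set set \<Rightarrow> bool" where
  "tower_partition U Q \<longleftrightarrow> clopen U \<and> (\<forall>B\<in>Q. clopen B \<and> B \<noteq> {}) \<and> \<Union>Q = UNIV \<and>
     (\<forall>B\<in>Q. \<forall>C\<in>Q. B \<inter> C \<noteq> {} \<longrightarrow> B = C) \<and> (\<forall>B\<in>Q. B \<subseteq> U \<or> B \<inter> U = {}) \<and>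
     (\<forall>B\<in>Q. T ` B \<subseteq> U \<or> T ` B \<in> Q \<and> T ` B \<inter> U = {})"

lemma tower_partitionD:
  assumes "tower_partition U Q"
  shows "clopen U" and "B \<in> Q \<Longrightarrow> clopen B" and "B \<in> Q \<Longrightarrow> B \<noteq> {}" and "\<exists>B\<in>Q. x \<in> B"
    and "B \<in> Q \<Longrightarrow> C \<in> Q \<Longrightarrow> x \<in> B \<Longrightarrow> x \<in> C \<Longrightarrow> B = C"
    and "B \<in> Q \<Longrightarrow> B \<subseteq> U \<or> B \<inter> U = {}"
    and "B \<in> Q \<Longrightarrow> T ` B \<subseteq> U \<or> T ` B \<in> Q \<and> T ` B \<inter> U = {}"
proof -
  note * = assms[unfolded tower_partition_def]
  show "clopen U" using * by (elim conjE)
  show "B \<in> Q \<Longrightarrow> clopen B" "B \<in> Q \<Longrightarrow> B \<noteq> {}" "B \<in> Q \<Longrightarrow> B \<subseteq> U \<or> B \<inter> U = {}"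
    "B \<in> Q \<Longrightarrow> T ` B \<subseteq> U \<or> T ` B \<in> Q \<and> T ` B \<inter> U = {}"
    using * by simp_all
  have "\<Union> Q = UNIV" using * by (elim conjE)
  then show "\<exists>B\<in>Q. x \<in> B" by blast
  have "\<forall>B\<in>Q. \<forall>C\<in>Q. B \<inter> C \<noteq> {} \<longrightarrow> B = C" using * by (elim conjE)
  then show "B \<in> Q \<Longrightarrow> C \<in> Q \<Longrightarrow> x \<in> B \<Longrightarrow> x \<in> C \<Longrightarrow> B = C" by blast
qed

text \<open>Points are identified when they lie on the same level and the orbit segments of their base
  points, of a length exceeding all return times, carry the same labels.\<close>

lemma tower_partition_exists:
  assumes U: "clopen U" "U \<noteq> {}" and c: "loc_const c"
  shows "\<exists>Q. tower_partition U Q \<and> (\<forall>B\<in>Q. \<forall>x\<in>B. \<forall>y\<in>B. c x = c y)"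
proof -
  obtain N where N: "\<And>x. rt U x \<le> N"
    using loc_const_nat_bounded[OF compact_space loc_const_rt[OF U]] by blast
  define base where "base x = (Ti ^^ bt U x) x" for x
  \<comment> \<open>The last index \<open>N\<close> is at least \<open>Suc (bt U x)\<close>, so the
    word read at the base point also tells whether \<open>T x\<close> is back in
    \<open>U\<close>.\<close>
  define w where "w v = map (\<lambda>k. (c ((T ^^ k) v), (T ^^ k) v \<in> U)) [0..<Suc N]" for v
  define F where "F x = (bt U x, w (base x))" for x
  have "loc_const (\<lambda>v. (c v, v \<in> U))" by (rule loc_const_app2[OF c U(1)])
  then have lw: "loc_const w"
    unfolding w_def[abs_def] by (intro loc_const_map loc_const_pow[of "\<lambda>v. (c v, v \<in> U)"])
  have lF: "loc_const F"
    unfolding F_def[abs_def] base_def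
    by (rule loc_const_app2[OF loc_const_bt[OF U] loc_const_base[OF U lw]])
  have nth: "w (base x) ! k = (c ((T ^^ k) (base x)), (T ^^ k) (base x) \<in> U)" if "k \<le> N" for x k
    unfolding w_def using that by (subst nth_map) (auto simp del: upt_Suc)
  have btN: "Suc (bt U x) \<le> N" for x
    using bt_less_rt[OF U, of x] N[of "(Ti ^^ bt U x) x"] by linarith
  have up: "(T ^^ bt U x) (base x) = x" "(T ^^ Suc (bt U x)) (base x) = T x" for x
    by (simp_all add: base_def)
  have Fc: "c x = c y" and FT: "T x \<in> U \<longleftrightarrow> T y \<in> U" and FU: "x \<in> U \<longleftrightarrow> y \<in> U"
    if "F x = F y" for x y
  proof -
    have *: "bt U x = bt U y" "w (base x) = w (base y)" using that by (simp_all add: F_def)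
    show "c x = c y" "x \<in> U \<longleftrightarrow> y \<in> U"
      using nth[of "bt U x" x] nth[of "bt U y" y] btN[of x] * up(1)[of x] up(1)[of y] by auto
    show "T x \<in> U \<longleftrightarrow> T y \<in> U"
      using nth[of "Suc (bt U x)" x] nth[of "Suc (bt U y)" y] btN[of x] * up(2)[of x] up(2)[of y]
      by (simp del: funpow.simps)
  qed
  have FS: "F (T x) = (Suc (bt U x), w (base x))" if "T x \<notin> U" for x
    unfolding F_def base_def bt_T[OF U that] by (simp add: funpow_swap1)
  define Q where "Q = range (\<lambda>x. {z. F z = F x})"
  have TB: "T ` {z. F z = F x} = {z. F z = F (T x)}" if x: "T x \<notin> U" for x
  proof
    show "T ` {z. F z = F x} \<subseteq> {z. F z = F (T x)}"
    proof safe
      fix z assume z: "F z = F x"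
      then have "T z \<notin> U" using FT[OF z] x by simp
      then show "F (T z) = F (T x)" using FS[OF x] FS[of z] z by (simp add: F_def)
    qed
    show "{z. F z = F (T x)} \<subseteq> T ` {z. F z = F x}"
    proof safe
      fix z assume z: "F z = F (T x)"
      then have "T (Ti z) \<notin> U" using FU[OF z] x by simp
      then have "F (Ti z) = F x" using FS[OF x] FS[of "Ti z"] z by (simp add: F_def)
      then show "z \<in> T ` {z. F z = F x}" by (intro image_eqI[of _ _ "Ti z"]) auto
    qed
  qed
  have "tower_partition U Q"
    unfolding tower_partition_def
  proof (intro conjI ballI impI)
    fix B assume "B \<in> Q"
    then obtain x where B: "B = {z. F z = F x}" by (auto simp: Q_def)
    show "clopen B" unfolding B by (rule clopen_Collect[OF lF])
    show "B \<noteq> {}" unfolding B by auto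
    show "B \<subseteq> U \<or> B \<inter> U = {}" unfolding B using FU[of _ x] by (cases "x \<in> U") blast+
    show "T ` B \<subseteq> U \<or> T ` B \<in> Q \<and> T ` B \<inter> U = {}"
    proof (cases "T x \<in> U")
      case True
      then have "T ` B \<subseteq> U" unfolding B using FT[of _ x] by blast
      then show ?thesis ..
    next
      case False
      then have "T ` B \<inter> U = {}" unfolding B using FT[of _ x] by blast
      moreover have "T ` B \<in> Q" unfolding B TB[OF False] Q_def by blast
      ultimately show ?thesis by blast
    qed
    fix C assume "C \<in> Q" "B \<inter> C \<noteq> {}"
    then show "B = C" unfolding B Q_def by auto
  qed (use U in \<open>auto simp: Q_def\<close>)
  moreover have "\<forall>B\<in>Q. \<forall>x\<in>B. \<forall>y\<in>B. c x = c y"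
    unfolding Q_def by (auto intro!: Fc)
  ultimately show ?thesis by blast
qed

lemma speedup_continuous:
  assumes "loc_const p"
  shows "continuous_on UNIV (\<lambda>x. (T ^^ p x) x)"
  unfolding continuous_on_open_vimage[OF open_UNIV]
proof (intro allI impI)
  fix O' :: "'a set" assume O': "open O'"
  have "(\<lambda>x. (T ^^ p x) x) -` O' \<inter> UNIV = (\<Union>n. {x. p x = n} \<inter> (T ^^ n) -` O')" by auto
  moreover have "open ({x. p x = n} \<inter> (T ^^ n) -` O')" for n
    using loc_const_open[OF assms, of "\<lambda>k. k = n"] open_vimage[OF O' cont_pow[of n]] by (rule open_Int)
  ultimately show "open ((\<lambda>x. (T ^^ p x) x) -` O' \<inter> UNIV)" by auto
qed

end

text \<open>\<open>r x\<close> is the atom of a partition of the second space that the conjugacy to be constructed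
  assigns to \<open>x\<close>; \<open>p\<close> is the final speedup function wherever the atom is not mapped into
  the base \<open>U\<close>.\<close>

locale stage = exhaustive_relation T S \<Phi>
  for T :: "'a::metric_space \<Rightarrow> 'a" and S :: "'b::metric_space \<Rightarrow> 'b" and \<Phi> +
  fixes x0 :: 'a and y0 :: 'b and r :: "'a \<Rightarrow> 'b set" and p :: "'a \<Rightarrow> nat" and U :: "'b set"
  assumes r: "loc_const r" and p: "loc_const p" "\<And>x. 0 < p x"
    and bij: "bij (\<lambda>x. (T ^^ p x) x)"
    and towers: "Y.tower_partition U (range r)"
    and matched: "matched {v. r v = r x} (r x)"
    and step: "if S ` r x \<subseteq> U then r ((T ^^ p x) x) \<subseteq> U else r ((T ^^ p x) x) = S ` r x"
    and y0: "y0 \<in> U" "y0 \<in> r (T x0)" "Y.Ti y0 \<in> r x0"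
begin

definition tau :: "'a \<Rightarrow> 'a" where "tau x = (T ^^ p x) x"

abbreviation taui :: "'a \<Rightarrow> 'a" where "taui \<equiv> inv_into UNIV tau"

lemma bij_tau: "bij tau"
  using bij by (simp add: tau_def[abs_def])

lemma tau_taui [simp]: "tau (taui x) = x" and taui_tau [simp]: "taui (tau x) = x"
  using bij_tau by (simp_all add: bij_is_surj surj_f_inv_f bij_is_inj)

lemma tau_pow_cancel [simp]: "(tau ^^ n) ((taui ^^ n) x) = x" "(taui ^^ n) ((tau ^^ n) x) = x"
proof -
  show "(tau ^^ n) ((taui ^^ n) x) = x"
    by (induction n arbitrary: x) (simp_all add: funpow_swap1)
  show "(taui ^^ n) ((tau ^^ n) x) = x"
    by (induction n arbitrary: x) (simp_all add: funpow_swap1)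
qed

lemma cont_tau: "continuous_on UNIV tau"
  using X.speedup_continuous[OF p(1)] by (simp add: tau_def[abs_def])

lemma cont_taui: "continuous_on UNIV taui"
  using continuous_on_inv[OF cont_tau X.compact_space, of taui] bij_is_surj[OF bij_tau] by simp

lemma loc_const_tau_pow: "loc_const f \<Longrightarrow> loc_const (\<lambda>x. f ((tau ^^ n) x))"
  and loc_const_taui_pow: "loc_const f \<Longrightarrow> loc_const (\<lambda>x. f ((taui ^^ n) x))"
  by (erule loc_const_compose, rule continuous_on_funpow, rule cont_tau cont_taui)+

lemma tau_pow: "\<exists>m. (tau ^^ n) x = (T ^^ m) x"
proof (induction n)
  case 0
  show ?case by (intro exI[of _ 0]) simp
next
  case (Suc n)
  then obtain m where "(tau ^^ n) x = (T ^^ m) x" by blast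
  then have "(tau ^^ Suc n) x = (T ^^ (p ((T ^^ m) x) + m)) x" by (simp add: tau_def funpow_add)
  then show ?case by blast
qed

lemma clopen_U: "clopen U"
  using Y.tower_partitionD(1)[OF towers] .

lemma U_nonempty: "U \<noteq> {}"
  using y0 by auto

lemma r_clopen: "clopen (r x)" and r_nonempty: "r x \<noteq> {}"
  and r_cover: "\<exists>x. y \<in> r x" and r_dichotomy: "r x \<subseteq> U \<or> r x \<inter> U = {}"
  and Sr: "S ` r x \<subseteq> U \<or> S ` r x \<in> range r \<and> S ` r x \<inter> U = {}"
  using Y.tower_partitionD(2,3,6,7)[OF towers rangeI, of x] Y.tower_partitionD(4)[OF towers, of y]
  by auto

lemma r_eqI: "y \<in> r x \<Longrightarrow> y \<in> r x' \<Longrightarrow> r x = r x'"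
  using Y.tower_partitionD(5)[OF towers rangeI rangeI] .

lemma r_tau: "if S ` r x \<subseteq> U then r (tau x) \<subseteq> U else r (tau x) = S ` r x"
  using step by (simp add: tau_def)

lemma r_taui: assumes "\<not> r x \<subseteq> U" shows "r x = S ` r (taui x)"
  using r_tau[of "taui x"] assms by (simp split: if_splits)

text \<open>All points of an atom lie on the same level (\<open>lev_eq_bt\<close>), so the choice is
  immaterial. Since the value depends on \<open>x\<close> only through \<open>r x\<close>, it is
  locally constant at once.\<close>

definition lev :: "'a \<Rightarrow> nat" where "lev x = Y.bt U (SOME y. y \<in> r x)"

lemma loc_const_lev: "loc_const lev"
  unfolding lev_def[abs_def] by (rule loc_const_app[OF r])

text \<open>Both towers are descended in parallel: a point whose atom is off the base cannot come
  from a top, as \<open>step\<close> sends tops into \<open>U\<close>, so its atom is the image of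
  the one before.\<close>

lemma r_taui_pow:
  assumes "y \<in> r x" "j \<le> Y.bt U y"
  shows "r x = (S ^^ j) ` r ((taui ^^ j) x) \<and> (Y.Ti ^^ j) y \<in> r ((taui ^^ j) x)"
  using assms(2)
proof (induction j)
  case 0
  then show ?case using assms(1) by simp
next
  case (Suc j)
  let ?x = "(taui ^^ j) x"
  have "(Y.Ti ^^ j) y \<notin> U" using Y.bt_least[of j U y] Suc.prems by simp
  then have "\<not> r ?x \<subseteq> U" using Suc by auto
  from r_taui[OF this] have *: "r ?x = S ` r ((taui ^^ Suc j) x)" by simp
  then have "r x = (S ^^ Suc j) ` r ((taui ^^ Suc j) x)"
    using Suc by (simp add: image_comp funpow_swap1 comp_def)
  moreover have "(Y.Ti ^^ Suc j) y \<in> r ((taui ^^ Suc j) x)"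
    using Suc * by auto
  ultimately show ?case by blast
qed

lemma lev_eq_bt: assumes y: "y \<in> r x" shows "lev x = Y.bt U y"
proof -
  have *: "Y.bt U y \<le> Y.bt U y'" if "y \<in> r x" "y' \<in> r x" for y y'
  proof (rule ccontr)
    assume "\<not> ?thesis"
    then have less: "Y.bt U y' < Y.bt U y" by simp
    have "(Y.Ti ^^ Y.bt U y') y' \<in> r ((taui ^^ Y.bt U y') x)" using r_taui_pow that(2) by blast
    then have "r ((taui ^^ Y.bt U y') x) \<subseteq> U"
      using r_dichotomy Y.bt_in[OF clopen_U U_nonempty, of y'] by blast
    moreover have "(Y.Ti ^^ Y.bt U y') y \<in> r ((taui ^^ Y.bt U y') x)"
      using r_taui_pow[OF that(1)] less by simp
    ultimately show False using Y.bt_least[OF less] by blast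
  qed
  have "(SOME y. y \<in> r x) \<in> r x" using r_nonempty[of x] by (auto intro: someI)
  then show ?thesis unfolding lev_def using * y by (meson le_antisym)
qed

lemma r_lev: "r x = (S ^^ lev x) ` r ((taui ^^ lev x) x)"
  and r_below: "j < lev x \<Longrightarrow> \<not> r ((taui ^^ j) x) \<subseteq> U"
proof -
  obtain y where y: "y \<in> r x" using r_nonempty[of x] by blast
  note l = lev_eq_bt[OF y]
  show "r x = (S ^^ lev x) ` r ((taui ^^ lev x) x)" using r_taui_pow[OF y] by (simp add: l)
  show "\<not> r ((taui ^^ j) x) \<subseteq> U" if "j < lev x"
    using r_taui_pow[OF y, of j] that Y.bt_least[of j U y] by (auto simp: l)
qed

lemma lev_cong: "r x = r x' \<Longrightarrow> lev x = lev x'"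
  by (simp add: lev_def)

lemma lev_tau:
  assumes "\<not> S ` r x \<subseteq> U"
  shows "r (tau x) = S ` r x" "r (tau x) \<inter> U = {}" "lev (tau x) = Suc (lev x)"
proof -
  show *: "r (tau x) = S ` r x" using r_tau[of x] assms by simp
  then show **: "r (tau x) \<inter> U = {}" using Sr[of x] assms by simp
  obtain y where y: "y \<in> r x" using r_nonempty[of x] by blast
  then have "S y \<in> r (tau x)" using * by simp
  moreover from this have "S y \<notin> U" using ** by blast
  ultimately show "lev (tau x) = Suc (lev x)"
    using lev_eq_bt y Y.bt_T[OF clopen_U U_nonempty] by simp
qed

text \<open>Below a top the next atom is determined by the present one, so two points starting in
  the same atom at the foot of a column climb through the same atoms.\<close>

lemma climb:
  assumes "r v = r ((taui ^^ lev x) x)" "j \<le> lev x"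
  shows "r ((tau ^^ j) v) = r ((taui ^^ (lev x - j)) x)"
  using assms(2)
proof (induction j)
  case 0
  then show ?case using assms(1) by simp
next
  case (Suc j)
  let ?u = "(taui ^^ (lev x - j)) x"
  have "lev x - j = Suc (lev x - Suc j)" using Suc.prems by simp
  then have u: "tau ?u = (taui ^^ (lev x - Suc j)) x" by simp
  have "lev x - Suc j < lev x" using Suc.prems by simp
  then have "\<not> r (tau ?u) \<subseteq> U" using r_below unfolding u by blast
  then have n: "\<not> S ` r ?u \<subseteq> U" using r_tau[of ?u] by auto
  have "r (tau ((tau ^^ j) v)) = r (tau ?u)"
    using lev_tau(1)[OF n] lev_tau(1)[of "(tau ^^ j) v"] Suc n by simp
  then show ?case using u by simp
qed

text \<open>\<open>tau\<close> is an injective continuous speedup of \<open>T\<close>, so it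
  preserves classes of clopen sets for \<open>T\<close> just as \<open>S\<close> does for
  itself.\<close>

lemma matched_image:
  assumes "matched A B"
  shows "matched ((tau ^^ n) ` A) ((S ^^ n) ` B)"
proof (induction n)
  case (Suc n)
  let ?A = "(tau ^^ n) ` A" let ?B = "(S ^^ n) ` B"
  have inj: "inj_on (\<lambda>x. (T ^^ p x) x) ?A" using bij by (auto simp: bij_def intro: inj_on_subset)
  have injS: "inj_on (\<lambda>x. (S ^^ 1) x) ?B" using Y.bij_T by (auto simp: bij_def intro: inj_on_subset)
  note sx = X.speedup_image[OF matched_clopen(1)[OF Suc] p(1) inj]
  note sy = Y.speedup_image[OF matched_clopen(2)[OF Suc], of "\<lambda>_. 1", OF loc_const_const injS]
  have "matched ((\<lambda>x. (T ^^ p x) x) ` ?A) ((\<lambda>x. (S ^^ 1) x) ` ?B)"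
    by (rule matched_cohom[OF Suc sx(1) sy(1) sx(2) sy(2)])
  moreover have "(\<lambda>x. (T ^^ p x) x) ` ?A = (tau ^^ Suc n) ` A" "(\<lambda>x. (S ^^ 1) x) ` ?B = (S ^^ Suc n) ` B"
    by (auto simp: tau_def[abs_def] image_comp comp_def)
  ultimately show ?case by simp
qed (use assms in simp)

section \<open>Subdividing the columns of a stage\<close>

definition refined :: "('a \<Rightarrow> 'b set) \<Rightarrow> bool" where
  "refined \<rho> \<longleftrightarrow> loc_const \<rho> \<and> (\<forall>v. \<rho> v \<subseteq> r v \<and> \<rho> v \<noteq> {} \<and> matched {u. \<rho> u = \<rho> v} (\<rho> v)) \<and>
     (\<forall>u v. \<rho> u \<inter> \<rho> v \<noteq> {} \<longrightarrow> \<rho> u = \<rho> v) \<and> (\<forall>y. \<exists>v. y \<in> \<rho> v) \<and>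
     y0 \<in> \<rho> (T x0) \<and> (Y.Ti ^^ Suc (lev x0)) y0 \<in> \<rho> ((taui ^^ lev x0) x0)"

text \<open>Only the values of \<open>\<rho>\<close> at the feet of the columns are read; they are
  carried upwards by \<open>tau\<close> on one side and \<open>S\<close> on the other, so
  \<open>p\<close> and \<open>U\<close> can stay. This is why the second marked pair in
  \<open>refined\<close> consists of the feet below \<open>x0\<close> and below the preimage of
  \<open>y0\<close>.\<close>

lemma column_refine:
  assumes \<rho>: "refined \<rho>"
  defines "r' \<equiv> \<lambda>x. (S ^^ lev x) ` \<rho> ((taui ^^ lev x) x)"
  shows "stage T S \<Phi> x0 y0 r' p U" "r' x \<subseteq> r x" "r' x \<noteq> {}"
proof -
  have l\<rho>: "loc_const \<rho>" and sub: "\<And>v. \<rho> v \<subseteq> r v" and ne: "\<And>v. \<rho> v \<noteq> {}"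
    and m\<rho>: "\<And>v. matched {u. \<rho> u = \<rho> v} (\<rho> v)"
    and disj: "\<And>u v. \<rho> u \<inter> \<rho> v \<noteq> {} \<Longrightarrow> \<rho> u = \<rho> v" and cover: "\<And>y. \<exists>v. y \<in> \<rho> v"
    and pts: "y0 \<in> \<rho> (T x0)" "(Y.Ti ^^ Suc (lev x0)) y0 \<in> \<rho> ((taui ^^ lev x0) x0)"
    using \<rho> unfolding refined_def by blast+
  have r'r: "r' x \<subseteq> r x" for x
    unfolding r'_def using sub r_lev[of x] image_mono by blast
  then show "r' x \<subseteq> r x" .
  have r'ne: "r' x \<noteq> {}" for x unfolding r'_def using ne by simp
  then show "r' x \<noteq> {}" .
  have lr': "loc_const r'"
  proof -
    have "loc_const (\<lambda>x. (S ^^ k) ` \<rho> ((taui ^^ k) x))" for k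
      by (rule loc_const_app[of _ "\<lambda>B. (S ^^ k) ` B"]) (rule loc_const_taui_pow[OF l\<rho>])
    from loc_const_family[OF loc_const_lev this] show ?thesis unfolding r'_def by simp
  qed
  have inj: "inj (S ^^ k)" for k using Y.inj_pow by (auto intro: injI)
  have same: "r u = r x" "lev u = lev x" "\<rho> ((taui ^^ lev x) u) = \<rho> ((taui ^^ lev x) x)"
    if "r' u \<inter> r' x \<noteq> {}" for u x
  proof -
    show ru: "r u = r x" using that r'r[of u] r'r[of x] r_eqI by blast
    then show l: "lev u = lev x" by (rule lev_cong)
    have "(S ^^ lev x) ` \<rho> ((taui ^^ lev x) u) \<inter> (S ^^ lev x) ` \<rho> ((taui ^^ lev x) x) \<noteq> {}"
      using that unfolding r'_def l by simp
    then have "\<rho> ((taui ^^ lev x) u) \<inter> \<rho> ((taui ^^ lev x) x) \<noteq> {}"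
      using Y.inj_pow by blast
    then show "\<rho> ((taui ^^ lev x) u) = \<rho> ((taui ^^ lev x) x)" by (rule disj)
  qed
  have lift: "r' ((tau ^^ lev x) v) = (S ^^ lev x) ` \<rho> v" if "r v = r ((taui ^^ lev x) x)" for v x
  proof -
    have "r ((tau ^^ lev x) v) = r x" using climb[OF that order_refl] by simp
    then have "lev ((tau ^^ lev x) v) = lev x" by (rule lev_cong)
    then show ?thesis unfolding r'_def by simp
  qed
  have up: "r' (tau x) = S ` r' x" if "\<not> S ` r x \<subseteq> U" for x
    unfolding r'_def lev_tau(3)[OF that]
    by (simp add: funpow_swap1 image_comp comp_def del: funpow.simps) (simp add: funpow_swap1)
  have m': "matched {v. r' v = r' x} (r' x)" for x
  proof -
    let ?b = "(taui ^^ lev x) x"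
    have "{v. r' v = r' x} = (tau ^^ lev x) ` {v. \<rho> v = \<rho> ?b}"
    proof (rule equalityI; rule subsetI)
      fix u assume "u \<in> {v. r' v = r' x}"
      then have "r' u = r' x" by simp
      then have "\<rho> ((taui ^^ lev x) u) = \<rho> ?b" using same(3)[of u x] r'ne by simp
      then show "u \<in> (tau ^^ lev x) ` {v. \<rho> v = \<rho> ?b}"
        by (intro image_eqI[of _ _ "(taui ^^ lev x) u"]) auto
    next
      fix u assume "u \<in> (tau ^^ lev x) ` {v. \<rho> v = \<rho> ?b}"
      then obtain v where u: "u = (tau ^^ lev x) v" and v: "\<rho> v = \<rho> ?b" by blast
      obtain z where z: "z \<in> \<rho> v" using ne[of v] by blast
      have "r v = r ?b" by (rule r_eqI[of z]) (use sub z v in auto)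
      from lift[OF this] show "u \<in> {v. r' v = r' x}" using v by (simp add: u r'_def)
    qed
    then show ?thesis using matched_image[OF m\<rho>[of ?b], of "lev x"] by (simp add: r'_def)
  qed
  have iff: "S ` r' x \<subseteq> U \<longleftrightarrow> S ` r x \<subseteq> U" for x
    using r'r[of x] r'ne[of x] Sr[of x] by blast
  show "stage T S \<Phi> x0 y0 r' p U"
  proof unfold_locales
    show "Y.tower_partition U (range r')"
      unfolding Y.tower_partition_def
    proof (intro conjI ballI impI)
      fix B assume "B \<in> range r'"
      then obtain x where B: "B = r' x" by blast
      show "clopen B" unfolding B by (rule matched_clopen(2)[OF m'])
      show "B \<noteq> {}" unfolding B by (rule r'ne)
      show "B \<subseteq> U \<or> B \<inter> U = {}" unfolding B using r'r[of x] r_dichotomy[of x] by blast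
      show "S ` B \<subseteq> U \<or> S ` B \<in> range r' \<and> S ` B \<inter> U = {}"
      proof (cases "S ` r x \<subseteq> U")
        case True
        then show ?thesis unfolding B using iff by simp
      next
        case False
        have "S ` r' x \<inter> U = {}" using r'r[of x] Sr[of x] False by blast
        then show ?thesis unfolding B using up[OF False] by (metis rangeI)
      qed
      fix C assume "C \<in> range r'" "B \<inter> C \<noteq> {}"
      then obtain z where C: "C = r' z" "r' x \<inter> r' z \<noteq> {}" unfolding B by blast
      show "B = C" using same(2,3)[OF C(2)] unfolding B C(1) by (simp add: r'_def)
    next
      show "clopen U" by (rule clopen_U)
      have "\<exists>u. y \<in> r' u" for y
      proof -
        obtain x where x: "y \<in> r x" using r_cover by blast
        let ?z = "(Y.Ti ^^ lev x) y"
        obtain v where v: "?z \<in> \<rho> v" using cover by blast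
        have "?z \<in> r ((taui ^^ lev x) x)" using r_taui_pow[OF x, of "lev x"] lev_eq_bt[OF x] by simp
        then have "r v = r ((taui ^^ lev x) x)" using r_eqI sub v by blast
        from lift[OF this] have "r' ((tau ^^ lev x) v) = (S ^^ lev x) ` \<rho> v" .
        moreover have "y \<in> (S ^^ lev x) ` \<rho> v" using v by (intro image_eqI[of _ _ ?z]) auto
        ultimately show ?thesis by blast
      qed
      then show "\<Union> (range r') = UNIV" by auto
    qed
    show "if S ` r' x \<subseteq> U then r' ((T ^^ p x) x) \<subseteq> U else r' ((T ^^ p x) x) = S ` r' x" for x
      using up[of x] r_tau[of x] r'r[of "tau x"] iff[of x] by (auto simp: tau_def split: if_splits)
    show "y0 \<in> r' (T x0)"
    proof -
      have "lev (T x0) = 0" unfolding lev_eq_bt[OF y0(2)] by (rule Y.bt_eqI) (use y0 in auto)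
      then show ?thesis using pts(1) by (simp add: r'_def)
    qed
    show "Y.Ti y0 \<in> r' x0"
      unfolding r'_def using pts(2)
      by (intro image_eqI[of _ _ "(Y.Ti ^^ Suc (lev x0)) y0"]) (simp_all add: funpow_swap1)
  qed (use lr' p bij m' y0 in auto)
qed

section \<open>Shrinking the base\<close>

lemma finite_range_r: "finite (range r)"
  by (rule finite_range_loc_const[OF X.compact_space r])

lemma matched_atoms:
  assumes "P \<subseteq> range r"
  shows "matched {v. r v \<in> P} (\<Union>P)"
  using finite_subset[OF assms finite_range_r] assms
proof (induction P)
  case empty
  then show ?case using matched_empty by simp
next
  case (insert B P)
  then obtain x where B: "B = r x" by blast
  have "matched ({v. r v = B} \<union> {v. r v \<in> P}) (B \<union> \<Union>P)"
  proof (rule matched_Un)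
    show "matched {v. r v = B} B" unfolding B by (rule matched)
    show "matched {v. r v \<in> P} (\<Union>P)" using insert by simp
    show "{v. r v = B} \<inter> {v. r v \<in> P} = {}" using insert.hyps(2) by auto
    have "C = B" if "C \<in> P" "z \<in> B" "z \<in> C" for C z
      using that insert.prems r_eqI[of z x] unfolding B by blast
    then show "B \<inter> \<Union>P = {}" using insert.hyps(2) by blast
  qed
  moreover have "{v. r v = B} \<union> {v. r v \<in> P} = {v. r v \<in> insert B P}" by auto
  ultimately show ?case by simp
qed

text \<open>\<open>rel_unique\<close> turns a cohomology for \<open>S\<close> into one for
  \<open>T\<close>, and cohomologous clopen sets are joined by a speedup. New jumps are produced
  here.\<close>

lemma matched_bij:
  assumes "matched A C" "matched B D" "cohom S (Y.ind C) (Y.ind D)" "B \<noteq> {}"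
  shows "\<exists>q. loc_const q \<and> (\<forall>x. 0 < q x) \<and> bij_betw (\<lambda>x. (T ^^ q x) x) A B"
proof -
  have "\<Phi> (X.ind A) (Y.ind D)"
    using matched_cohom[OF assms(1) matched_clopen(1)[OF assms(1)] matched_clopen(2)[OF assms(2)] cohom_refl assms(3)]
    by (simp add: matched_def)
  moreover have "\<Phi> (X.ind B) (Y.ind D)" using assms(2) by (simp add: matched_def)
  ultimately have "cohom T (X.ind A) (X.ind B)" by (rule rel_unique)
  then show ?thesis
    using X.speedup_between[OF matched_clopen(1)[OF assms(1)] matched_clopen(1)[OF assms(2)] assms(4)] by blast
qed

text \<open>The atoms stay and only jumps into the old base are rebuilt. Atoms of \<open>U\<close>
  outside \<open>U'\<close> turn into higher levels and must now be hit exactly; the remaining tops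
  are joined, as one set, to the new base.\<close>

lemma base_shrink:
  assumes U': "U' \<subseteq> U" "y0 \<in> U'" and tp: "Y.tower_partition U' (range r)"
  shows "\<exists>p'. stage T S \<Phi> x0 y0 r p' U' \<and> (\<forall>x. \<not> S ` r x \<subseteq> U \<longrightarrow> p' x = p x)"
proof -
  note tpD = Y.tower_partitionD[OF tp]
  have cU': "clopen U'" by (rule tpD(1))
  have dich: "r x \<subseteq> U' \<or> r x \<inter> U' = {}" and Sdich: "S ` r x \<subseteq> U' \<or> S ` r x \<in> range r \<and> S ` r x \<inter> U' = {}" for x
    using tpD(6,7)[of "r x"] by auto
  \<comment> \<open>\<open>g\<close> labels where a point has to go and \<open>g'\<close> where a
    point is, with the whole base \<open>U'\<close> merged into \<open>None\<close>. The new map has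
    to carry each set of constant \<open>g\<close> onto the set of the same
    \<open>g'\<close>.\<close>
  define g where "g x = (if S ` r x \<subseteq> U' then None else Some (S ` r x))" for x
  define g' where "g' x = (if r x \<subseteq> U' then None else Some (r x))" for x
  have lg: "loc_const g" unfolding g_def[abs_def] by (rule loc_const_app[OF r])
  have mB: "matched {v. r v \<subseteq> U'} U'"
  proof -
    have "\<Union>{C \<in> range r. C \<subseteq> U'} = U'"
    proof
      show "U' \<subseteq> \<Union>{C \<in> range r. C \<subseteq> U'}"
      proof
        fix y assume y: "y \<in> U'"
        obtain x where "y \<in> r x" using r_cover by blast
        then show "y \<in> \<Union>{C \<in> range r. C \<subseteq> U'}" using dich[of x] y by blast
      qed
    qed blast
    moreover have "{v. r v \<in> {C \<in> range r. C \<subseteq> U'}} = {v. r v \<subseteq> U'}" by auto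
    ultimately show ?thesis using matched_atoms[of "{C \<in> range r. C \<subseteq> U'}"] by simp
  qed
  have mA: "matched {v. S ` r v \<subseteq> U'} {y. S y \<in> U'}"
  proof -
    have "\<Union>{C \<in> range r. S ` C \<subseteq> U'} = {y. S y \<in> U'}"
    proof
      show "{y. S y \<in> U'} \<subseteq> \<Union>{C \<in> range r. S ` C \<subseteq> U'}"
      proof
        fix y assume y: "y \<in> {y. S y \<in> U'}"
        obtain x where "y \<in> r x" using r_cover by blast
        then show "y \<in> \<Union>{C \<in> range r. S ` C \<subseteq> U'}" using Sdich[of x] y by blast
      qed
    qed blast
    moreover have "{v. r v \<in> {C \<in> range r. S ` C \<subseteq> U'}} = {v. S ` r v \<subseteq> U'}" by auto
    ultimately show ?thesis using matched_atoms[of "{C \<in> range r. S ` C \<subseteq> U'}"] by simp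
  qed
  have U'ne: "U' \<noteq> {}" using U'(2) by blast
  have "\<exists>q. loc_const q \<and> (\<forall>x. 0 < q x) \<and> bij_betw (\<lambda>x. (T ^^ q x) x) {v. g v = l} {v. g' v = l} \<and>
      (\<forall>D. l = Some D \<and> \<not> D \<subseteq> U \<longrightarrow> q = p)" if l: "l \<in> range g" for l
  proof (cases l)
    case None
    have "{v. g v = l} = {v. S ` r v \<subseteq> U'}" "{v. g' v = l} = {v. r v \<subseteq> U'}"
      by (auto simp: None g_def g'_def)
    moreover have "{v. r v \<subseteq> U'} \<noteq> {}" using matched_empty_iff[OF mB] U'ne by simp
    moreover have "cohom S (Y.ind {y. S y \<in> U'}) (Y.ind U')"
      using cohom_sym[OF Y.cohom_T[OF loc_const_of_bool[OF cU']]] by simp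
    ultimately show ?thesis using matched_bij[OF mA mB] None by simp
  next
    case (Some D)
    then obtain x where D: "D = S ` r x" "\<not> D \<subseteq> U'" using l by (auto simp: g_def split: if_splits)
    then have DR: "D \<in> range r" using Sdich[of x] by blast
    then obtain d where d: "D = r d" by blast
    have inj: "S ` A = S ` B \<longleftrightarrow> A = B" for A B using Y.bij_T by (simp add: bij_is_inj inj_image_eq_iff)
    have "g v = l \<longleftrightarrow> r v = r x" for v
      using D(2) inj[of "r v" "r x"] unfolding Some g_def D(1) by (cases "S ` r v = S ` r x") simp_all
    then have ge: "{v. g v = l} = {v. r v = r x}" by simp
    have "g' v = l \<longleftrightarrow> r v = r d" for v
      using D(2) unfolding Some g'_def d by (cases "r v = r d") simp_all
    then have g'e: "{v. g' v = l} = {v. r v = r d}" by simp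
    show ?thesis
    proof (cases "D \<subseteq> U")
      \<comment> \<open>The image atom lies in the old base, where \<open>p\<close> only promised
        arrival somewhere in \<open>U\<close>; a jump onto exactly this atom is needed.\<close>
      case True
      have "inj_on (\<lambda>x. (S ^^ 1) x) (r x)" using Y.bij_T by (auto simp: bij_def intro: inj_on_subset)
      from Y.speedup_image(2)[OF r_clopen loc_const_const this]
      have "cohom S (Y.ind (r x)) (Y.ind (S ` r x))" by simp
      then have "cohom S (Y.ind (r x)) (Y.ind (r d))" using D(1) d by simp
      then show ?thesis unfolding ge g'e
        using matched_bij[OF matched[of x] matched[of d]] True Some by auto
    next
      \<comment> \<open>The old jump already maps onto this atom. Keeping \<open>q = p\<close> here
        is what makes the jumps settle in the limit.\<close>
      case False
      have "bij_betw (\<lambda>x. (T ^^ p x) x) {v. r v = r x} {v. r v = r d}"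
        unfolding bij_betw_def
      proof
        show "inj_on (\<lambda>x. (T ^^ p x) x) {v. r v = r x}"
          using bij by (auto simp: bij_def intro: inj_on_subset)
        show "(\<lambda>x. (T ^^ p x) x) ` {v. r v = r x} = {v. r v = r d}"
        proof (rule equalityI; rule subsetI)
          fix u assume "u \<in> (\<lambda>x. (T ^^ p x) x) ` {v. r v = r x}"
          then obtain v where v: "r v = r x" "u = tau v" by (auto simp: tau_def)
          then have "r u = S ` r x" using lev_tau(1)[of v] False D(1) by simp
          then show "u \<in> {v. r v = r d}" using D(1) d by simp
        next
          fix u assume "u \<in> {v. r v = r d}"
          then have u: "r u = S ` r x" "\<not> r u \<subseteq> U" using D(1) d False by auto
          then have "r (taui u) = r x" using r_taui[OF u(2)] inj by simp
          then show "u \<in> (\<lambda>x. (T ^^ p x) x) ` {v. r v = r x}"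
            by (intro image_eqI[of _ _ "taui u"]) (auto simp: tau_def[symmetric])
        qed
      qed
      then show ?thesis unfolding ge g'e using p by blast
    qed
  qed
  then have "\<forall>l\<in>range g. \<exists>q. loc_const q \<and> (\<forall>x. 0 < q x) \<and> bij_betw (\<lambda>x. (T ^^ q x) x) {v. g v = l} {v. g' v = l} \<and>
      (\<forall>D. l = Some D \<and> \<not> D \<subseteq> U \<longrightarrow> q = p)" by (rule ballI)
  from bchoice[OF this] obtain q where q: "\<forall>l\<in>range g. loc_const (q l) \<and> (\<forall>x. 0 < q l x) \<and>
      bij_betw (\<lambda>x. (T ^^ q l x) x) {v. g v = l} {v. g' v = l} \<and>
      (\<forall>D. l = Some D \<and> \<not> D \<subseteq> U \<longrightarrow> q l = p)" ..
  have q: "loc_const (q l)" "0 < q l x" "bij_betw (\<lambda>x. (T ^^ q l x) x) {v. g v = l} {v. g' v = l}"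
    "l = Some D \<Longrightarrow> \<not> D \<subseteq> U \<Longrightarrow> q l = p" if "l \<in> range g" for l x D
    using bspec[OF q that] by simp_all
  define p' where "p' x = q (g x) x" for x
  have lp': "loc_const p'" unfolding loc_const_def
  proof
    fix x
    have "\<forall>\<^sub>F y in nhds x. g y = g x" "\<forall>\<^sub>F y in nhds x. q (g x) y = q (g x) x"
      using lg q(1)[OF rangeI, of x] by (simp_all add: loc_const_def)
    then show "\<forall>\<^sub>F y in nhds x. p' y = p' x" by eventually_elim (simp add: p'_def)
  qed
  have g'g: "g' ((T ^^ p' x) x) = g x" for x
    using bij_betwE[OF q(3)[OF rangeI, of x]] by (simp add: p'_def)
  have inj: "inj (\<lambda>x. (T ^^ p' x) x)"
  proof (rule injI)
    fix x y assume eq: "(T ^^ p' x) x = (T ^^ p' y) y"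
    then have gg: "g x = g y" using g'g[of x] g'g[of y] by simp
    then have "(T ^^ q (g x) x) x = (T ^^ q (g x) y) y" using eq by (simp add: p'_def)
    then show "x = y"
      using bij_betw_imp_inj_on[OF q(3)[OF rangeI, of x]] gg by (auto dest: inj_onD)
  qed
  \<comment> \<open>Every place label also occurs as a destination; otherwise part of the space
    would not be reached.\<close>
  have g'range: "g' u \<in> range g" for u
  proof (cases "r u \<subseteq> U'")
    case True
    have "{v. S ` r v \<subseteq> U'} \<noteq> {}"
    proof -
      have "Y.Ti y0 \<in> {y. S y \<in> U'}" using U'(2) by simp
      then show ?thesis using matched_empty_iff[OF mA] by blast
    qed
    then obtain v where "S ` r v \<subseteq> U'" by blast
    then have "g v = g' u" using True by (simp add: g_def g'_def)
    then show ?thesis by (metis rangeI)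
  next
    case False
    then have disj: "r u \<inter> U' = {}" using dich[of u] by blast
    obtain y where y: "y \<in> r u" using r_nonempty[of u] by blast
    obtain x where x: "Y.Ti y \<in> r x" using r_cover by blast
    then have yS: "y \<in> S ` r x" by (intro image_eqI[of _ _ "Y.Ti y"]) auto
    then have nU: "\<not> S ` r x \<subseteq> U'" using y disj by blast
    then obtain z where z: "S ` r x = r z" using Sdich[of x] by blast
    then have "r u = S ` r x" using r_eqI[OF y, of z] yS by simp
    then have "g x = g' u" using nU False by (simp add: g_def g'_def)
    then show ?thesis by (metis rangeI)
  qed
  have surj: "surj (\<lambda>x. (T ^^ p' x) x)"
    unfolding surj_def
  proof
    fix u
    have "u \<in> {v. g' v = g' u}" by simp
    then have "u \<in> (\<lambda>x. (T ^^ q (g' u) x) x) ` {v. g v = g' u}"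
      using bij_betw_imp_surj_on[OF q(3)[OF g'range[of u]]] by simp
    then obtain v where "g v = g' u" "u = (T ^^ q (g' u) v) v" by blast
    then show "\<exists>v. u = (T ^^ p' v) v" by (metis p'_def)
  qed
  have "stage T S \<Phi> x0 y0 r p' U'"
  proof unfold_locales
    show "bij (\<lambda>x. (T ^^ p' x) x)" using inj surj by (simp add: bij_def)
    show "if S ` r x \<subseteq> U' then r ((T ^^ p' x) x) \<subseteq> U' else r ((T ^^ p' x) x) = S ` r x" for x
      using g'g[of x] by (auto simp: g_def g'_def split: if_splits)
    show "0 < p' x" for x unfolding p'_def by (rule q(2)[OF rangeI])
  qed (use r lp' tp matched U' y0 in auto)
  moreover have "p' x = p x" if "\<not> S ` r x \<subseteq> U" for x
  proof -
    have "g x = Some (S ` r x)" using that U'(1) by (auto simp: g_def)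
    then show ?thesis using q(4)[OF rangeI, of x "S ` r x"] that unfolding p'_def by simp
  qed
  ultimately show ?thesis by blast
qed

section \<open>Refinements prescribed on either side\<close>

lemma atom_pmatched:
  "pmatched (T x0) ((taui ^^ lev x0) x0) y0 ((Y.Ti ^^ Suc (lev x0)) y0) {v. r v = r x} (r x)"
proof -
  have "(Y.Ti ^^ Suc (lev x0)) y0 \<in> r ((taui ^^ lev x0) x0)"
    using r_taui_pow[OF y0(3), of "lev x0"] lev_eq_bt[OF y0(3)] by (simp add: funpow_swap1)
  then show ?thesis
    unfolding pmatched_def using matched[of x] y0(2) r_eqI by fastforce
qed

text \<open>A coincidence would make \<open>x0\<close> or \<open>y0\<close> periodic, since
  \<open>tau\<close> moves points along \<open>T\<close> by positive powers. Distinctness lets a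
  subdivision separate the two marked points.\<close>

lemma points_distinct:
  "T x0 \<noteq> (taui ^^ lev x0) x0" "y0 \<noteq> (Y.Ti ^^ Suc (lev x0)) y0"
proof
  assume eq: "T x0 = (taui ^^ lev x0) x0"
  obtain m where "(tau ^^ lev x0) (T x0) = (T ^^ m) (T x0)" using tau_pow by blast
  then have "(T ^^ Suc m) x0 = x0" by (simp add: eq funpow_swap1)
  then show False using X.aperiodic[of "Suc m" x0] by blast
next
  show "y0 \<noteq> (Y.Ti ^^ Suc (lev x0)) y0"
  proof
    assume "y0 = (Y.Ti ^^ Suc (lev x0)) y0"
    then have "(S ^^ Suc (lev x0)) y0 = y0" by (metis Y.pow_inv_cancel(1))
    then show False using Y.aperiodic[of "Suc (lev x0)" y0] by blast
  qed
qed

lemma refinedD: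
  assumes "refined \<rho>"
  shows "\<rho> v \<subseteq> r v" "\<rho> v \<noteq> {}"
  using assms unfolding refined_def by simp_all

lemma refine_left:
  assumes w: "loc_const w"
  shows "\<exists>\<rho>. refined \<rho> \<and> (\<forall>u v. \<rho> u = \<rho> v \<longrightarrow> w u = w v)"
proof -
  let ?M = "pmatched (T x0) ((taui ^^ lev x0) x0) y0 ((Y.Ti ^^ Suc (lev x0)) y0)"
  have "\<forall>B\<in>range r. \<exists>\<rho>. (\<forall>l\<in>range w. ?M {v \<in> {v. r v = B}. w v = l} (\<rho> l)) \<and>
    disjoint_family_on \<rho> (range w) \<and> (\<Union>l\<in>range w. \<rho> l) = B"
  proof
    fix B assume "B \<in> range r"
    then obtain x where B: "B = r x" by blast
    show "\<exists>\<rho>. (\<forall>l\<in>range w. ?M {v \<in> {v. r v = B}. w v = l} (\<rho> l)) \<and>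
      disjoint_family_on \<rho> (range w) \<and> (\<Union>l\<in>range w. \<rho> l) = B"
      unfolding B by (rule pmatched_partition_left[OF points_distinct atom_pmatched w])
  qed
  from bchoice[OF this] obtain R where "\<forall>B\<in>range r. (\<forall>l\<in>range w. ?M {v \<in> {v. r v = B}. w v = l} (R B l)) \<and>
    disjoint_family_on (R B) (range w) \<and> (\<Union>l\<in>range w. R B l) = B" ..
  note R0 = bspec[OF this rangeI]
  note R = bspec[OF conjunct1[OF R0]] conjunct1[OF conjunct2[OF R0]] conjunct2[OF conjunct2[OF R0]]
  define \<rho> where "\<rho> v = R (r v) (w v)" for v
  have M: "?M {u. r u = r v \<and> w u = w v} (\<rho> v)" for v
    using R(1)[of "w v" v] by (simp add: \<rho>_def)
  have sub: "\<rho> v \<subseteq> r v" for v unfolding \<rho>_def using R(3)[of v] by blast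
  have ne: "\<rho> v \<noteq> {}" for v
    using matched_empty_iff[of "{u. r u = r v \<and> w u = w v}" "\<rho> v"] M[of v] by (auto simp: pmatched_def)
  have eqI: "r u = r v \<and> w u = w v" if "z \<in> \<rho> u" "z \<in> \<rho> v" for u v z
  proof -
    have "r u = r v" using r_eqI sub that by blast
    moreover from this have "w u = w v"
      using R(2)[of v] that unfolding disjoint_family_on_def \<rho>_def by auto
    ultimately show ?thesis by blast
  qed
  have eq: "\<rho> u = \<rho> v \<longleftrightarrow> r u = r v \<and> w u = w v" for u v
    using eqI[of _ u v] ne[of u] by (auto simp: \<rho>_def)
  have "refined \<rho>"
    unfolding refined_def
  proof (intro conjI allI impI)
    show "loc_const \<rho>" unfolding \<rho>_def[abs_def] by (rule loc_const_app2[OF r w])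
    show "\<rho> v \<subseteq> r v" "\<rho> v \<noteq> {}" for v by (rule sub, rule ne)
    show "matched {u. \<rho> u = \<rho> v} (\<rho> v)" for v using M[of v] by (simp add: eq pmatched_def)
    show "\<rho> u = \<rho> v" if "\<rho> u \<inter> \<rho> v \<noteq> {}" for u v using that eqI eq by blast
    show "\<exists>v. y \<in> \<rho> v" for y
    proof -
      obtain x where "y \<in> r x" using r_cover by blast
      then obtain l where l: "l \<in> range w" "y \<in> R (r x) l" using R(3)[of x] by blast
      have "matched {v \<in> {v. r v = r x}. w v = l} (R (r x) l)"
        using R(1)[OF l(1), of x] by (simp add: pmatched_def)
      from matched_empty_iff[OF this] obtain v where "r v = r x" "w v = l" using l(2) by auto
      then have "y \<in> \<rho> v" using l by (simp add: \<rho>_def)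
      then show ?thesis ..
    qed
    show "y0 \<in> \<rho> (T x0)" "(Y.Ti ^^ Suc (lev x0)) y0 \<in> \<rho> ((taui ^^ lev x0) x0)"
      using M[of "T x0"] M[of "(taui ^^ lev x0) x0"] by (simp_all add: pmatched_def)
  qed
  then show ?thesis using eq by blast
qed

text \<open>The partition is prescribed in Y and copied to X. The pieces in Y are cut out exactly by
  \<open>c\<close>, so that they can later be identified with atoms of a given tower
  partition.\<close>

lemma refine_right:
  assumes c: "loc_const c"
  shows "\<exists>\<rho>. refined \<rho> \<and> (\<forall>v. \<exists>l. \<rho> v = {y \<in> r v. c y = l})"
proof -
  let ?M = "pmatched (T x0) ((taui ^^ lev x0) x0) y0 ((Y.Ti ^^ Suc (lev x0)) y0)"
  have "\<forall>B\<in>range r. \<exists>\<alpha>. (\<forall>l\<in>range c. ?M (\<alpha> l) {y \<in> B. c y = l}) \<and>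
    disjoint_family_on \<alpha> (range c) \<and> (\<Union>l\<in>range c. \<alpha> l) = {v. r v = B}"
  proof
    fix B assume "B \<in> range r"
    then obtain x where B: "B = r x" by blast
    show "\<exists>\<alpha>. (\<forall>l\<in>range c. ?M (\<alpha> l) {y \<in> B. c y = l}) \<and>
      disjoint_family_on \<alpha> (range c) \<and> (\<Union>l\<in>range c. \<alpha> l) = {v. r v = B}"
      unfolding B by (rule pmatched_partition_right[OF points_distinct atom_pmatched c])
  qed
  from bchoice[OF this] obtain \<alpha> where "\<forall>B\<in>range r. (\<forall>l\<in>range c. ?M (\<alpha> B l) {y \<in> B. c y = l}) \<and>
    disjoint_family_on (\<alpha> B) (range c) \<and> (\<Union>l\<in>range c. \<alpha> B l) = {v. r v = B}" ..
  note \<alpha>0 = bspec[OF this rangeI]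
  note \<alpha> = bspec[OF conjunct1[OF \<alpha>0]] conjunct1[OF conjunct2[OF \<alpha>0]] conjunct2[OF conjunct2[OF \<alpha>0]]
  \<comment> \<open>The label of the copied piece of X that contains \<open>v\<close>; it replaces
    the labelling that was given from the start in the other direction.\<close>
  define lab where "lab v = (SOME l. l \<in> range c \<and> v \<in> \<alpha> (r v) l)" for v
  have lab: "lab v \<in> range c" "v \<in> \<alpha> (r v) (lab v)" for v
  proof -
    have "\<exists>l. l \<in> range c \<and> v \<in> \<alpha> (r v) l" using \<alpha>(3)[of v] by blast
    from someI_ex[OF this] show "lab v \<in> range c" "v \<in> \<alpha> (r v) (lab v)" by (simp_all add: lab_def)
  qed
  have in\<alpha>: "r u = r v \<and> lab u = l" if "u \<in> \<alpha> (r v) l" "l \<in> range c" for u v l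
  proof -
    have u: "r u = r v" using \<alpha>(3)[of v] that by blast
    have "lab u = l"
    proof (rule ccontr)
      assume "lab u \<noteq> l"
      then have "\<alpha> (r v) (lab u) \<inter> \<alpha> (r v) l = {}"
        by (rule disjoint_family_onD[OF \<alpha>(2) lab(1) that(2)])
      then show False using that(1) lab(2)[of u] u by auto
    qed
    with u show ?thesis by simp
  qed
  define \<rho> where "\<rho> v = {y \<in> r v. c y = lab v}" for v
  have M: "?M (\<alpha> (r v) (lab v)) (\<rho> v)" for v using \<alpha>(1)[OF lab(1), of v] by (simp add: \<rho>_def)
  have ne: "\<rho> v \<noteq> {}" for v
    using matched_empty_iff[of "\<alpha> (r v) (lab v)" "\<rho> v"] M[of v] lab(2)[of v] by (auto simp: pmatched_def)
  have eqI: "r u = r v \<and> lab u = lab v" if "z \<in> \<rho> u" "z \<in> \<rho> v" for u v z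
  proof
    have z: "z \<in> r u" "c z = lab u" "z \<in> r v" "c z = lab v" using that by (simp_all add: \<rho>_def)
    show "r u = r v" by (rule r_eqI[OF z(1,3)])
    show "lab u = lab v" by (rule trans[OF sym[OF z(2)] z(4)])
  qed
  have eq: "\<rho> u = \<rho> v \<longleftrightarrow> r u = r v \<and> lab u = lab v" for u v
  proof
    assume uv: "\<rho> u = \<rho> v"
    obtain z where z: "z \<in> \<rho> u" using ne[of u] by blast
    show "r u = r v \<and> lab u = lab v" by (rule eqI[OF z z[unfolded uv]])
  qed (simp add: \<rho>_def)
  have eq\<alpha>: "{u. \<rho> u = \<rho> v} = \<alpha> (r v) (lab v)" for v
  proof -
    have "u \<in> \<alpha> (r v) (lab v) \<longleftrightarrow> r u = r v \<and> lab u = lab v" for u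
      using in\<alpha>[OF _ lab(1)] lab(2)[of u] by metis
    then show ?thesis unfolding eq by blast
  qed
  have "refined \<rho>"
    unfolding refined_def
  proof (intro conjI allI impI)
    show "loc_const \<rho>" unfolding loc_const_def
    proof
      fix v
      have "clopen {u. \<rho> u = \<rho> v}"
        unfolding eq\<alpha> using M[of v] by (auto simp: pmatched_def dest: matched_clopen(1))
      from spec[OF this[unfolded loc_const_def], of v]
      show "\<forall>\<^sub>F u in nhds v. \<rho> u = \<rho> v" by simp
    qed
    show "\<rho> v \<subseteq> r v" for v unfolding \<rho>_def by blast
    show "\<rho> v \<noteq> {}" for v by (rule ne)
    show "matched {u. \<rho> u = \<rho> v} (\<rho> v)" for v using M[of v] by (simp add: eq\<alpha> pmatched_def)
    show "\<rho> u = \<rho> v" if "\<rho> u \<inter> \<rho> v \<noteq> {}" for u v using that eqI eq by blast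
    show "\<exists>v. y \<in> \<rho> v" for y
    proof -
      obtain x where x: "y \<in> r x" using r_cover by blast
      have "y \<in> {z \<in> r x. c z = c y}" using x by simp
      moreover have "matched (\<alpha> (r x) (c y)) {z \<in> r x. c z = c y}"
        using \<alpha>(1)[of "c y" x] by (simp add: pmatched_def)
      ultimately have "\<alpha> (r x) (c y) \<noteq> {}" using matched_empty_iff by blast
      then obtain v where "v \<in> \<alpha> (r x) (c y)" by blast
      then have "r v = r x \<and> lab v = c y" using in\<alpha> by blast
      then have "y \<in> \<rho> v" using x by (simp add: \<rho>_def)
      then show ?thesis ..
    qed
    show "y0 \<in> \<rho> (T x0)" "(Y.Ti ^^ Suc (lev x0)) y0 \<in> \<rho> ((taui ^^ lev x0) x0)"
      using M[of "T x0"] M[of "(taui ^^ lev x0) x0"] lab(2)[of "T x0"] lab(2)[of "(taui ^^ lev x0) x0"]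
      by (simp_all add: pmatched_def)
  qed
  moreover have "\<forall>v. \<exists>l. \<rho> v = {y \<in> r v. c y = l}" by (auto simp: \<rho>_def)
  ultimately show ?thesis by blast
qed

text \<open>Subdivisions are made at the feet of columns, so the labels met on the way up are
  recorded there: \<open>wd\<close> is the itinerary along \<open>tau\<close> up to the greatest
  level.\<close>

lemma domain_refine:
  assumes w: "loc_const w"
  shows "\<exists>r'. stage T S \<Phi> x0 y0 r' p U \<and> (\<forall>x. r' x \<subseteq> r x) \<and> (\<forall>x x'. r' x = r' x' \<longrightarrow> w x = w x')"
proof -
  obtain N where N: "\<And>x. lev x \<le> N"
    using loc_const_nat_bounded[OF X.compact_space loc_const_lev] by blast
  define wd where "wd v = map (\<lambda>j. w ((tau ^^ j) v)) [0..<Suc N]" for v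
  have "loc_const wd" unfolding wd_def[abs_def] by (intro loc_const_map loc_const_tau_pow[OF w])
  then obtain \<rho> where \<rho>: "refined \<rho>" "\<And>u v. \<rho> u = \<rho> v \<Longrightarrow> wd u = wd v"
    using refine_left[of wd] by blast
  let ?r' = "\<lambda>x. (S ^^ lev x) ` \<rho> ((taui ^^ lev x) x)"
  have "w x = w x'" if eq: "?r' x = ?r' x'" for x x'
  proof -
    obtain z where z: "z \<in> ?r' x" using column_refine(3)[OF \<rho>(1), of x] by blast
    have "r x = r x'"
      by (rule r_eqI[of z]) (use z eq column_refine(2)[OF \<rho>(1)] in blast)+
    then have l: "lev x = lev x'" by (rule lev_cong)
    have "inj (S ^^ lev x)" using Y.inj_pow by (auto intro: injI)
    then have "\<rho> ((taui ^^ lev x) x) = \<rho> ((taui ^^ lev x) x')"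
      using eq unfolding l by (simp add: inj_image_eq_iff)
    then have "wd ((taui ^^ lev x) x) = wd ((taui ^^ lev x) x')" by (rule \<rho>(2))
    then have "wd ((taui ^^ lev x) x) ! lev x = wd ((taui ^^ lev x) x') ! lev x" by simp
    then show ?thesis unfolding wd_def using N[of x] by (simp del: upt_Suc)
  qed
  then show ?thesis using column_refine(1,2)[OF \<rho>(1)] by (intro exI[of _ ?r']) blast
qed

text \<open>A tower partition \<open>Q\<close> over \<open>U'\<close> that refines the old atoms is
  built in Y first. The stage is refined with the old \<open>p\<close> and \<open>U\<close> until
  its atoms are exactly those of \<open>Q\<close>, and the base is shrunk only then, so jumps not
  leading into \<open>U\<close> are never changed.\<close>

lemma codomain_refine:
  assumes c: "loc_const c" and U': "clopen U'" "U' \<subseteq> U" "y0 \<in> U'"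
  shows "\<exists>r' p'. stage T S \<Phi> x0 y0 r' p' U' \<and> (\<forall>x. r' x \<subseteq> r x) \<and>
    (\<forall>x. \<not> S ` r' x \<subseteq> U \<longrightarrow> p' x = p x) \<and> (\<forall>x. \<forall>y\<in>r' x. \<forall>z\<in>r' x. c y = c z)"
proof -
  \<comment> \<open>Making the list of old atoms part of the label forces \<open>Q\<close> to refine
    the range of \<open>r\<close>.\<close>
  define q where "q y = {B \<in> range r. y \<in> B}" for y
  have lq: "loc_const q" unfolding loc_const_def
  proof
    fix y
    have "\<forall>\<^sub>F z in nhds y. \<forall>B\<in>range r. (z \<in> B) = (y \<in> B)"
      by (rule loc_const_ball[OF finite_range_r]) (use r_clopen in auto)
    then show "\<forall>\<^sub>F z in nhds y. q z = q y" by eventually_elim (auto simp: q_def)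
  qed
  have "U' \<noteq> {}" using U'(3) by blast
  then obtain Q where Q: "Y.tower_partition U' Q" "\<forall>B\<in>Q. \<forall>y\<in>B. \<forall>z\<in>B. (c y, q y) = (c z, q z)"
    using Y.tower_partition_exists[OF U'(1) _ loc_const_app2[OF c lq, of Pair]] by blast
  note QD = Y.tower_partitionD[OF Q(1)]
  define a where "a y = (SOME B. B \<in> Q \<and> y \<in> B)" for y
  have a: "a y \<in> Q" "y \<in> a y" for y
  proof -
    have "\<exists>B. B \<in> Q \<and> y \<in> B" using QD(4)[of y] by blast
    from someI_ex[OF this] show "a y \<in> Q" "y \<in> a y" by (simp_all add: a_def)
  qed
  have a_eq: "a z = a y" if "z \<in> a y" for z y
    using QD(5)[OF a(1) a(1) a(2) that] .
  have la: "loc_const a" unfolding loc_const_def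
  proof
    fix y
    have "\<forall>\<^sub>F z in nhds y. z \<in> a y" using QD(2)[OF a(1)] a(2) by (auto simp: clopen_iff intro: eventually_nhds_in_open)
    then show "\<forall>\<^sub>F z in nhds y. a z = a y" by eventually_elim (rule a_eq)
  qed
  obtain \<rho> where \<rho>: "refined \<rho>" "\<And>v. \<exists>l. \<rho> v = {y \<in> r v. a y = l}"
    using refine_right[OF la] by blast
  \<comment> \<open>An atom of \<open>Q\<close> lies within one old atom because \<open>q\<close> is
    constant on it, so cutting \<open>r v\<close> by \<open>a\<close> returns the atom
    whole.\<close>
  have \<rho>Q: "\<rho> v \<in> Q" for v
  proof -
    obtain l where l: "\<rho> v = {y \<in> r v. a y = l}" using \<rho>(2)[of v] by (elim exE)
    obtain y where y: "y \<in> \<rho> v" using refinedD(2)[OF \<rho>(1), of v] by blast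
    then have al: "a y = l" "y \<in> r v" using l by auto
    have in_rv: "z \<in> r v" if "z \<in> a y" for z
    proof -
      have "q z = q y" using Q(2)[rule_format, OF a(1)[of y] that a(2)[of y]] by simp
      moreover have "r v \<in> q y" using al by (simp add: q_def)
      ultimately have "r v \<in> q z" by simp
      then show "z \<in> r v" by (simp add: q_def)
    qed
    have "\<rho> v = a y"
    proof (rule equalityI; rule subsetI)
      fix z assume "z \<in> \<rho> v"
      then have "a z = a y" using l al by simp
      then show "z \<in> a y" using a(2)[of z] by simp
    next
      fix z assume z: "z \<in> a y"
      show "z \<in> \<rho> v" using in_rv[OF z] a_eq[OF z] l al by simp
    qed
    then show ?thesis using a(1)[of y] by simp
  qed
  define r' where "r' = (\<lambda>x. (S ^^ lev x) ` \<rho> ((taui ^^ lev x) x))"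
  have st: "stage T S \<Phi> x0 y0 r' p U" unfolding r'_def by (rule column_refine(1)[OF \<rho>(1)])
  interpret R: stage T S \<Phi> x0 y0 r' p U by (rule st)
  have sub: "r' x \<subseteq> r x" for x unfolding r'_def by (rule column_refine(2)[OF \<rho>(1)])
  \<comment> \<open>Above its foot an old column avoids \<open>U\<close>, hence also
    \<open>U'\<close>; so the image of each piece on the way up is again an atom of
    \<open>Q\<close>.\<close>
  have r'Q: "r' x \<in> Q" for x
  proof -
    let ?b = "(taui ^^ lev x) x"
    have "(S ^^ j) ` \<rho> ?b \<in> Q" if "j \<le> lev x" for j
      using that
    proof (induction j)
      case 0
      then show ?case using \<rho>Q by simp
    next
      case (Suc j)
      let ?C = "(S ^^ j) ` \<rho> ?b"
      have C: "S ` ?C = (S ^^ Suc j) ` \<rho> ?b" by (simp add: image_comp)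
      let ?u = "(taui ^^ (lev x - Suc j)) x"
      have "\<not> r ?u \<subseteq> U" using r_below[of "lev x - Suc j" x] Suc.prems by simp
      then have disj: "r ?u \<inter> U = {}" using r_dichotomy by blast
      obtain y where y: "y \<in> r x" using r_nonempty[of x] by blast
      have "(S ^^ Suc j) ` \<rho> ?b \<subseteq> r ?u"
      proof -
        have 1: "r x = (S ^^ lev x) ` r ?b" by (rule r_lev)
        have "r x = (S ^^ (lev x - Suc j)) ` r ?u"
          using r_taui_pow[OF y, of "lev x - Suc j"] lev_eq_bt[OF y] by simp
        moreover have "(S ^^ lev x) = (S ^^ (lev x - Suc j)) \<circ> (S ^^ Suc j)"
          using funpow_add[of "lev x - Suc j" "Suc j" S] Suc.prems by simp
        ultimately have "(S ^^ (lev x - Suc j)) ` r ?u = (S ^^ (lev x - Suc j)) ` ((S ^^ Suc j) ` r ?b)"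
          using 1 by (simp add: image_comp)
        moreover have "inj (S ^^ (lev x - Suc j))" using Y.inj_pow by (auto intro: injI)
        ultimately have "r ?u = (S ^^ Suc j) ` r ?b" by (simp add: inj_image_eq_iff)
        moreover have "\<rho> ?b \<subseteq> r ?b" by (rule refinedD(1)[OF \<rho>(1)])
        ultimately show ?thesis by (simp add: image_mono)
      qed
      then have "S ` ?C \<inter> U' = {}" unfolding C using disj U'(2) by blast
      moreover have "S ` ?C \<noteq> {}" using \<rho>Q QD(3) by simp
      moreover have "?C \<in> Q" using Suc by simp
      ultimately show ?case using QD(7)[of ?C] unfolding C by blast
    qed
    from this[OF order_refl] show ?thesis by (simp add: r'_def)
  qed
  have "range r' = Q"
  proof
    show "range r' \<subseteq> Q" using r'Q by blast
    show "Q \<subseteq> range r'"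
    proof
      fix B assume B: "B \<in> Q"
      then obtain y where y: "y \<in> B" using QD(3) by blast
      obtain x where x: "y \<in> r' x" using R.r_cover by blast
      have "B = r' x" by (rule QD(5)[OF B r'Q y x])
      then show "B \<in> range r'" by blast
    qed
  qed
  then have "Y.tower_partition U' (range r')" using Q(1) by simp
  then obtain p' where p': "stage T S \<Phi> x0 y0 r' p' U'" "\<forall>x. \<not> S ` r' x \<subseteq> U \<longrightarrow> p' x = p x"
    using R.base_shrink[OF U'(2,3)] by blast
  moreover have "\<forall>x. \<forall>y\<in>r' x. \<forall>z\<in>r' x. c y = c z" using Q(2) r'Q by blast
  ultimately show ?thesis using sub by blast
qed

end

section \<open>Compactness and small atoms\<close>

context minimal_system
begin

lemma nested_closed:
  fixes F :: "nat \<Rightarrow> 'a set"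
  assumes F: "\<And>n. closed (F n)" "\<And>n. F n \<noteq> {}" and anti: "\<And>m n. m \<le> n \<Longrightarrow> F n \<subseteq> F m"
  shows "\<exists>x. \<forall>n. x \<in> F n"
proof (rule ccontr)
  assume "\<nexists>x. \<forall>n. x \<in> F n"
  then have cover: "UNIV \<subseteq> (\<Union>n. - F n)" by blast
  obtain I where I: "finite I" "UNIV \<subseteq> (\<Union>n\<in>I. - F n)"
    by (rule compactE_image[OF compact_space _ cover]) (use F(1) in auto)
  obtain x where x: "x \<in> F (Max (insert 0 I))" using F(2) by blast
  obtain n where n: "n \<in> I" "x \<notin> F n" using I(2) by blast
  have "n \<le> Max (insert 0 I)" using n(1) I(1) by simp
  from anti[OF this] x n(2) show False by blast
qed

text \<open>The label of a point lists the members of a finite clopen cover that contain it; points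
  with equal labels share a member, which lies in a ball of radius \<open>e / 2\<close>.\<close>

lemma fine_labelling:
  fixes e :: real
  assumes "0 < e"
  shows "\<exists>w :: 'a \<Rightarrow> 'a set set. loc_const w \<and> (\<forall>x y. w x = w y \<longrightarrow> dist x y < e)"
proof -
  have "\<forall>x :: 'a. \<exists>V. clopen V \<and> x \<in> V \<and> V \<subseteq> ball x (e / 2)"
  proof
    fix x :: 'a
    obtain V where "clopen V" "x \<in> V" "V \<subseteq> ball x (e / 2)"
      by (rule clopen_nbhd[of "ball x (e / 2)" x]) (use assms in auto)
    then show "\<exists>V. clopen V \<and> x \<in> V \<and> V \<subseteq> ball x (e / 2)" by blast
  qed
  from choice[OF this] obtain V where "\<forall>x :: 'a. clopen (V x) \<and> x \<in> V x \<and> V x \<subseteq> ball x (e / 2)" ..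
  then have V: "clopen (V x)" "x \<in> V x" "V x \<subseteq> ball x (e / 2)" for x by simp_all
  obtain C where C: "finite C" "UNIV \<subseteq> (\<Union>x\<in>C. V x)"
  proof (rule compactE_image[OF compact_space, of UNIV V])
    show "open (V x)" for x using V(1)[of x] by (simp add: clopen_iff)
    show "UNIV \<subseteq> (\<Union>x. V x)" using V(2) by blast
  qed
  define w where "w x = {B \<in> V ` C. x \<in> B}" for x
  have "loc_const w" unfolding loc_const_def
  proof
    fix x
    have "\<forall>\<^sub>F y in nhds x. \<forall>B\<in>V ` C. (y \<in> B) = (x \<in> B)"
      by (rule loc_const_ball) (use C(1) V(1) in auto)
    then show "\<forall>\<^sub>F y in nhds x. w y = w x" by eventually_elim (auto simp: w_def)
  qed
  moreover have "dist x y < e" if "w x = w y" for x y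
  proof -
    obtain z where z: "z \<in> C" "x \<in> V z" using C(2) by blast
    then have "V z \<in> w x" by (simp add: w_def)
    then have "V z \<in> w y" using that by simp
    then have "y \<in> V z" by (simp add: w_def)
    then have "dist z x < e / 2" "dist z y < e / 2" using z V(3)[of z] by auto
    then show ?thesis using dist_triangle_half_r by blast
  qed
  ultimately show ?thesis by blast
qed

end

context stage
begin

lemma next_stage:
  fixes e :: real
  assumes e: "0 < e"
  shows "\<exists>r' p' U'. stage T S \<Phi> x0 y0 r' p' U' \<and> (\<forall>x. r' x \<subseteq> r x) \<and> U' \<subseteq> U \<and> U' \<subseteq> ball y0 e \<and>
    (\<forall>x. \<not> S ` r' x \<subseteq> U \<longrightarrow> p' x = p x) \<and> (\<forall>x x'. r' x = r' x' \<longrightarrow> dist x x' < e) \<and>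
    (\<forall>x. \<forall>y\<in>r' x. \<forall>z\<in>r' x. dist y z < e)"
proof -
  obtain w :: "'a \<Rightarrow> 'a set set" where w: "loc_const w" "\<forall>x y. w x = w y \<longrightarrow> dist x y < e"
    using X.fine_labelling[OF e] by (elim exE conjE)
  obtain c :: "'b \<Rightarrow> 'b set set" where c: "loc_const c" "\<forall>x y. c x = c y \<longrightarrow> dist x y < e"
    using Y.fine_labelling[OF e] by (elim exE conjE)
  obtain r1 where r1: "stage T S \<Phi> x0 y0 r1 p U" "\<forall>x. r1 x \<subseteq> r x" "\<forall>x x'. r1 x = r1 x' \<longrightarrow> w x = w x'"
    using domain_refine[OF w(1)] by (elim exE conjE)
  interpret R1: stage T S \<Phi> x0 y0 r1 p U by (rule r1(1))
  have "open (U \<inter> ball y0 e)" using clopen_U by (simp add: clopen_iff open_Int)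
  then obtain U' where U': "clopen U'" "y0 \<in> U'" "U' \<subseteq> U \<inter> ball y0 e"
    by (rule Y.clopen_nbhd[of _ y0]) (use y0 e in auto)
  have U'U: "U' \<subseteq> U" "U' \<subseteq> ball y0 e" using U'(3) by auto
  obtain r' p' where r': "stage T S \<Phi> x0 y0 r' p' U'" "\<forall>x. r' x \<subseteq> r1 x"
    "\<forall>x. \<not> S ` r' x \<subseteq> U \<longrightarrow> p' x = p x" "\<forall>x. \<forall>y\<in>r' x. \<forall>z\<in>r' x. c y = c z"
    using R1.codomain_refine[OF c(1) U'(1) U'U(1) U'(2)] by (elim exE conjE)
  interpret R': stage T S \<Phi> x0 y0 r' p' U' by (rule r'(1))
  \<comment> \<open>The second refinement only shrinks atoms: points with equal final atoms already
    had equal atoms in \<open>r1\<close>, so the smallness obtained in X persists.\<close>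
  have "dist x x' < e" if "r' x = r' x'" for x x'
  proof -
    obtain z where z: "z \<in> r' x" using R'.r_nonempty[of x] by blast
    have "z \<in> r1 x" using spec[OF r'(2), of x] z by (rule subsetD)
    moreover have "z \<in> r1 x'" using spec[OF r'(2), of x'] z unfolding that by (rule subsetD)
    ultimately have "r1 x = r1 x'" by (rule R1.r_eqI)
    then have "w x = w x'" using r1(3) by blast
    then show ?thesis using w(2) by blast
  qed
  moreover have "\<forall>x. \<forall>y\<in>r' x. \<forall>z\<in>r' x. dist y z < e" using r'(4) c(2) by blast
  moreover have "r' x \<subseteq> r x" for x using order_trans[OF spec[OF r'(2)] spec[OF r1(2)]] .
  ultimately show ?thesis using r'(1,3) U'U
    by (intro exI[of _ r'] exI[of _ p'] exI[of _ U'] conjI allI impI) blast+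
qed

end

section \<open>Passage to the limit\<close>

context exhaustive_relation
begin

text \<open>With the whole space as base the single atom is a top, so the jump 1 commits to
  nothing.\<close>

lemma initial_stage: "stage T S \<Phi> x0 y0 (\<lambda>x. UNIV) (\<lambda>x. 1) UNIV"
proof unfold_locales
  show "bij (\<lambda>x. (T ^^ 1) x)" using X.bij_T by simp
  show "Y.tower_partition UNIV (range (\<lambda>x. UNIV))"
    by (auto simp: Y.tower_partition_def)
qed (use matched_UNIV in auto)

lemma conjugate_speedup: "strong_speedup S T"
proof -
  define x0 :: 'a where "x0 = undefined"
  define y0 :: 'b where "y0 = undefined"
  define P :: "nat \<Rightarrow> ('a \<Rightarrow> 'b set) \<times> ('a \<Rightarrow> nat) \<times> 'b set \<Rightarrow> bool"
    where "P n s \<longleftrightarrow> stage T S \<Phi> x0 y0 (fst s) (fst (snd s)) (snd (snd s))" for n s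
  define Q :: "nat \<Rightarrow> ('a \<Rightarrow> 'b set) \<times> ('a \<Rightarrow> nat) \<times> 'b set \<Rightarrow> ('a \<Rightarrow> 'b set) \<times> ('a \<Rightarrow> nat) \<times> 'b set \<Rightarrow> bool"
    where "Q n s s' \<longleftrightarrow> (\<forall>x. fst s' x \<subseteq> fst s x) \<and> snd (snd s') \<subseteq> snd (snd s) \<and>
      snd (snd s') \<subseteq> ball y0 (inverse (Suc n)) \<and>
      (\<forall>x. \<not> S ` fst s' x \<subseteq> snd (snd s) \<longrightarrow> fst (snd s') x = fst (snd s) x) \<and>
      (\<forall>x x'. fst s' x = fst s' x' \<longrightarrow> dist x x' < inverse (Suc n)) \<and>
      (\<forall>x. \<forall>y\<in>fst s' x. \<forall>z\<in>fst s' x. dist y z < inverse (Suc n))" for n s s'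
  have "\<exists>f. \<forall>n. P n (f n) \<and> Q n (f n) (f (Suc n))"
  proof (rule dependent_nat_choice)
    show "\<exists>s. P 0 s" unfolding P_def
      by (rule exI[of _ "(\<lambda>x. UNIV, \<lambda>x. 1, UNIV)"]) (use initial_stage in simp)
    fix s n assume "P n s"
    then interpret St: stage T S \<Phi> x0 y0 "fst s" "fst (snd s)" "snd (snd s)" unfolding P_def .
    obtain r' p' U' where "stage T S \<Phi> x0 y0 r' p' U' \<and> (\<forall>x. r' x \<subseteq> fst s x) \<and> U' \<subseteq> snd (snd s) \<and>
      U' \<subseteq> ball y0 (inverse (Suc n)) \<and>
      (\<forall>x. \<not> S ` r' x \<subseteq> snd (snd s) \<longrightarrow> p' x = fst (snd s) x) \<and>
      (\<forall>x x'. r' x = r' x' \<longrightarrow> dist x x' < inverse (Suc n)) \<and>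
      (\<forall>x. \<forall>y\<in>r' x. \<forall>z\<in>r' x. dist y z < inverse (Suc n))"
      using St.next_stage[of "inverse (Suc n)"] by (auto simp del: of_nat_Suc)
    then show "\<exists>s'. P (Suc n) s' \<and> Q n s s'"
      unfolding P_def Q_def by (intro exI[of _ "(r', p', U')"]) simp
  qed
  then obtain f where f: "\<And>n. P n (f n)" "\<And>n. Q n (f n) (f (Suc n))" by blast
  define r where "r n = fst (f n)" for n
  define p where "p n = fst (snd (f n))" for n
  define U where "U n = snd (snd (f n))" for n
  have st: "stage T S \<Phi> x0 y0 (r n) (p n) (U n)" for n
    using f(1)[of n] by (simp add: P_def r_def p_def U_def)
  have Suc_r: "r (Suc n) x \<subseteq> r n x" and Suc_U: "U (Suc n) \<subseteq> U n" "U (Suc n) \<subseteq> ball y0 (inverse (Suc n))"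
    and Suc_p: "\<not> S ` r (Suc n) x \<subseteq> U n \<Longrightarrow> p (Suc n) x = p n x"
    and small_X: "r (Suc n) x = r (Suc n) x' \<Longrightarrow> dist x x' < inverse (Suc n)"
    and small_Y: "y \<in> r (Suc n) x \<Longrightarrow> z \<in> r (Suc n) x \<Longrightarrow> dist y z < inverse (Suc n)" for n x x' y z
    using f(2)[of n] unfolding Q_def r_def p_def U_def by simp_all
  have mono_r: "r n x \<subseteq> r m x" if "m \<le> n" for m n x
    by (rule lift_Suc_antimono_le[of "\<lambda>n. r n x", OF Suc_r that])
  have mono_U: "U n \<subseteq> U m" if "m \<le> n" for m n
    by (rule lift_Suc_antimono_le[of U, OF Suc_U(1) that])
  have small: "\<exists>n. inverse (Suc n) < e" if "0 < e" for e :: real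
    using reals_Archimedean[OF that] .
  have r_clopen: "clopen (r n x)" for n x by (rule stage.r_clopen[OF st])

  have ex_h: "\<exists>y. \<forall>n. y \<in> r n x" for x
  proof -
    show ?thesis
      by (rule Y.nested_closed)
        (use r_clopen stage.r_nonempty[OF st] mono_r in \<open>simp_all add: clopen_iff\<close>)
  qed
  define h where "h x = (SOME y. \<forall>n. y \<in> r n x)" for x
  have h: "h x \<in> r n x" for n x
    using someI_ex[OF ex_h[of x]] unfolding h_def by blast
  \<comment> \<open>Late stages are enough because atoms decrease. The bound \<open>k\<close> is for
    the conjugacy equation, which is controlled only once \<open>S (h x)\<close> has left the
    base.\<close>
  have h_eqI: "h x = y" if y: "\<And>n. k \<le> n \<Longrightarrow> y \<in> r n x" for x y k
  proof (rule ccontr)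
    assume "h x \<noteq> y"
    then obtain n where n: "inverse (Suc n) < dist (h x) y" using small[of "dist (h x) y"] by auto
    have "y \<in> r (Suc n) x" using y[of "max k (Suc n)"] mono_r[of "Suc n" "max k (Suc n)" x] by auto
    then have "dist (h x) y < inverse (Suc n)" by (rule small_Y[OF h])
    with n show False by simp
  qed
  have inj: "x = x'" if "h x = h x'" for x x'
  proof (rule ccontr)
    assume "x \<noteq> x'"
    then obtain n where n: "inverse (Suc n) < dist x x'" using small[of "dist x x'"] by auto
    have "r (Suc n) x = r (Suc n) x'"
      by (rule stage.r_eqI[OF st h]) (unfold that, rule h)
    then have "dist x x' < inverse (Suc n)" by (rule small_X)
    with n show False by simp
  qed
  have surj: "\<exists>x. h x = y" for y
  proof -
    have "\<exists>x. \<forall>n. x \<in> {x. y \<in> r n x}"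
    proof (rule X.nested_closed)
      show "closed {x. y \<in> r n x}" for n
        using loc_const_closed[OF stage.r[OF st], of "\<lambda>B. y \<in> B" n] .
      show "{x. y \<in> r n x} \<noteq> {}" for n using stage.r_cover[OF st, of y n] by blast
      show "{x. y \<in> r n x} \<subseteq> {x. y \<in> r m x}" if "m \<le> n" for m n using mono_r[OF that] by blast
    qed
    then obtain x where "\<And>n. y \<in> r n x" by blast
    then have "h x = y" by (intro h_eqI[of 0])
    then show ?thesis ..
  qed
  have cont: "continuous_on UNIV h"
    unfolding continuous_on_iff
  proof (intro ballI allI impI)
    fix x and e :: real assume "0 < e"
    then obtain n where n: "inverse (Suc n) < e" using small by blast
    have "open {u. r (Suc n) u = r (Suc n) x}"
      using loc_const_open[OF stage.r[OF st], of "\<lambda>B. B = r (Suc n) x" "Suc n"] .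
    then obtain d where d: "0 < d" "ball x d \<subseteq> {u. r (Suc n) u = r (Suc n) x}"
      unfolding open_contains_ball by auto
    have "dist (h u) (h x) < e" if "dist u x < d" for u
    proof -
      have "u \<in> ball x d" using that by (simp add: dist_commute)
      then have "r (Suc n) u = r (Suc n) x" using d(2) by blast
      then have "h u \<in> r (Suc n) x" using h[of u "Suc n"] by simp
      then have "dist (h u) (h x) < inverse (Suc n)" by (rule small_Y[OF _ h])
      with n show ?thesis by simp
    qed
    with d(1) show "\<exists>d>0. \<forall>u\<in>UNIV. dist u x < d \<longrightarrow> dist (h u) (h x) < e" by blast
  qed
  have "inj h" "surj h" using inj surj by (auto intro: injI simp: surj_def) metis
  have "\<exists>g. homeomorphism UNIV UNIV h g"
    by (rule homeomorphism_compact[OF X.compact_space cont \<open>surj h\<close> \<open>inj h\<close>])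
  then obtain g where g: "homeomorphism UNIV UNIV h g" by blast
  then have hg: "h (g y) = y" "g (h x) = x" for x y by (auto simp: homeomorphism_def)
  \<comment> \<open>Every stage keeps the two marked pairs together, so the limit maps
    \<open>T x0\<close> to \<open>y0\<close> and \<open>x0\<close> to the preimage of
    \<open>y0\<close>.\<close>
  have hx0: "h (T x0) = y0" "h x0 = Y.Ti y0"
    by (rule h_eqI[of 0], rule stage.y0(2,3)[OF st])+

  have out: "S (h x) \<in> U n \<longleftrightarrow> S ` r n x \<subseteq> U n" for x n
    using stage.Sr[OF st, of n x] h[of x n] by blast
  have ex_out: "\<exists>n. S (h x) \<notin> U n" if "x \<noteq> x0" for x
  proof -
    have "S (h x) \<noteq> y0"
    proof
      assume "S (h x) = y0"
      then have "h x = h x0" using hx0(2) by (metis Y.Ti_T)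
      with inj that show False by blast
    qed
    then obtain n where n: "inverse (Suc n) < dist y0 (S (h x))" using small[of "dist y0 (S (h x))"] by auto
    then have "S (h x) \<notin> U (Suc n)" using Suc_U(2)[of n] by auto
    then show ?thesis by blast
  qed
  have stable: "p n x = p m x" if "S (h x) \<notin> U m" "m \<le> n" for m n x
    using that(2)
  proof (induction n rule: dec_induct)
    case (step n)
    have "S (h x) \<notin> U n" using mono_U[OF step.hyps(1)] that(1) by blast
    then have "\<not> S ` r (Suc n) x \<subseteq> U n" using h[of x "Suc n"] by blast
    then show ?case using Suc_p step.IH by simp
  qed simp
  \<comment> \<open>Away from \<open>x0\<close> the jump is that of the first stage whose base
    misses \<open>S (h x)\<close>, after which it no longer changes. At \<open>x0\<close> this never
    happens, as \<open>S (h x0) = y0\<close> lies in every base; the value 1 is correct there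
    because \<open>h (T x0) = y0\<close>.\<close>
  define q where "q x = (if x = x0 then 1 else p (LEAST n. S (h x) \<notin> U n) x)" for x
  have q_eq: "q x = p n x" if "S (h x) \<notin> U n" "x \<noteq> x0" for n x
  proof -
    have "S (h x) \<notin> U (LEAST n. S (h x) \<notin> U n)" using that(1) by (rule LeastI)
    from stable[OF this Least_le] that show ?thesis by (simp add: q_def)
  qed
  have hT: "h ((T ^^ q x) x) = S (h x)" for x
  proof (cases "x = x0")
    case True
    then show ?thesis by (simp add: q_def hx0)
  next
    case False
    then obtain k where k: "S (h x) \<notin> U k" using ex_out by blast
    show ?thesis
    proof (rule h_eqI)
      fix n assume "k \<le> n"
      then have n: "S (h x) \<notin> U n" using mono_U k by blast
      then have "\<not> S ` r n x \<subseteq> U n" using out by simp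
      then have "r n ((T ^^ p n x) x) = S ` r n x" using stage.step[OF st, of n x] by simp
      then show "S (h x) \<in> r n ((T ^^ q x) x)" using q_eq[OF n False] h[of x n] by simp
    qed
  qed
  have "0 < q x" for x using stage.p(2)[OF st] by (simp add: q_def)
  moreover have "isCont q x" if "x \<noteq> x0" for x
  proof -
    obtain k where k: "S (h x) \<notin> U k" using ex_out \<open>x \<noteq> x0\<close> by blast
    \<comment> \<open>Whether \<open>S (h u)\<close> lies in \<open>U k\<close> depends only on the
      atom \<open>r k u\<close>, so near \<open>x\<close> the single stage \<open>k\<close> supplies
      all values of \<open>q\<close>.\<close>
    have 1: "\<forall>\<^sub>F u in nhds x. r k u = r k x" "\<forall>\<^sub>F u in nhds x. p k u = p k x"
      using stage.r[OF st, of k] stage.p(1)[OF st, of k] by (simp_all add: loc_const_def)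
    have "\<forall>\<^sub>F u in nhds x. u \<noteq> x0" by (rule t1_space_nhds[OF \<open>x \<noteq> x0\<close>])
    with 1 have "\<forall>\<^sub>F u in nhds x. q u = q x"
    proof eventually_elim
      case (elim u)
      then have "S (h u) \<notin> U k" using k out by simp
      then show ?case using q_eq[of u k] q_eq[OF k \<open>x \<noteq> x0\<close>] elim by simp
    qed
    then show ?thesis by (simp add: isCont_nat_iff)
  qed
  moreover have "conjugate S (\<lambda>x. (T ^^ q x) x)"
    unfolding conjugate_def
  proof (intro exI conjI)
    show "is_homeo g" unfolding is_homeo_def using homeomorphism_symD[OF g] by blast
    show "g \<circ> S = (\<lambda>x. (T ^^ q x) x) \<circ> g"
    proof
      fix y
      have "g (S (h (g y))) = (T ^^ q (g y)) (g y)" by (simp only: hT[symmetric] hg(2))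
      then show "(g \<circ> S) y = ((\<lambda>x. (T ^^ q x) x) \<circ> g) y" by (simp add: hg)
    qed
  qed
  ultimately show ?thesis unfolding strong_speedup_def by (intro exI[of _ q]) metis
qed

end

theorem theorem2:
  fixes S :: "'b::metric_space \<Rightarrow> 'b" and T :: "'a::metric_space \<Rightarrow> 'a"
  assumes "minimal_Cantor_system S" and "minimal_Cantor_system T"
  shows "(strong_speedup S T \<longleftrightarrow>
           (\<exists>\<phi>. unital_ordered_epi (dimension_group S) (dimension_group T) \<phi> \<and>
                exhaustive (dimension_group S) (dimension_group T) \<phi>)) \<and>
         ((\<exists>\<phi>. unital_ordered_epi (dimension_group S) (dimension_group T) \<phi> \<and>
                exhaustive (dimension_group S) (dimension_group T) \<phi>) \<longleftrightarrow>
           (\<exists>h :: 'a \<Rightarrow> 'b. is_homeo h \<and> (\<forall>f \<in> cob S. f \<circ> h \<in> cob T)))"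
    (is "(?A \<longleftrightarrow> ?B) \<and> (?B \<longleftrightarrow> ?C)")
proof -
  have X: "minimal_system T" and Y: "minimal_system S"
    using assms by (auto intro: minimal_system.intro)
  have "?A \<Longrightarrow> ?C" by (rule homeo_of_strong_speedup[OF X Y])
  moreover have "?C \<Longrightarrow> ?B" using exhaustive_epi_of_homeo[OF X Y] by blast
  moreover have "?B \<Longrightarrow> ?A"
    using exhaustive_relation.conjugate_speedup[OF exhaustive_relation_of_epi[OF X Y]] by blast
  ultimately show ?thesis by blast
qed

end
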